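(* Let $\mathcal A$ be a (unital) $K$-algebra which is a direct product $\prod_{g\in\Lambda}\mathcal A_g$ of indecomposable unital rings, $\alpha$ a unital partial action of a group $G$ on $\mathcal A$, and $w_i\in Z^n_{par}(G,\mathcal A)$, $i=1,2$, where $n>0$. Suppose that $(\mathcal B,\beta)$ is an enveloping action of $(\mathcal A,\alpha)$ and that $u_i\in Z^n(G,\mathcal M(\mathcal B))$ is a globalization of $w_i$, $i=1,2$. If $w_1$ is cohomologous to $w_2$ (i.e. $w_1-w_2\in B^n_{par}(G,\mathcal A)$), then $u_1$ is cohomologous to $u_2$ (i.e. $u_1-u_2\in B^n(G,\mathcal M(\mathcal B))$). In particular, any two globalizations of the same partial $n$-cocycle are cohomologous.
   Context: $K$ is a commutative unital ring; algebras are associative $K$-algebras, not necessarily commutative. A unital ring is indecomposable if it is nonzero and its only central idempotents are $0$ and $1$. A partial action $\alpha$ of $G$ on an algebra $\mathcal A$ is a family of two-sided ideals $\mathcal D_g$ and algebra isomorphisms $\alpha_g:\mathcal D_{g^{-1}}\to\mathcal D_g$ ($g\in G$) such that $\alpha_1=\mathrm{id}_{\mathcal A}$, and whenever $a\in\mathcal D_{h^{-1}}$ and $\alpha_h(a)\in\mathcal D_{g^{-1}}$, then $a\in\mathcal D_{(gh)^{-1}}$ and $\alpha_g(\alpha_h(a))=\alpha_{gh}(a)$. It is unital if $\mathcal D_g=1_g\mathcal A$ for a central idempotent $1_g$ of $\mathcal A$. Put $1_{(g_1,\dots,g_n)}=1_{g_1}1_{g_1g_2}\cdots1_{g_1\cdots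 g_n}$ and let $C^0_{par}(G,\mathcal A)=\mathcal A$, $C^n_{par}(G,\mathcal A)=\{f:G^n\to\mathcal A\mid f(g_1,\dots,g_n)\in1_{(g_1,\dots,g_n)}\mathcal A\}$ for $n\ge1$. Let $(\delta^0a)(g)=\alpha_g(1_{g^{-1}}a)-1_ga$ and, for $n\ge1$, $$(\delta^nf)(g_1,\dots,g_{n+1})=\alpha_{g_1}(1_{g_1^{-1}}f(g_2,\dots,g_{n+1}))+\sum_{i=1}^n(-1)^i1_{g_1\cdots g_i}f(g_1,\dots,g_ig_{i+1},\dots,g_{n+1})+(-1)^{n+1}1_{g_1\cdots g_{n+1}}f(g_1,\dots,g_n).$$ $Z^n_{par}(G,\mathcal A)=\ker\delta^n$ and $B^n_{par}(G,\mathcal A)=\mathrm{im}\,\delta^{n-1}$. An enveloping action of $(\mathcal A,\alpha)$ is a (global) action $\beta$ of $G$ by automorphisms on an algebra $\mathcal B$ (possibly without $1$) with an injective algebra homomorphism $\varphi:\mathcal A\to\mathcal B$ such that $\varphi(\mathcal A)$ is a two-sided ideal of $\mathcal B$, $\mathcal B=\sum_{g\in G}\beta_g(\varphi(\mathcal A))$, $\varphi(\mathcal D_g)=\varphi(\mathcal A)\cap\beta_g(\varphi(\mathcal A))$, and $\varphi\circ\alpha_g=\beta_g\circ\varphi$ on $\mathcal D_{g^{-1}}$. The multiplier algebra is $\mathcal M(\mathcal B)=\{(R,L)\in\mathrm{End}({}_{\mathcal B}\mathcal B)\times\mathrm{End}(\mathcal B_{\mathcal B}) : (aR)b=a(Lb)\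 \forall a,b\in\mathcal B\}$ (left module maps written on the right); for $\gamma=(R,L)$ write $b\gamma=bR$, $\gamma b=Lb$. $G$ acts on it by $\beta^*_g(u)=\beta_gu\beta_g^{-1}$. $Z^n(G,\mathcal M(\mathcal B))$ and $B^n(G,\mathcal M(\mathcal B))$ are the groups of classical $n$-cocycles and $n$-coboundaries of $G$ with values in the additive group of $\mathcal M(\mathcal B)$ with this action. A globalization of $w\in Z^n_{par}(G,\mathcal A)$ is $u\in Z^n(G,\mathcal M(\mathcal B))$ with $\varphi(w(g_1,\dots,g_n))=\varphi(1_{(g_1,\dots,g_n)})u(g_1,\dots,g_n)$ for all $g_1,\dots,g_n\in G$. *)

theory Defs
  imports "HOL-Algebra.Algebra"
begin

section \<open>Algebras over a commutative ring\<close>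

text \<open>
  The locale \<^locale>\<open>algebra\<close> of the library covers commutative unital algebras only.
  In the non-unital case the field \<^const>\<open>one\<close> of the record carries no information.
\<close>

locale nonunital_algebra = module K B for K (structure) and B (structure) +
  assumes mult_closed: "\<lbrakk>x \<in> carrier B; y \<in> carrier B\<rbrakk> \<Longrightarrow> x \<otimes>\<^bsub>B\<^esub> y \<in> carrier B"
    and mult_assoc: "\<lbrakk>x \<in> carrier B; y \<in> carrier B; z \<in> carrier B\<rbrakk>
      \<Longrightarrow> (x \<otimes>\<^bsub>B\<^esub> y) \<otimes>\<^bsub>B\<^esub> z = x \<otimes>\<^bsub>B\<^esub> (y \<otimes>\<^bsub>B\<^esub> z)"
    and mult_l_distr: "\<lbrakk>x \<in> carrier B; y \<in> carrier B; z \<in> carrier B\<rbrakk>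
      \<Longrightarrow> (x \<oplus>\<^bsub>B\<^esub> y) \<otimes>\<^bsub>B\<^esub> z = x \<otimes>\<^bsub>B\<^esub> z \<oplus>\<^bsub>B\<^esub> y \<otimes>\<^bsub>B\<^esub> z"
    and mult_r_distr: "\<lbrakk>x \<in> carrier B; y \<in> carrier B; z \<in> carrier B\<rbrakk>
      \<Longrightarrow> x \<otimes>\<^bsub>B\<^esub> (y \<oplus>\<^bsub>B\<^esub> z) = x \<otimes>\<^bsub>B\<^esub> y \<oplus>\<^bsub>B\<^esub> x \<otimes>\<^bsub>B\<^esub> z"
    and smult_mult_l: "\<lbrakk>k \<in> carrier K; x \<in> carrier B; y \<in> carrier B\<rbrakk>
      \<Longrightarrow> (k \<odot>\<^bsub>B\<^esub> x) \<otimes>\<^bsub>B\<^esub> y = k \<odot>\<^bsub>B\<^esub> (x \<otimes>\<^bsub>B\<^esub> y)"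
    and smult_mult_r: "\<lbrakk>k \<in> carrier K; x \<in> carrier B; y \<in> carrier B\<rbrakk>
      \<Longrightarrow> x \<otimes>\<^bsub>B\<^esub> (k \<odot>\<^bsub>B\<^esub> y) = k \<odot>\<^bsub>B\<^esub> (x \<otimes>\<^bsub>B\<^esub> y)"

locale unital_algebra = nonunital_algebra K A + monoid A for K (structure) and A (structure)

lemma (in unital_algebra) ring_A: "ring A"
  by (intro ringI M.abelian_group_axioms monoid_axioms mult_l_distr mult_r_distr)

text \<open>Homomorphisms of not necessarily unital algebras; units need not be preserved.\<close>

definition algebra_hom ::
  "('k, 'p) ring_scheme \<Rightarrow> ('k, 'a, 'q) module_scheme \<Rightarrow> ('k, 'b, 'r) module_scheme \<Rightarrow> ('a \<Rightarrow> 'b) set"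
  where "algebra_hom K A B = {h \<in> carrier A \<rightarrow> carrier B.
    (\<forall>x\<in>carrier A. \<forall>y\<in>carrier A. h (x \<oplus>\<^bsub>A\<^esub> y) = h x \<oplus>\<^bsub>B\<^esub> h y) \<and>
    (\<forall>x\<in>carrier A. \<forall>y\<in>carrier A. h (x \<otimes>\<^bsub>A\<^esub> y) = h x \<otimes>\<^bsub>B\<^esub> h y) \<and>
    (\<forall>k\<in>carrier K. \<forall>x\<in>carrier A. h (k \<odot>\<^bsub>A\<^esub> x) = k \<odot>\<^bsub>B\<^esub> h x)}"

definition algebra_iso ::
  "('k, 'p) ring_scheme \<Rightarrow> ('k, 'a, 'q) module_scheme \<Rightarrow> ('k, 'b, 'r) module_scheme \<Rightarrow> ('a \<Rightarrow> 'b) set"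
  where "algebra_iso K A B = {h \<in> algebra_hom K A B. bij_betw h (carrier A) (carrier B)}"

text \<open>The library locale \<^locale>\<open>ideal\<close> requires an ambient ring with unit.\<close>

definition two_sided_ideal ::
  "('k, 'p) ring_scheme \<Rightarrow> ('k, 'b, 'q) module_scheme \<Rightarrow> 'b set \<Rightarrow> bool"
  where "two_sided_ideal K B I \<longleftrightarrow> submodule I K B \<and>
    (\<forall>x\<in>I. \<forall>b\<in>carrier B. b \<otimes>\<^bsub>B\<^esub> x \<in> I \<and> x \<otimes>\<^bsub>B\<^esub> b \<in> I)"

definition central_idempotent :: "('a, 'q) ring_scheme \<Rightarrow> 'a \<Rightarrow> bool"
  where "central_idempotent R e \<longleftrightarrow>
    e \<in> carrier R \<and> e \<otimes>\<^bsub>R\<^esub> e = e \<and> (\<forall>x\<in>carrier R. e \<otimes>\<^bsub>R\<^esub> x = x \<otimes>\<^bsub>R\<^esub> e)"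

definition indecomposable_ring :: "('a, 'q) ring_scheme \<Rightarrow> bool"
  where "indecomposable_ring R \<longleftrightarrow> ring R \<and> \<one>\<^bsub>R\<^esub> \<noteq> \<zero>\<^bsub>R\<^esub> \<and>
    (\<forall>e. central_idempotent R e \<longrightarrow> e = \<zero>\<^bsub>R\<^esub> \<or> e = \<one>\<^bsub>R\<^esub>)"

definition product_ring :: "'l set \<Rightarrow> ('l \<Rightarrow> ('c, 'q) ring_scheme) \<Rightarrow> ('l \<Rightarrow> 'c) ring"
  where "product_ring \<Lambda> S =
    \<lparr>carrier = (\<Pi>\<^sub>E l\<in>\<Lambda>. carrier (S l)),
     monoid.mult = (\<lambda>x y. \<lambda>l\<in>\<Lambda>. x l \<otimes>\<^bsub>S l\<^esub> y l),
     monoid.one = (\<lambda>l\<in>\<Lambda>. \<one>\<^bsub>S l\<^esub>),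
     ring.zero = (\<lambda>l\<in>\<Lambda>. \<zero>\<^bsub>S l\<^esub>),
     ring.add = (\<lambda>x y. \<lambda>l\<in>\<Lambda>. x l \<oplus>\<^bsub>S l\<^esub> y l)\<rparr>"


section \<open>Partial actions and enveloping actions\<close>

locale partial_action = A: unital_algebra K A + G: group G
  for K (structure) and A (structure) and G (structure)
    and D and \<alpha> +
  assumes ideal_D: "g \<in> carrier G \<Longrightarrow> ideal (D g) A"
    and iso: "g \<in> carrier G \<Longrightarrow>
      \<alpha> g \<in> algebra_iso K (A\<lparr>carrier := D (inv\<^bsub>G\<^esub> g)\<rparr>) (A\<lparr>carrier := D g\<rparr>)"
    and D_one: "D \<one>\<^bsub>G\<^esub> = carrier A"
    and act_one: "a \<in> carrier A \<Longrightarrow> \<alpha> \<one>\<^bsub>G\<^esub> a = a"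
    and comp_dom: "\<lbrakk>g \<in> carrier G; h \<in> carrier G; a \<in> D (inv\<^bsub>G\<^esub> h); \<alpha> h a \<in> D (inv\<^bsub>G\<^esub> g)\<rbrakk>
      \<Longrightarrow> a \<in> D (inv\<^bsub>G\<^esub> (g \<otimes>\<^bsub>G\<^esub> h))"
    and comp: "\<lbrakk>g \<in> carrier G; h \<in> carrier G; a \<in> D (inv\<^bsub>G\<^esub> h); \<alpha> h a \<in> D (inv\<^bsub>G\<^esub> g)\<rbrakk>
      \<Longrightarrow> \<alpha> g (\<alpha> h a) = \<alpha> (g \<otimes>\<^bsub>G\<^esub> h) a"

text \<open>
  The idempotent generating \<open>D g\<close> (written \<open>1\<^sub>g\<close> in the literature) is uniquely determined
  by \<open>D g\<close>; it is carried as the parameter \<open>e g\<close>.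
\<close>

locale unital_partial_action = partial_action K A G D \<alpha>
  for K (structure) and A (structure) and G (structure)
    and D and \<alpha> and e +
  assumes idem: "g \<in> carrier G \<Longrightarrow> central_idempotent A (e g)"
    and D_eq: "g \<in> carrier G \<Longrightarrow> D g = (\<lambda>a. e g \<otimes>\<^bsub>A\<^esub> a) ` carrier A"

text \<open>
  The library locale \<^locale>\<open>group_action\<close> makes each \<open>\<beta> g\<close> an extensional permutation
  of the carrier, i.e. undefined outside it.
\<close>

definition global_action ::
  "('k, 'p) ring_scheme \<Rightarrow> ('k, 'b, 'q) module_scheme \<Rightarrow> ('g, 'r) monoid_scheme \<Rightarrow> ('g \<Rightarrow> 'b \<Rightarrow> 'b) \<Rightarrow> bool"
  where "global_action K B G \<beta> \<longleftrightarrow> nonunital_algebra K B \<and> group_action G (carrier B) \<beta> \<and>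
    (\<forall>g\<in>carrier G. \<beta> g \<in> algebra_iso K B B)"

definition enveloping_action ::
  "('k, 'p) ring_scheme \<Rightarrow> ('k, 'a, 'q) module_scheme \<Rightarrow> ('g, 'r) monoid_scheme
   \<Rightarrow> ('g \<Rightarrow> 'a set) \<Rightarrow> ('g \<Rightarrow> 'a \<Rightarrow> 'a)
   \<Rightarrow> ('k, 'b, 's) module_scheme \<Rightarrow> ('g \<Rightarrow> 'b \<Rightarrow> 'b) \<Rightarrow> ('a \<Rightarrow> 'b) \<Rightarrow> bool"
  where "enveloping_action K A G D \<alpha> B \<beta> \<phi> \<longleftrightarrow>
    global_action K B G \<beta> \<and>
    \<phi> \<in> algebra_hom K A B \<and> inj_on \<phi> (carrier A) \<and>
    two_sided_ideal K B (\<phi> ` carrier A) \<and>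
    carrier B = {finsum B b F | F b. finite F \<and> F \<subseteq> carrier G \<and>
                   b \<in> (\<Pi> g\<in>F. \<beta> g ` \<phi> ` carrier A)} \<and>
    (\<forall>g\<in>carrier G. \<phi> ` D g = \<phi> ` carrier A \<inter> \<beta> g ` \<phi> ` carrier A) \<and>
    (\<forall>g\<in>carrier G. \<forall>a\<in>D (inv\<^bsub>G\<^esub> g). \<phi> (\<alpha> g a) = \<beta> g (\<phi> a))"


section \<open>The multiplier algebra\<close>

text \<open>
  Endomorphisms of modules over a \<open>K\<close>-algebra are \<open>K\<close>-linear. They are represented by
  functions that are undefined outside the carrier.
\<close>

definition linear_endos ::
  "('k, 'p) ring_scheme \<Rightarrow> ('k, 'b, 'q) module_scheme \<Rightarrow> ('b \<Rightarrow> 'b) set"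
  where "linear_endos K B = {T \<in> carrier B \<rightarrow>\<^sub>E carrier B.
    (\<forall>x\<in>carrier B. \<forall>y\<in>carrier B. T (x \<oplus>\<^bsub>B\<^esub> y) = T x \<oplus>\<^bsub>B\<^esub> T y) \<and>
    (\<forall>k\<in>carrier K. \<forall>x\<in>carrier B. T (k \<odot>\<^bsub>B\<^esub> x) = k \<odot>\<^bsub>B\<^esub> T x)}"

definition left_module_endos ::
  "('k, 'p) ring_scheme \<Rightarrow> ('k, 'b, 'q) module_scheme \<Rightarrow> ('b \<Rightarrow> 'b) set"
  where "left_module_endos K B =
    {R \<in> linear_endos K B. \<forall>x\<in>carrier B. \<forall>y\<in>carrier B. R (x \<otimes>\<^bsub>B\<^esub> y) = x \<otimes>\<^bsub>B\<^esub> R y}"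

definition right_module_endos ::
  "('k, 'p) ring_scheme \<Rightarrow> ('k, 'b, 'q) module_scheme \<Rightarrow> ('b \<Rightarrow> 'b) set"
  where "right_module_endos K B =
    {L \<in> linear_endos K B. \<forall>x\<in>carrier B. \<forall>y\<in>carrier B. L (x \<otimes>\<^bsub>B\<^esub> y) = L x \<otimes>\<^bsub>B\<^esub> y}"

text \<open>
  In a multiplier \<open>(R, L)\<close> the map \<open>R\<close> acts from the right, so the first component of a
  product is the composite of the first components in the opposite order.
\<close>

definition multiplier_algebra ::
  "('k, 'p) ring_scheme \<Rightarrow> ('k, 'b, 'q) module_scheme \<Rightarrow> ('k, ('b \<Rightarrow> 'b) \<times> ('b \<Rightarrow> 'b)) module"
  where "multiplier_algebra K B =
    \<lparr>carrier = {(R, L) \<in> left_module_endos K B \<times> right_module_endos K B.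
        \<forall>a\<in>carrier B. \<forall>b\<in>carrier B. R a \<otimes>\<^bsub>B\<^esub> b = a \<otimes>\<^bsub>B\<^esub> L b},
     monoid.mult = (\<lambda>(R, L) (R', L'). (\<lambda>b\<in>carrier B. R' (R b), \<lambda>b\<in>carrier B. L (L' b))),
     monoid.one = (\<lambda>b\<in>carrier B. b, \<lambda>b\<in>carrier B. b),
     ring.zero = (\<lambda>b\<in>carrier B. \<zero>\<^bsub>B\<^esub>, \<lambda>b\<in>carrier B. \<zero>\<^bsub>B\<^esub>),
     ring.add = (\<lambda>(R, L) (R', L'). (\<lambda>b\<in>carrier B. R b \<oplus>\<^bsub>B\<^esub> R' b, \<lambda>b\<in>carrier B. L b \<oplus>\<^bsub>B\<^esub> L' b)),
     module.smult = (\<lambda>k (R, L). (\<lambda>b\<in>carrier B. k \<odot>\<^bsub>B\<^esub> R b, \<lambda>b\<in>carrier B. k \<odot>\<^bsub>B\<^esub> L b))\<rparr>"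

text \<open>The element \<open>b \<gamma> = b R\<close> for \<open>\<gamma> = (R, L)\<close>.\<close>

definition right_mult :: "'b \<Rightarrow> ('b \<Rightarrow> 'b) \<times> ('b \<Rightarrow> 'b) \<Rightarrow> 'b"
  where "right_mult b \<gamma> = fst \<gamma> b"

text \<open>Conjugation of both components by the automorphism \<open>\<beta> g\<close>.\<close>

definition multiplier_action ::
  "('b, 'q) ring_scheme \<Rightarrow> ('g \<Rightarrow> 'b \<Rightarrow> 'b) \<Rightarrow> 'g \<Rightarrow> ('b \<Rightarrow> 'b) \<times> ('b \<Rightarrow> 'b) \<Rightarrow> ('b \<Rightarrow> 'b) \<times> ('b \<Rightarrow> 'b)"
  where "multiplier_action B \<beta> g = (\<lambda>(R, L).
    (\<lambda>b\<in>carrier B. \<beta> g (R (inv_into (carrier B) (\<beta> g) b)),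
     \<lambda>b\<in>carrier B. \<beta> g (L (inv_into (carrier B) (\<beta> g) b))))"


section \<open>Cochains\<close>

text \<open>
  An \<open>n\<close>-tuple of group elements is a list of length \<open>n\<close>, and an \<open>n\<close>-cochain is a function on
  such lists, undefined elsewhere. A \<open>0\<close>-cochain, i.e. an element of the coefficients, is thus
  represented by its value at the empty list.
\<close>

definition tuples :: "('g, 'r) monoid_scheme \<Rightarrow> nat \<Rightarrow> 'g list set"
  where "tuples G n = {gs. set gs \<subseteq> carrier G \<and> length gs = n}"

definition mult_list :: "('g, 'r) monoid_scheme \<Rightarrow> 'g list \<Rightarrow> 'g"
  where "mult_list G gs = foldr (\<otimes>\<^bsub>G\<^esub>) gs \<one>\<^bsub>G\<^esub>"

text \<open>\<open>(g\<^sub>1, \<dots>, g\<^sub>i g\<^bsub>i+1\<^esub>, \<dots>, g\<^bsub>n+1\<^esub>)\<close>, with entries counted from \<open>1\<close>.\<close>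

definition merge :: "('g, 'r) monoid_scheme \<Rightarrow> nat \<Rightarrow> 'g list \<Rightarrow> 'g list"
  where "merge G i gs = take (i - 1) gs @ [gs ! (i - 1) \<otimes>\<^bsub>G\<^esub> gs ! i] @ drop (i + 1) gs"

text \<open>\<open>(-1)\<^sup>i x\<close>\<close>

definition alt_sign :: "('a, 'q) ring_scheme \<Rightarrow> nat \<Rightarrow> 'a \<Rightarrow> 'a"
  where "alt_sign M i x = (if even i then x else \<ominus>\<^bsub>M\<^esub> x)"

definition cochain_diff ::
  "('a, 'q) ring_scheme \<Rightarrow> ('g, 'r) monoid_scheme \<Rightarrow> nat \<Rightarrow> ('g list \<Rightarrow> 'a) \<Rightarrow> ('g list \<Rightarrow> 'a) \<Rightarrow> 'g list \<Rightarrow> 'a"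
  where "cochain_diff M G n f f' = (\<lambda>gs\<in>tuples G n. f gs \<ominus>\<^bsub>M\<^esub> f' gs)"

subsection \<open>Classical cochains with values in the additive group of \<open>M\<close>, with action \<open>\<sigma>\<close>\<close>

definition cochains :: "('m, 'q) ring_scheme \<Rightarrow> ('g, 'r) monoid_scheme \<Rightarrow> nat \<Rightarrow> ('g list \<Rightarrow> 'm) set"
  where "cochains M G n = tuples G n \<rightarrow>\<^sub>E carrier M"

definition coboundary_map ::
  "('m, 'q) ring_scheme \<Rightarrow> ('g, 'r) monoid_scheme \<Rightarrow> ('g \<Rightarrow> 'm \<Rightarrow> 'm) \<Rightarrow> nat
   \<Rightarrow> ('g list \<Rightarrow> 'm) \<Rightarrow> 'g list \<Rightarrow> 'm"
  where "coboundary_map M G \<sigma> n f = (\<lambda>gs\<in>tuples G (Suc n).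
    \<sigma> (hd gs) (f (tl gs))
    \<oplus>\<^bsub>M\<^esub> (\<Oplus>\<^bsub>M\<^esub>i\<in>{1..n}. alt_sign M i (f (merge G i gs)))
    \<oplus>\<^bsub>M\<^esub> alt_sign M (Suc n) (f (butlast gs)))"

definition cocycles ::
  "('m, 'q) ring_scheme \<Rightarrow> ('g, 'r) monoid_scheme \<Rightarrow> ('g \<Rightarrow> 'm \<Rightarrow> 'm) \<Rightarrow> nat \<Rightarrow> ('g list \<Rightarrow> 'm) set"
  where "cocycles M G \<sigma> n =
    {f \<in> cochains M G n. \<forall>gs\<in>tuples G (Suc n). coboundary_map M G \<sigma> n f gs = \<zero>\<^bsub>M\<^esub>}"

text \<open>Coboundaries, here and in the partial case, are only meaningful for \<open>n > 0\<close>.\<close>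

definition coboundaries ::
  "('m, 'q) ring_scheme \<Rightarrow> ('g, 'r) monoid_scheme \<Rightarrow> ('g \<Rightarrow> 'm \<Rightarrow> 'm) \<Rightarrow> nat \<Rightarrow> ('g list \<Rightarrow> 'm) set"
  where "coboundaries M G \<sigma> n = coboundary_map M G \<sigma> (n - 1) ` cochains M G (n - 1)"

definition cohomologous ::
  "('m, 'q) ring_scheme \<Rightarrow> ('g, 'r) monoid_scheme \<Rightarrow> ('g \<Rightarrow> 'm \<Rightarrow> 'm) \<Rightarrow> nat
   \<Rightarrow> ('g list \<Rightarrow> 'm) \<Rightarrow> ('g list \<Rightarrow> 'm) \<Rightarrow> bool"
  where "cohomologous M G \<sigma> n f f' \<longleftrightarrow> cochain_diff M G n f f' \<in> coboundaries M G \<sigma> n"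

subsection \<open>Partial cochains\<close>

text \<open>\<open>1\<^bsub>(g\<^sub>1,\<dots>,g\<^sub>n)\<^esub> = 1\<^bsub>g\<^sub>1\<^esub> 1\<^bsub>g\<^sub>1g\<^sub>2\<^esub> \<dots> 1\<^bsub>g\<^sub>1\<dots>g\<^sub>n\<^esub>\<close>; it is \<open>\<one>\<close> for the empty tuple.\<close>

definition tuple_idem ::
  "('a, 'q) ring_scheme \<Rightarrow> ('g, 'r) monoid_scheme \<Rightarrow> ('g \<Rightarrow> 'a) \<Rightarrow> 'g list \<Rightarrow> 'a"
  where "tuple_idem A G e gs =
    mult_list A (map (\<lambda>i. e (mult_list G (take i gs))) [1..<Suc (length gs)])"

definition par_cochains ::
  "('a, 'q) ring_scheme \<Rightarrow> ('g, 'r) monoid_scheme \<Rightarrow> ('g \<Rightarrow> 'a) \<Rightarrow> nat \<Rightarrow> ('g list \<Rightarrow> 'a) set"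
  where "par_cochains A G e n =
    (\<Pi>\<^sub>E gs\<in>tuples G n. (\<lambda>a. tuple_idem A G e gs \<otimes>\<^bsub>A\<^esub> a) ` carrier A)"

definition par_coboundary_map ::
  "('a, 'q) ring_scheme \<Rightarrow> ('g, 'r) monoid_scheme \<Rightarrow> ('g \<Rightarrow> 'a \<Rightarrow> 'a) \<Rightarrow> ('g \<Rightarrow> 'a) \<Rightarrow> nat
   \<Rightarrow> ('g list \<Rightarrow> 'a) \<Rightarrow> 'g list \<Rightarrow> 'a"
  where "par_coboundary_map A G \<alpha> e n f = (\<lambda>gs\<in>tuples G (Suc n).
    \<alpha> (hd gs) (e (inv\<^bsub>G\<^esub> (hd gs)) \<otimes>\<^bsub>A\<^esub> f (tl gs))
    \<oplus>\<^bsub>A\<^esub> (\<Oplus>\<^bsub>A\<^esub>i\<in>{1..n}. alt_sign A i (e (mult_list G (take i gs)) \<otimes>\<^bsub>A\<^esub> f (merge G i gs)))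
    \<oplus>\<^bsub>A\<^esub> alt_sign A (Suc n) (e (mult_list G gs) \<otimes>\<^bsub>A\<^esub> f (butlast gs)))"

definition par_cocycles ::
  "('a, 'q) ring_scheme \<Rightarrow> ('g, 'r) monoid_scheme \<Rightarrow> ('g \<Rightarrow> 'a \<Rightarrow> 'a) \<Rightarrow> ('g \<Rightarrow> 'a) \<Rightarrow> nat
   \<Rightarrow> ('g list \<Rightarrow> 'a) set"
  where "par_cocycles A G \<alpha> e n =
    {f \<in> par_cochains A G e n. \<forall>gs\<in>tuples G (Suc n). par_coboundary_map A G \<alpha> e n f gs = \<zero>\<^bsub>A\<^esub>}"

definition par_coboundaries ::
  "('a, 'q) ring_scheme \<Rightarrow> ('g, 'r) monoid_scheme \<Rightarrow> ('g \<Rightarrow> 'a \<Rightarrow> 'a) \<Rightarrow> ('g \<Rightarrow> 'a) \<Rightarrow> nat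
   \<Rightarrow> ('g list \<Rightarrow> 'a) set"
  where "par_coboundaries A G \<alpha> e n = par_coboundary_map A G \<alpha> e (n - 1) ` par_cochains A G e (n - 1)"

definition par_cohomologous ::
  "('a, 'q) ring_scheme \<Rightarrow> ('g, 'r) monoid_scheme \<Rightarrow> ('g \<Rightarrow> 'a \<Rightarrow> 'a) \<Rightarrow> ('g \<Rightarrow> 'a) \<Rightarrow> nat
   \<Rightarrow> ('g list \<Rightarrow> 'a) \<Rightarrow> ('g list \<Rightarrow> 'a) \<Rightarrow> bool"
  where "par_cohomologous A G \<alpha> e n w w' \<longleftrightarrow> cochain_diff A G n w w' \<in> par_coboundaries A G \<alpha> e n"

subsection \<open>Globalizations\<close>

definition globalization ::
  "('k, 'p) ring_scheme \<Rightarrow> ('k, 'a, 'q) module_scheme \<Rightarrow> ('g, 'r) monoid_scheme \<Rightarrow> ('g \<Rightarrow> 'a)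
   \<Rightarrow> ('k, 'b, 's) module_scheme \<Rightarrow> ('g \<Rightarrow> 'b \<Rightarrow> 'b) \<Rightarrow> ('a \<Rightarrow> 'b) \<Rightarrow> nat
   \<Rightarrow> ('g list \<Rightarrow> 'a) \<Rightarrow> ('g list \<Rightarrow> ('b \<Rightarrow> 'b) \<times> ('b \<Rightarrow> 'b)) \<Rightarrow> bool"
  where "globalization K A G e B \<beta> \<phi> n w u \<longleftrightarrow>
    u \<in> cocycles (multiplier_algebra K B) G (multiplier_action B \<beta>) n \<and>
    (\<forall>gs\<in>tuples G n. \<phi> (w gs) = right_mult (\<phi> (tuple_idem A G e gs)) (u gs))"

end

theory Submission
  imports Defs
begin

text \<open>
  Let \<open>X\<close> be the set of primitive central idempotents \<open>x\<close> of \<open>\<B>\<close>. Since \<open>\<A>\<close> is a product of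
  indecomposable rings, \<open>\<M>(\<B>)\<close> is the product of the algebras \<open>x\<B>\<close>, so a cochain with values in
  \<open>\<M>(\<B>)\<close> is a family of cochains indexed by the \<open>G\<close>-set \<open>X\<close>. In homogeneous form the component at
  \<open>x\<close> of \<open>u\<^sub>1 - u\<^sub>2\<close> is a cocycle \<open>F\<^sub>x(a\<^sub>0, \<dots>, a\<^sub>n)\<close> on the simplex with vertex set \<open>G\<close>. The
  globalization property says that \<open>w\<^sub>1 - w\<^sub>2\<close> is the restriction of \<open>F\<^sub>x\<close> to simplices with
  vertices in \<open>S\<^sub>x = {a. x \<le> \<beta>\<^sub>a(\<phi>(1))}\<close>, where it therefore has a primitive \<open>V\<^sub>x\<close>. The sets \<open>S\<^sub>x\<close> are
  nonempty because \<open>\<B>\<close> is the sum of the \<open>\<beta>\<^sub>a(\<phi>(\<A>))\<close>, and \<open>G\<close> acts freely on \<open>X \<times> G\<close>, so there are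
  maps \<open>p\<^sub>x\<close> from \<open>G\<close> to \<open>S\<^sub>x\<close>, equivariant in \<open>x\<close>. With \<open>h\<close> the prism operator of \<open>p\<^sub>x\<close>, the
  homotopy formula gives \<open>F\<^sub>x = d(V\<^sub>x \<circ> p\<^sub>x - h F\<^sub>x)\<close>, and these primitives glue to a cochain with values
  in \<open>\<M>(\<B>)\<close>.
\<close>

section \<open>Simplicial cochains with coefficients in an abelian group\<close>

text \<open>On the full simplex with vertex set G every cocycle of positive degree bounds, by coning
  off from a vertex. A cone at chosen vertices \<open>s x\<close> respects the action only if the
  vertex chosen for gx is g times \<open>s x\<close>. This is impossible once x has a nontrivial
  stabilizer, since no nontrivial translation of G fixes a vertex. Hence the map into
  \<open>S\<^sub>x\<close> cannot be constant: it is made equivariant jointly in x and the vertex,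
  and the cone gives way to the homotopy between \<open>p\<^sub>x\<close> and the identity. Of the
  sets \<open>S\<^sub>x\<close> only nonemptiness and compatibility with translation matter, and
  \<open>V\<^sub>x\<close> may be arbitrary off \<open>S\<^sub>x\<close> because it is composed with
  \<open>p\<^sub>x\<close>.

  Gluing is where multipliers enter. In A arbitrary families over the primitive idempotents glue, A
  being the full product. In B, whose elements are finite sums over translates of A, a family
  \<open>f x\<close> is glued only after multiplication by an element b. The maps sending b to the
  glued families \<open>b f x\<close> and \<open>f x b\<close> are the two halves R and L of a
  multiplier, and \<open>R x\<close> is its component at x.\<close>

context
  fixes M (structure) and N (structure) and h
  assumes M: "abelian_group M" and N: "abelian_group N"
    and h: "h \<in> hom (add_monoid M) (add_monoid N)"
begin

interpretation M: abelian_group M by (rule M)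
interpretation N: abelian_group N by (rule N)
interpretation h: abelian_group_hom M N h
  by unfold_locales (use h in simp)

text \<open>The lemmas of this context keep both groups and the map as explicit premises because
  they are instantiated for maps between different structures: negation, multiplication by a fixed
  element, \<open>\<beta> g\<close>, \<open>\<phi>\<close>, and evaluation of a multiplier at an
  element.\<close>

lemma add_hom_closed: "a \<in> carrier M \<Longrightarrow> h a \<in> carrier N"
  using h by (auto simp: hom_def)

lemma add_hom_add: "\<lbrakk>a \<in> carrier M; b \<in> carrier M\<rbrakk> \<Longrightarrow> h (a \<oplus>\<^bsub>M\<^esub> b) = h a \<oplus>\<^bsub>N\<^esub> h b"
  using h by (auto simp: hom_def)

lemma add_hom_zero: "h \<zero>\<^bsub>M\<^esub> = \<zero>\<^bsub>N\<^esub>"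
  by (rule h.hom_zero)

lemma add_hom_uminus: "a \<in> carrier M \<Longrightarrow> h (\<ominus>\<^bsub>M\<^esub> a) = \<ominus>\<^bsub>N\<^esub> h a"
  by (rule h.hom_a_inv)

lemma add_hom_minus:
  "\<lbrakk>a \<in> carrier M; b \<in> carrier M\<rbrakk> \<Longrightarrow> h (a \<ominus>\<^bsub>M\<^esub> b) = h a \<ominus>\<^bsub>N\<^esub> h b"
  by (simp add: a_minus_def add_hom_add add_hom_uminus)

lemma add_hom_alt_sign: "a \<in> carrier M \<Longrightarrow> h (alt_sign M i a) = alt_sign N i (h a)"
  by (simp add: alt_sign_def add_hom_uminus)

lemma add_hom_finsum:
  "f \<in> I \<rightarrow> carrier M \<Longrightarrow> h (\<Oplus>\<^bsub>M\<^esub>i\<in>I. f i) = (\<Oplus>\<^bsub>N\<^esub>i\<in>I. h (f i))"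
proof (induction I rule: infinite_finite_induct)
  case (insert i I)
  then show ?case by (simp add: Pi_def add_hom_add add_hom_closed)
qed (simp_all add: add_hom_zero)

end

lemma (in abelian_group) alt_sign_closed:
  "a \<in> carrier G \<Longrightarrow> alt_sign G i a \<in> carrier G"
  by (simp add: alt_sign_def)

lemma (in abelian_group) alt_sign_Suc:
  "a \<in> carrier G \<Longrightarrow> alt_sign G (Suc i) a = \<ominus> alt_sign G i a"
  by (simp add: alt_sign_def minus_minus)

text \<open>
  A cochain is a function on lists of vertices. The empty list counts as a simplex of dimension
  \<open>-1\<close>, so this is the augmented complex, whose differential has a one-line recursion.
\<close>

fun bd :: "('m, 'q) ring_scheme \<Rightarrow> ('v list \<Rightarrow> 'm) \<Rightarrow> 'v list \<Rightarrow> 'm" where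
  "bd M F [] = \<zero>\<^bsub>M\<^esub>"
| "bd M F (a # l) = F l \<ominus>\<^bsub>M\<^esub> bd M (\<lambda>l. F (a # l)) l"

text \<open>Unfolded, this is the alternating sum over i of F at (a_0, ..., a_i, p a_i, ..., p a_k),
  the classical prism operator. It recurses on the first vertex exactly as \<open>bd\<close> does,
  so that the homotopy formula takes a single induction.\<close>

fun prism :: "('m, 'q) ring_scheme \<Rightarrow> ('v \<Rightarrow> 'v) \<Rightarrow> ('v list \<Rightarrow> 'm) \<Rightarrow> 'v list \<Rightarrow> 'm" where
  "prism M p F [] = \<zero>\<^bsub>M\<^esub>"
| "prism M p F (a # l) = F (a # map p (a # l)) \<ominus>\<^bsub>M\<^esub> prism M p (\<lambda>l. F (a # l)) l"

lemma bd_cong: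
  "(\<And>k. length k + 1 = length l \<Longrightarrow> set k \<subseteq> set l \<Longrightarrow> F k = F' k) \<Longrightarrow> bd M F l = bd M F' l"
proof (induction l arbitrary: F F')
  case (Cons a l)
  have "bd M (\<lambda>l. F (a # l)) l = bd M (\<lambda>l. F' (a # l)) l"
    by (rule Cons.IH, rule Cons.prems) auto
  moreover have "F l = F' l" by (rule Cons.prems) auto
  ultimately show ?case by simp
qed simp

lemma prism_cong:
  "(\<And>k. length k = Suc (length l) \<Longrightarrow> set k \<subseteq> set l \<union> p ` set l \<Longrightarrow> F k = F' k)
    \<Longrightarrow> prism M p F l = prism M p F' l"
proof (induction l arbitrary: F F')
  case (Cons a l)
  have "prism M p (\<lambda>l. F (a # l)) l = prism M p (\<lambda>l. F' (a # l)) l"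
    by (rule Cons.IH, rule Cons.prems) auto
  moreover have "F (a # map p (a # l)) = F' (a # map p (a # l))"
    by (rule Cons.prems) auto
  ultimately show ?case by simp
qed simp

lemma bd_map: "bd M (\<lambda>l. F (map f l)) l = bd M F (map f l)"
proof (induction l arbitrary: F)
  case (Cons a l)
  show ?case using Cons.IH[of "\<lambda>l. F (f a # l)"] by simp
qed simp

text \<open>Naturality for a vertex map that intertwines \<open>p\<close> with \<open>p'\<close>. It
  is applied to left translation by g, which carries the map chosen for x to the one chosen for
  gx.\<close>

lemma prism_map:
  "(\<And>a. a \<in> set l \<Longrightarrow> f (p a) = p' (f a)) \<Longrightarrow>
    prism M p (\<lambda>l. F (map f l)) l = prism M p' F (map f l)"
proof (induction l arbitrary: F)
  case (Cons a l)
  have "prism M p (\<lambda>l. F (f a # map f l)) l = prism M p' (\<lambda>l. F (f a # l)) (map f l)"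
    by (rule Cons.IH[of "\<lambda>l. F (f a # l)"]) (use Cons.prems in auto)
  moreover have "map (f \<circ> p) l = map (p' \<circ> f) l" using Cons.prems by auto
  ultimately show ?case using Cons.prems by (simp del: map_eq_conv)
qed simp

context abelian_group
begin

lemma bd_closed:
  "\<lbrakk>F \<in> lists V \<rightarrow> carrier G; l \<in> lists V\<rbrakk> \<Longrightarrow> bd G F l \<in> carrier G"
proof (induction l arbitrary: F)
  case (Cons a l)
  have "bd G (\<lambda>l. F (a # l)) l \<in> carrier G" using Cons by (auto simp: Pi_def)
  then show ?case using Cons.prems by (auto simp: Pi_def)
qed simp

lemma prism_closed:
  "\<lbrakk>F \<in> lists V \<rightarrow> carrier G; l \<in> lists V; p \<in> V \<rightarrow> V\<rbrakk> \<Longrightarrow> prism G p F l \<in> carrier G"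
proof (induction l arbitrary: F)
  case (Cons a l)
  have "prism G p (\<lambda>l. F (a # l)) l \<in> carrier G" using Cons by (auto simp: Pi_def)
  moreover have "F (a # map p (a # l)) \<in> carrier G"
    using Cons.prems by (auto simp: Pi_def in_lists_conv_set)
  ultimately show ?case by auto
qed simp

lemma minus_minus_minus:
  assumes "a \<in> carrier G" "b \<in> carrier G" "c \<in> carrier G" "d \<in> carrier G"
  shows "(a \<ominus> b) \<ominus> (c \<ominus> d) = (a \<ominus> c) \<ominus> (b \<ominus> d)"
  using assms by (simp add: a_minus_def minus_add minus_minus a_ac)

lemma bd_minus:
  "\<lbrakk>F \<in> lists V \<rightarrow> carrier G; F' \<in> lists V \<rightarrow> carrier G; l \<in> lists V\<rbrakk> \<Longrightarrow>
    bd G (\<lambda>l. F l \<ominus> F' l) l = bd G F l \<ominus> bd G F' l"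
proof (induction l arbitrary: F F')
  case Nil
  then show ?case by (simp add: r_neg a_minus_def)
next
  case (Cons a l)
  have P: "(\<lambda>l. F (a # l)) \<in> lists V \<rightarrow> carrier G" "(\<lambda>l. F' (a # l)) \<in> lists V \<rightarrow> carrier G"
    and l: "l \<in> lists V" using Cons.prems by (auto simp: Pi_def)
  have C: "F l \<in> carrier G" "F' l \<in> carrier G" using Cons.prems by (auto simp: Pi_def)
  show ?case
    using Cons.IH[OF P l] minus_minus_minus[OF C bd_closed[OF P(1) l] bd_closed[OF P(2) l]]
    by simp
qed

text \<open>The bounds on length and vertices matter: the cocycle identity that is fed in here holds
  in one degree only and on lists over the group only.\<close>

lemma prism_zero:
  "(\<And>k. length k = Suc (length l) \<Longrightarrow> set k \<subseteq> set l \<union> p ` set l \<Longrightarrow> F k = \<zero>) \<Longrightarrow>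
    prism G p F l = \<zero>"
proof (induction l arbitrary: F)
  case (Cons a l)
  have "prism G p (\<lambda>l. F (a # l)) l = \<zero>"
    by (rule Cons.IH, rule Cons.prems) auto
  moreover have "F (a # map p (a # l)) = \<zero>" by (rule Cons.prems) auto
  ultimately show ?case by (simp add: a_minus_def)
qed simp

lemma prism_minus:
  "\<lbrakk>F \<in> lists V \<rightarrow> carrier G; F' \<in> lists V \<rightarrow> carrier G; l \<in> lists V; p \<in> V \<rightarrow> V\<rbrakk> \<Longrightarrow>
    prism G p (\<lambda>l. F l \<ominus> F' l) l = prism G p F l \<ominus> prism G p F' l"
proof (induction l arbitrary: F F')
  case Nil
  then show ?case by (simp add: r_neg a_minus_def)
next
  case (Cons a l)
  have P: "(\<lambda>l. F (a # l)) \<in> lists V \<rightarrow> carrier G" "(\<lambda>l. F' (a # l)) \<in> lists V \<rightarrow> carrier G"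
    and l: "l \<in> lists V" using Cons.prems by (auto simp: Pi_def)
  have "a # map p (a # l) \<in> lists V" using Cons.prems by (auto simp: Pi_def in_lists_conv_set)
  then have C: "F (a # map p (a # l)) \<in> carrier G" "F' (a # map p (a # l)) \<in> carrier G"
    using Cons.prems(1,2) by (auto simp only: Pi_def)
  show ?case
    using Cons.IH[OF P l Cons.prems(4)]
      minus_minus_minus[OF C prism_closed[OF P(1) l Cons.prems(4)] prism_closed[OF P(2) l Cons.prems(4)]]
    by simp
qed

text \<open>The additive bookkeeping of the induction step in \<open>prism_homotopy\<close>. There
  \<open>s\<close> and \<open>r\<close> each occur once in either summand and cancel, and the last
  hypothesis, \<open>t \<oplus> t' = q \<ominus> f\<close>, is the induction hypothesis.\<close>

lemma homotopy_step:
  assumes "p \<in> carrier G" "q \<in> carrier G" "f \<in> carrier G" "s \<in> carrier G" "r \<in> carrier G"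
    and "t \<in> carrier G" "t' \<in> carrier G" and "t \<oplus> t' = q \<ominus> f"
  shows "((p \<ominus> (q \<ominus> s)) \<ominus> (r \<ominus> t)) \<oplus> (r \<ominus> (s \<ominus> t')) = p \<ominus> f"
proof -
  have "((p \<ominus> (q \<ominus> s)) \<ominus> (r \<ominus> t)) \<oplus> (r \<ominus> (s \<ominus> t'))
      = (((p \<ominus> q) \<oplus> (s \<oplus> \<ominus> s)) \<oplus> (r \<oplus> \<ominus> r)) \<oplus> (t \<oplus> t')"
    using assms(1-7) by (simp add: a_minus_def minus_add minus_minus a_ac)
  also have "\<dots> = (p \<ominus> f \<oplus> (q \<oplus> \<ominus> q)) \<oplus> ((s \<oplus> \<ominus> s) \<oplus> (r \<oplus> \<ominus> r))"
    unfolding assms(8) using assms(1-7) by (simp add: a_minus_def a_ac)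
  finally show ?thesis using assms(1-7) by (simp add: r_neg)
qed

text \<open>Peeling off the first vertex a, the induction hypothesis is applied to the cochain with
  a prepended. The faces beginning with both a and p a, and the prism that omits a, arise once from
  each summand with opposite signs.\<close>

lemma prism_homotopy:
  assumes "F \<in> lists V \<rightarrow> carrier G" "l \<in> lists V" "p \<in> V \<rightarrow> V"
  shows "prism G p (bd G F) l \<oplus> bd G (prism G p F) l = F (map p l) \<ominus> F l"
  using assms(1,2)
proof (induction l arbitrary: F)
  case Nil
  then have "F [] \<in> carrier G" by auto
  then show ?case by (simp add: a_minus_def r_neg)
next
  case (Cons a l)
  let ?Fa = "\<lambda>l. F (a # l)"
  let ?Faa = "\<lambda>l. F (a # p a # l)"
  note p = assms(3)
  have a: "a \<in> V" "p a \<in> V" and l: "l \<in> lists V" using Cons.prems p by auto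
  have pl: "map p l \<in> lists V" using l p by (auto simp: in_lists_conv_set)
  have Fa: "?Fa \<in> lists V \<rightarrow> carrier G" and Faa: "?Faa \<in> lists V \<rightarrow> carrier G"
    using Cons.prems a by (auto simp: Pi_def)
  have dFa: "bd G ?Fa \<in> lists V \<rightarrow> carrier G" using bd_closed[OF Fa] by auto
  have hFa: "prism G p ?Fa \<in> lists V \<rightarrow> carrier G" using prism_closed[OF Fa] p by auto
  \<comment> \<open>In 1 the recursion of \<open>bd\<close> is expanded under the prism operator; in
    2 the recursion of \<open>prism\<close> is expanded under \<open>bd\<close>, where naturality
    turns the leading terms, those beginning with a and p a, into a boundary at
    \<open>map p l\<close>.\<close>
  have 1: "prism G p (\<lambda>l. bd G F (a # l)) l = prism G p F l \<ominus> prism G p (bd G ?Fa) l"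
    using prism_minus[OF Cons.prems(1) dFa l p] by simp
  have 2: "bd G (\<lambda>l. prism G p F (a # l)) l = bd G ?Faa (map p l) \<ominus> bd G (prism G p ?Fa) l"
  proof -
    have "bd G (\<lambda>l. prism G p F (a # l)) l
        = bd G (\<lambda>l. ?Faa (map p l)) l \<ominus> bd G (prism G p ?Fa) l"
      using bd_minus[of "\<lambda>l. ?Faa (map p l)" V "prism G p ?Fa" l] hFa l Faa p
      by (auto simp: Pi_def in_lists_conv_set)
    then show ?thesis using bd_map[of G ?Faa p l] by simp
  qed
  have "F (map p (a # l)) \<in> carrier G" "F (a # map p l) \<in> carrier G" "F (a # l) \<in> carrier G"
    using Cons.prems(1) a l pl by (auto simp: Pi_def)
  from homotopy_step[OF this bd_closed[OF Faa pl] prism_closed[OF Cons.prems(1) l p]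
      prism_closed[OF dFa l p] bd_closed[OF hFa l] Cons.IH[OF Fa l]]
  show ?case using 1 2 by simp
qed

text \<open>Returns from the recursion, suited to inductions, to the alternating sum over deleted
  vertices, the shape in which group coboundaries are defined.\<close>

lemma bd_eq_finsum:
  "\<lbrakk>F \<in> lists V \<rightarrow> carrier G; l \<in> lists V; length l = Suc n\<rbrakk> \<Longrightarrow>
    bd G F l = (\<Oplus>i\<in>{..n}. alt_sign G i (F (take i l @ drop (Suc i) l)))"
proof (induction n arbitrary: F l)
  case 0
  then obtain a where "l = [a]" by (cases l) auto
  then show ?case using 0 by (auto simp: alt_sign_def a_minus_def Pi_def)
next
  case (Suc n)
  then obtain a k where l: "l = a # k" by (cases l) auto
  let ?D = "\<lambda>i. F (a # (take i k @ drop (Suc i) k))"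
  have k: "k \<in> lists V" "length k = Suc n" "a \<in> V" using Suc.prems l by auto
  have Fa: "(\<lambda>l. F (a # l)) \<in> lists V \<rightarrow> carrier G"
    using Suc.prems l by (auto simp: Pi_def)
  have D: "?D i \<in> carrier G" for i
  proof -
    have "a # (take i k @ drop (Suc i) k) \<in> lists V"
      using k by (auto simp: in_lists_conv_set dest: in_set_takeD in_set_dropD)
    then show ?thesis using Suc.prems(1) by blast
  qed
  have Fk: "F k \<in> carrier G" using Suc.prems k by auto
  have uh: "(\<lambda>x. \<ominus> x) \<in> hom (add_monoid G) (add_monoid G)"
    by (auto simp: hom_def minus_add)
  have "bd G F l = F k \<ominus> (\<Oplus>i\<in>{..n}. alt_sign G i (?D i))"
    using Suc.IH[OF Fa k(1,2)] l by simp
  also have "\<dots> = F k \<oplus> (\<Oplus>i\<in>{..n}. \<ominus> alt_sign G i (?D i))"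
    unfolding a_minus_def
    by (subst add_hom_finsum[OF abelian_group_axioms abelian_group_axioms uh])
      (simp_all add: D alt_sign_closed)
  \<comment> \<open>The minus sign of the recursion raises every sign exponent by one, which matches
    the shift of the deleted position caused by the new first vertex; \<open>F k\<close> is the face
    at position 0.\<close>
  also have "\<dots> = (\<Oplus>i\<in>{..n}. alt_sign G (Suc i) (?D i)) \<oplus> F k"
    using D Fk by (simp add: alt_sign_Suc alt_sign_closed a_comm)
  also have "\<dots> = (\<Oplus>i\<in>{..Suc n}. alt_sign G i (F (take i l @ drop (Suc i) l)))"
  proof -
    have "F (take i l @ drop (Suc i) l) \<in> carrier G" for i
    proof -
      have "take i l @ drop (Suc i) l \<in> lists V"
        using Suc.prems(2) by (auto simp: in_lists_conv_set dest: in_set_takeD in_set_dropD)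
      then show ?thesis using Suc.prems(1) by blast
    qed
    then show ?thesis
      by (subst finsum_Suc2) (auto simp: alt_sign_closed l alt_sign_def)
  qed
  finally show ?case .
qed

end

section \<open>Homogeneous and inhomogeneous cochains\<close>

text \<open>The vertices a, a g_1, a g_1 g_2, ... of the simplex that bar notation writes as
  a[g_1|...|g_n].\<close>

fun parts :: "('g, 'r) monoid_scheme \<Rightarrow> 'g \<Rightarrow> 'g list \<Rightarrow> 'g list" where
  "parts G a [] = [a]"
| "parts G a (g # gs) = a # parts G (a \<otimes>\<^bsub>G\<^esub> g) gs"

text \<open>The bar coordinates of a simplex. They forget the first vertex, so they are invariant
  under left translation and invert \<open>parts\<close> once that vertex is prescribed.\<close>

fun increments :: "('g, 'r) monoid_scheme \<Rightarrow> 'g list \<Rightarrow> 'g list" where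
  "increments G (a # b # l) = (inv\<^bsub>G\<^esub> a \<otimes>\<^bsub>G\<^esub> b) # increments G (b # l)"
| "increments G l = []"

lemma length_parts [simp]: "length (parts G a gs) = Suc (length gs)"
  by (induction gs arbitrary: a) auto

lemma parts_not_Nil [simp]: "parts G a gs \<noteq> []"
  by (cases gs) auto

lemma hd_parts [simp]: "hd (parts G a gs) = a"
  by (cases gs) auto

lemma length_increments [simp]: "length (increments G l) = length l - 1"
  by (induction l rule: induct_list012) auto

lemma tuples_lists: "gs \<in> tuples G n \<longleftrightarrow> gs \<in> lists (carrier G) \<and> length gs = n"
  by (auto simp: tuples_def)

lemma parts_butlast: "gs \<noteq> [] \<Longrightarrow> parts G a (butlast gs) = butlast (parts G a gs)"
  by (induction gs arbitrary: a) auto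

lemma tl_tuples: "gs \<in> tuples G (Suc n) \<Longrightarrow> tl gs \<in> tuples G n"
  by (cases gs) (auto simp: tuples_def)

lemma hd_tuples: "gs \<in> tuples G (Suc n) \<Longrightarrow> hd gs \<in> carrier G"
  by (cases gs) (auto simp: tuples_def)

lemma butlast_tuples: "gs \<in> tuples G (Suc n) \<Longrightarrow> butlast gs \<in> tuples G n"
  by (auto simp: tuples_def dest: in_set_butlastD)

lemma (in monoid) mult_list_closed: "set gs \<subseteq> carrier G \<Longrightarrow> mult_list G gs \<in> carrier G"
  by (induction gs) (auto simp: mult_list_def)

context group
begin

lemma parts_closed: "\<lbrakk>a \<in> carrier G; gs \<in> lists (carrier G)\<rbrakk> \<Longrightarrow> parts G a gs \<in> lists (carrier G)"
  by (induction gs arbitrary: a) auto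

lemma increments_closed: "l \<in> lists (carrier G) \<Longrightarrow> increments G l \<in> lists (carrier G)"
  by (induction l rule: induct_list012) auto

lemma increments_parts: "\<lbrakk>a \<in> carrier G; gs \<in> lists (carrier G)\<rbrakk> \<Longrightarrow> increments G (parts G a gs) = gs"
proof (induction gs arbitrary: a)
  case (Cons g gs)
  then have "increments G (parts G a (g # gs)) = (inv a \<otimes> (a \<otimes> g)) # increments G (parts G (a \<otimes> g) gs)"
    by (cases gs) auto
  then show ?case using Cons by (simp add: m_assoc[symmetric])
qed simp

lemma parts_increments: "\<lbrakk>l \<in> lists (carrier G); l \<noteq> []\<rbrakk> \<Longrightarrow> parts G (hd l) (increments G l) = l"
  by (induction l rule: induct_list012) (auto simp: m_assoc[symmetric])

lemma map_parts:
  "\<lbrakk>g \<in> carrier G; a \<in> carrier G; gs \<in> lists (carrier G)\<rbrakk> \<Longrightarrow>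
    map ((\<otimes>) g) (parts G a gs) = parts G (g \<otimes> a) gs"
  by (induction gs arbitrary: a) (auto simp: m_assoc)

lemma increments_map:
  "\<lbrakk>g \<in> carrier G; l \<in> lists (carrier G)\<rbrakk> \<Longrightarrow> increments G (map ((\<otimes>) g) l) = increments G l"
  by (induction l rule: induct_list012) (auto simp: m_assoc inv_mult_group inv_solve_left')

text \<open>Multiplying two neighbouring bar coordinates removes the vertex between them. This
  identifies the middle terms of the group coboundary with the inner faces of the simplex.\<close>

lemma parts_merge:
  "\<lbrakk>gs \<in> lists (carrier G); 1 \<le> i; i < length gs; a \<in> carrier G\<rbrakk> \<Longrightarrow>
    parts G a (merge G i gs) = take i (parts G a gs) @ drop (Suc i) (parts G a gs)"
proof (induction gs arbitrary: i a)
  case (Cons g gs)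
  obtain h k where gs: "gs = h # k" using Cons.prems by (cases gs) auto
  show ?case
  proof (cases "i = 1")
    case True
    then show ?thesis using Cons.prems gs by (auto simp: merge_def m_assoc)
  next
    case False
    then obtain j where i: "i = Suc (Suc j)" using Cons.prems by (metis One_nat_def Suc_le_D Suc_le_mono le_SucE le_zero_eq not0_implies_Suc)
    have "merge G i (g # gs) = g # merge G (Suc j) gs" by (simp add: merge_def i)
    then show ?thesis using Cons.IH[of "Suc j" "a \<otimes> g"] Cons.prems i by auto
  qed
qed simp

lemma merge_tuples:
  assumes "gs \<in> tuples G (Suc n)" "i \<in> {1..n}"
  shows "merge G i gs \<in> tuples G n"
proof -
  have "gs ! (i - 1) \<in> carrier G" "gs ! i \<in> carrier G"
    using assms by (auto simp: tuples_def subset_iff)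
  then show ?thesis
    using assms by (auto simp: tuples_def merge_def dest: in_set_takeD in_set_dropD)
qed

text \<open>For a equal to the identity the vertices are the partial products that index the
  idempotents of a partial cochain.\<close>

lemma nth_parts:
  "\<lbrakk>a \<in> carrier G; gs \<in> lists (carrier G); i \<le> length gs\<rbrakk> \<Longrightarrow>
    parts G a gs ! i = a \<otimes> mult_list G (take i gs)"
proof (induction gs arbitrary: a i)
  case (Cons g gs)
  have c: "mult_list G k \<in> carrier G" if "k \<in> lists (carrier G)" for k
    using that by (induction k) (auto simp: mult_list_def)
  show ?case
  proof (cases i)
    case (Suc j)
    have "take j gs \<in> lists (carrier G)"
      using Cons.prems by (auto simp: in_lists_conv_set dest: in_set_takeD)
    then show ?thesis using Cons Suc c by (auto simp: mult_list_def m_assoc)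
  qed (use Cons in \<open>auto simp: mult_list_def\<close>)
qed (auto simp: mult_list_def)

end

text \<open>
  Functions \<open>c x gs\<close> are inhomogeneous cochains with coefficients in the functions from the
  \<open>G\<close>-set \<open>I\<close> to \<open>M\<close>, on which \<open>g\<close> acts by \<open>m \<mapsto> (\<lambda>x. \<beta> g (m (\<tau> (inv g) x)))\<close>.
\<close>

locale indexed_coefficients = G: group G + M: abelian_group M
  for G :: "('g, 'r) monoid_scheme" (structure) and M :: "('m, 'q) ring_scheme" (structure) +
  fixes \<beta> :: "'g \<Rightarrow> 'm \<Rightarrow> 'm" and I :: "'x set" and \<tau> :: "'g \<Rightarrow> 'x \<Rightarrow> 'x"
  assumes act_hom: "g \<in> carrier G \<Longrightarrow> \<beta> g \<in> hom (add_monoid M) (add_monoid M)"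
    and act_mult: "\<lbrakk>g \<in> carrier G; h \<in> carrier G; m \<in> carrier M\<rbrakk> \<Longrightarrow> \<beta> (g \<otimes>\<^bsub>G\<^esub> h) m = \<beta> g (\<beta> h m)"
    and act_one: "m \<in> carrier M \<Longrightarrow> \<beta> \<one>\<^bsub>G\<^esub> m = m"
    and ix_closed: "\<lbrakk>g \<in> carrier G; x \<in> I\<rbrakk> \<Longrightarrow> \<tau> g x \<in> I"
    and ix_mult: "\<lbrakk>g \<in> carrier G; h \<in> carrier G; x \<in> I\<rbrakk> \<Longrightarrow> \<tau> (g \<otimes>\<^bsub>G\<^esub> h) x = \<tau> g (\<tau> h x)"
    and ix_one: "x \<in> I \<Longrightarrow> \<tau> \<one>\<^bsub>G\<^esub> x = x"
begin

lemmas act_closed = add_hom_closed[OF M.abelian_group_axioms M.abelian_group_axioms act_hom]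
lemmas act_zero = add_hom_zero[OF M.abelian_group_axioms M.abelian_group_axioms act_hom]
lemmas act_minus = add_hom_minus[OF M.abelian_group_axioms M.abelian_group_axioms act_hom]

lemma ix_inv: "\<lbrakk>g \<in> carrier G; x \<in> I\<rbrakk> \<Longrightarrow> \<tau> g (\<tau> (inv\<^bsub>G\<^esub> g) x) = x"
  by (simp flip: ix_mult add: ix_one)

text \<open>Invariance of H as a homogeneous cochain with values in the functions on I: translating
  the simplex translates the index as well. Membership in the carrier is included so that a single
  predicate is passed through all the constructions below.\<close>

definition equivariant where
  "equivariant H \<longleftrightarrow> (\<forall>x\<in>I. \<forall>l\<in>lists (carrier G). H x l \<in> carrier M \<and>
    (\<forall>g\<in>carrier G. H (\<tau> g x) (map ((\<otimes>\<^bsub>G\<^esub>) g) l) = \<beta> g (H x l)))"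

lemma equivariant_closed: "\<lbrakk>equivariant H; x \<in> I\<rbrakk> \<Longrightarrow> H x \<in> lists (carrier G) \<rightarrow> carrier M"
  by (auto simp: equivariant_def)

lemma equivariant_eq:
  "\<lbrakk>equivariant H; x \<in> I; l \<in> lists (carrier G); g \<in> carrier G\<rbrakk> \<Longrightarrow>
    H (\<tau> g x) (map ((\<otimes>\<^bsub>G\<^esub>) g) l) = \<beta> g (H x l)"
  by (auto simp: equivariant_def)

text \<open>Every nonempty simplex is the translate, by its first vertex, of a simplex starting at
  the identity. Equations between equivariant cochains therefore need checking only on
  \<open>parts \<one> gs\<close>, where the inhomogeneous hypotheses live.\<close>

lemma equivariant_increments:
  assumes "equivariant H" "x \<in> I" "l \<in> lists (carrier G)" "l \<noteq> []"
  shows "H x l = \<beta> (hd l) (H (\<tau> (inv\<^bsub>G\<^esub> hd l) x) (parts G \<one>\<^bsub>G\<^esub> (increments G l)))"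
proof -
  have h: "hd l \<in> carrier G" using assms by (cases l) auto
  have d: "increments G l \<in> lists (carrier G)" using G.increments_closed assms by blast
  have "map ((\<otimes>\<^bsub>G\<^esub>) (hd l)) (parts G \<one>\<^bsub>G\<^esub> (increments G l)) = l"
    using G.map_parts[OF h G.one_closed d] h assms by (simp add: G.parts_increments)
  then show ?thesis
    using equivariant_eq[OF assms(1) ix_closed G.parts_closed[OF G.one_closed d], of "inv\<^bsub>G\<^esub> hd l" x "hd l"]
    by (simp add: h assms ix_inv)
qed

lemma bd_act:
  assumes "F \<in> lists (carrier G) \<rightarrow> carrier M" "l \<in> lists (carrier G)" "g \<in> carrier G"
  shows "bd M (\<lambda>l. \<beta> g (F l)) l = \<beta> g (bd M F l)"
  using assms(1,2)
proof (induction l arbitrary: F)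
  case (Cons a l)
  have "(\<lambda>l. F (a # l)) \<in> lists (carrier G) \<rightarrow> carrier M"
    using Cons.prems by (auto simp: Pi_def)
  then show ?case
    using Cons.IH[of "\<lambda>l. F (a # l)"] Cons.prems M.bd_closed[of "\<lambda>l. F (a # l)" "carrier G" l]
    by (auto simp: act_minus[OF assms(3)] Pi_def)
qed (simp add: act_zero assms)

lemma prism_act:
  assumes "F \<in> lists (carrier G) \<rightarrow> carrier M" "l \<in> lists (carrier G)" "g \<in> carrier G"
    "p \<in> carrier G \<rightarrow> carrier G"
  shows "prism M p (\<lambda>l. \<beta> g (F l)) l = \<beta> g (prism M p F l)"
  using assms(1,2)
proof (induction l arbitrary: F)
  case (Cons a l)
  have 1: "(\<lambda>l. F (a # l)) \<in> lists (carrier G) \<rightarrow> carrier M"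
    using Cons.prems by (auto simp: Pi_def)
  have "a # map p (a # l) \<in> lists (carrier G)"
    using Cons.prems assms(4) by (auto simp: in_lists_conv_set)
  then have "F (a # map p (a # l)) \<in> carrier M" using Cons.prems(1) by blast
  then show ?case
    using Cons.IH[OF 1] Cons.prems M.prism_closed[OF 1 _ assms(4), of l]
    by (auto simp: act_minus[OF assms(3)])
qed (simp add: act_zero assms)

lemma equivariant_bd:
  assumes H: "equivariant H"
  shows "equivariant (\<lambda>x. bd M (H x))"
  unfolding equivariant_def
proof (intro ballI conjI)
  fix x l g assume x: "x \<in> I" and l: "l \<in> lists (carrier G)" and g: "g \<in> carrier G"
  have "bd M (H (\<tau> g x)) (map ((\<otimes>\<^bsub>G\<^esub>) g) l) = bd M (\<lambda>l. H (\<tau> g x) (map ((\<otimes>\<^bsub>G\<^esub>) g) l)) l"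
    by (rule bd_map[symmetric])
  also have "\<dots> = bd M (\<lambda>l. \<beta> g (H x l)) l"
    by (rule bd_cong) (use equivariant_eq[OF H x _ g] l in blast)
  finally show "bd M (H (\<tau> g x)) (map ((\<otimes>\<^bsub>G\<^esub>) g) l) = \<beta> g (bd M (H x) l)"
    using bd_act[OF equivariant_closed[OF H x] l g] by simp
qed (rule M.bd_closed[OF equivariant_closed[OF H]])

lemma equivariant_prism:
  assumes H: "equivariant H"
    and p: "\<And>x. x \<in> I \<Longrightarrow> p x \<in> carrier G \<rightarrow> carrier G"
    and p_eq: "\<And>x g a. \<lbrakk>x \<in> I; g \<in> carrier G; a \<in> carrier G\<rbrakk> \<Longrightarrow> p (\<tau> g x) (g \<otimes>\<^bsub>G\<^esub> a) = g \<otimes>\<^bsub>G\<^esub> p x a"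
  shows "equivariant (\<lambda>x. prism M (p x) (H x))"
  unfolding equivariant_def
proof (intro ballI conjI)
  fix x l g assume x: "x \<in> I" and l: "l \<in> lists (carrier G)" and g: "g \<in> carrier G"
  have "prism M (p (\<tau> g x)) (H (\<tau> g x)) (map ((\<otimes>\<^bsub>G\<^esub>) g) l)
      = prism M (p x) (\<lambda>l. H (\<tau> g x) (map ((\<otimes>\<^bsub>G\<^esub>) g) l)) l"
    by (rule prism_map[symmetric]) (use p_eq[OF x g] l in auto)
  also have "\<dots> = prism M (p x) (\<lambda>l. \<beta> g (H x l)) l"
  proof (rule prism_cong)
    fix k assume "set k \<subseteq> set l \<union> p x ` set l"
    then have "k \<in> lists (carrier G)" using l p[OF x] by (fastforce simp: in_lists_conv_set)
    then show "H (\<tau> g x) (map ((\<otimes>\<^bsub>G\<^esub>) g) k) = \<beta> g (H x k)" by (rule equivariant_eq[OF H x _ g])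
  qed
  finally show "prism M (p (\<tau> g x)) (H (\<tau> g x)) (map ((\<otimes>\<^bsub>G\<^esub>) g) l) = \<beta> g (prism M (p x) (H x) l)"
    using prism_act[OF equivariant_closed[OF H x] l g p[OF x]] by simp
qed (rule M.prism_closed[OF equivariant_closed[OF H] _ p])

lemma equivariant_pullback:
  assumes H: "equivariant H"
    and p: "\<And>x. x \<in> I \<Longrightarrow> p x \<in> carrier G \<rightarrow> carrier G"
    and p_eq: "\<And>x g a. \<lbrakk>x \<in> I; g \<in> carrier G; a \<in> carrier G\<rbrakk> \<Longrightarrow> p (\<tau> g x) (g \<otimes>\<^bsub>G\<^esub> a) = g \<otimes>\<^bsub>G\<^esub> p x a"
  shows "equivariant (\<lambda>x l. H x (map (p x) l))"
  unfolding equivariant_def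
proof (intro ballI conjI)
  fix x l g assume x: "x \<in> I" and l: "l \<in> lists (carrier G)" and g: "g \<in> carrier G"
  have pl: "map (p x) l \<in> lists (carrier G)" using p[OF x] l by (auto simp: in_lists_conv_set)
  have "map (p (\<tau> g x)) (map ((\<otimes>\<^bsub>G\<^esub>) g) l) = map ((\<otimes>\<^bsub>G\<^esub>) g) (map (p x) l)"
    using p_eq[OF x g] l by auto
  then show "H (\<tau> g x) (map (p (\<tau> g x)) (map ((\<otimes>\<^bsub>G\<^esub>) g) l)) = \<beta> g (H x (map (p x) l))"
    using equivariant_eq[OF H x pl g] by (simp only:)
next
  fix x l assume x: "x \<in> I" and l: "l \<in> lists (carrier G)"
  then have "map (p x) l \<in> lists (carrier G)" using p[OF x] by (auto simp: in_lists_conv_set)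
  then show "H x (map (p x) l) \<in> carrier M" using equivariant_closed[OF H x] by blast
qed

lemma equivariant_minus:
  assumes "equivariant H" "equivariant H'"
  shows "equivariant (\<lambda>x l. H x l \<ominus>\<^bsub>M\<^esub> H' x l)"
  using assms unfolding equivariant_def by (auto simp: act_minus)

text \<open>The group coboundary with coefficients in functions on I, read off at x. Only the first
  summand uses another component, because acting on a function also moves its argument.\<close>

definition indexed_coboundary where
  "indexed_coboundary n c x gs =
    \<beta> (hd gs) (c (\<tau> (inv\<^bsub>G\<^esub> hd gs) x) (tl gs))
    \<oplus>\<^bsub>M\<^esub> (\<Oplus>\<^bsub>M\<^esub>i\<in>{1..n}. alt_sign M i (c x (merge G i gs)))
    \<oplus>\<^bsub>M\<^esub> alt_sign M (Suc n) (c x (butlast gs))"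

text \<open>The faces match term by term: the first by equivariance, the inner ones by
  \<open>parts_merge\<close>, the last by \<open>parts_butlast\<close>. So \<open>bd\<close>
  computes the inhomogeneous coboundary on simplices starting at the identity.\<close>

lemma bd_parts:
  assumes H: "equivariant H" and x: "x \<in> I" and gs: "gs \<in> tuples G (Suc n)"
  shows "bd M (H x) (parts G \<one>\<^bsub>G\<^esub> gs)
    = indexed_coboundary n (\<lambda>x gs. H x (parts G \<one>\<^bsub>G\<^esub> gs)) x gs"
proof -
  let ?P = "parts G \<one>\<^bsub>G\<^esub> gs"
  let ?D = "\<lambda>i. H x (take i ?P @ drop (Suc i) ?P)"
  have gsl: "gs \<in> lists (carrier G)" and len: "length gs = Suc n"
    using gs by (auto simp: tuples_lists)
  have P: "?P \<in> lists (carrier G)" using G.parts_closed gsl by simp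
  obtain g k where gk: "gs = g # k" using len by (cases gs) auto
  have g: "g \<in> carrier G" "k \<in> lists (carrier G)" using gsl gk by auto
  have D: "?D i \<in> carrier M" for i
  proof -
    have "take i ?P @ drop (Suc i) ?P \<in> lists (carrier G)"
      using P by (auto simp: in_lists_conv_set dest: in_set_takeD in_set_dropD)
    then show ?thesis using equivariant_closed[OF H x] by blast
  qed
  \<comment> \<open>Deleting the vertex 1 leaves a simplex that starts at g. Moving it back to the
    identity produces both the operator \<open>\<beta> g\<close> and the shifted index.\<close>
  have D0: "?D 0 = \<beta> (hd gs) (H (\<tau> (inv\<^bsub>G\<^esub> hd gs) x) (parts G \<one>\<^bsub>G\<^esub> (tl gs)))"
  proof -
    have "take 0 ?P @ drop (Suc 0) ?P = map ((\<otimes>\<^bsub>G\<^esub>) g) (parts G \<one>\<^bsub>G\<^esub> k)"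
      using g by (simp add: gk G.map_parts)
    then show ?thesis
      using equivariant_eq[OF H ix_closed G.parts_closed[OF G.one_closed g(2)] g(1), of "inv\<^bsub>G\<^esub> g" x] g x
      by (simp add: gk ix_inv)
  qed
  have Di: "?D i = H x (parts G \<one>\<^bsub>G\<^esub> (merge G i gs))" if "i \<in> {1..n}" for i
    using that gsl len by (subst G.parts_merge) auto
  have Dm: "alt_sign M i (H x (parts G \<one>\<^bsub>G\<^esub> (merge G i gs))) \<in> carrier M" if "i \<in> {1..n}" for i
    by (rule M.alt_sign_closed) (use Di[OF that] D[of i] in simp)
  have Dl: "?D (Suc n) = H x (parts G \<one>\<^bsub>G\<^esub> (butlast gs))"
  proof -
    have "take (Suc n) ?P @ drop (Suc (Suc n)) ?P = butlast ?P"
      using len by (simp add: butlast_conv_take)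
    then show ?thesis by (simp add: gk flip: parts_butlast)
  qed
  have "bd M (H x) ?P = (\<Oplus>\<^bsub>M\<^esub>i\<in>{..Suc n}. alt_sign M i (?D i))"
    using M.bd_eq_finsum[OF equivariant_closed[OF H x] P] len by simp
  also have "\<dots> = alt_sign M (Suc n) (?D (Suc n)) \<oplus>\<^bsub>M\<^esub> (\<Oplus>\<^bsub>M\<^esub>i\<in>insert 0 {1..n}. alt_sign M i (?D i))"
  proof -
    have "insert 0 {1..n} = {..n}" by auto
    then show ?thesis using D by (subst M.finsum_Suc) (auto simp: M.alt_sign_closed)
  qed
  also have "(\<Oplus>\<^bsub>M\<^esub>i\<in>insert 0 {1..n}. alt_sign M i (?D i))
      = ?D 0 \<oplus>\<^bsub>M\<^esub> (\<Oplus>\<^bsub>M\<^esub>i\<in>{1..n}. alt_sign M i (?D i))"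
    using D D[of 0] by (subst M.finsum_insert) (auto simp: M.alt_sign_closed alt_sign_def)
  also have "(\<Oplus>\<^bsub>M\<^esub>i\<in>{1..n}. alt_sign M i (?D i))
      = (\<Oplus>\<^bsub>M\<^esub>i\<in>{1..n}. alt_sign M i (H x (parts G \<one>\<^bsub>G\<^esub> (merge G i gs))))" (is "_ = ?S")
    using Dm by (intro M.finsum_cong') (simp_all add: Di)
  finally have sum: "bd M (H x) ?P = alt_sign M (Suc n) (?D (Suc n)) \<oplus>\<^bsub>M\<^esub> (?D 0 \<oplus>\<^bsub>M\<^esub> ?S)" .
  have S: "?S \<in> carrier M"
    by (rule M.finsum_closed) (simp add: Dm)
  have "bd M (H x) ?P = ?D 0 \<oplus>\<^bsub>M\<^esub> ?S \<oplus>\<^bsub>M\<^esub> alt_sign M (Suc n) (?D (Suc n))"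
    unfolding sum by (rule M.a_comm[OF M.alt_sign_closed[OF D] M.a_closed[OF D S]])
  then show ?thesis unfolding indexed_coboundary_def D0 Dl .
qed

text \<open>Inverse to evaluation on simplices starting at the identity. The value zero in all other
  lengths makes it total on lists, as \<open>equivariant\<close> demands.\<close>

definition homogeneous where
  "homogeneous n c x l = (if length l = Suc n
    then \<beta> (hd l) (c (\<tau> (inv\<^bsub>G\<^esub> hd l) x) (increments G l)) else \<zero>\<^bsub>M\<^esub>)"

lemma homogeneous_parts:
  assumes "c x gs \<in> carrier M" "x \<in> I" "gs \<in> tuples G n"
  shows "homogeneous n c x (parts G \<one>\<^bsub>G\<^esub> gs) = c x gs"
  using assms by (auto simp: homogeneous_def tuples_lists G.increments_parts act_one ix_one)

lemma equivariant_homogeneous: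
  assumes c: "\<And>x gs. \<lbrakk>x \<in> I; gs \<in> tuples G n\<rbrakk> \<Longrightarrow> c x gs \<in> carrier M"
  shows "equivariant (homogeneous n c)"
  unfolding equivariant_def
proof (intro ballI conjI)
  fix x l g assume x: "x \<in> I" and l: "l \<in> lists (carrier G)" and g: "g \<in> carrier G"
  show "homogeneous n c (\<tau> g x) (map ((\<otimes>\<^bsub>G\<^esub>) g) l) = \<beta> g (homogeneous n c x l)"
  proof (cases "length l = Suc n")
    case True
    then have h: "hd l \<in> carrier G" "l \<noteq> []" using l by (cases l; auto)+
    have d: "increments G l \<in> tuples G n" using True l G.increments_closed[OF l] by (simp add: tuples_lists)
    have "\<tau> (inv\<^bsub>G\<^esub> (g \<otimes>\<^bsub>G\<^esub> hd l)) (\<tau> g x) = \<tau> (inv\<^bsub>G\<^esub> hd l) x"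
      using h g x by (simp flip: ix_mult add: G.inv_mult_group G.m_assoc)
    then show ?thesis
      using True h g x c[OF ix_closed d] by (simp add: homogeneous_def hd_map G.increments_map l act_mult)
  qed (simp add: homogeneous_def act_zero g)
next
  fix x l assume x: "x \<in> I" and l: "l \<in> lists (carrier G)"
  show "homogeneous n c x l \<in> carrier M"
  proof (cases "length l = Suc n")
    case True
    then have h: "hd l \<in> carrier G" using l by (cases l) auto
    have "increments G l \<in> tuples G n" using True l G.increments_closed[OF l] by (simp add: tuples_lists)
    then show ?thesis using h x by (simp add: homogeneous_def act_closed c ix_closed)
  qed (simp add: homogeneous_def)
qed

lemma indexed_coboundary_cong:
  assumes c: "\<And>x gs. \<lbrakk>x \<in> I; gs \<in> tuples G n\<rbrakk> \<Longrightarrow> c x gs = c' x gs"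
    and c': "\<And>x gs. \<lbrakk>x \<in> I; gs \<in> tuples G n\<rbrakk> \<Longrightarrow> c' x gs \<in> carrier M"
    and x: "x \<in> I" and gs: "gs \<in> tuples G (Suc n)"
  shows "indexed_coboundary n c x gs = indexed_coboundary n c' x gs"
proof -
  have "(\<Oplus>\<^bsub>M\<^esub>i\<in>{1..n}. alt_sign M i (c x (merge G i gs)))
      = (\<Oplus>\<^bsub>M\<^esub>i\<in>{1..n}. alt_sign M i (c' x (merge G i gs)))"
    by (rule M.finsum_cong) (auto simp: simp_implies_def c c' x G.merge_tuples[OF gs] intro!: M.alt_sign_closed)
  then show ?thesis
    unfolding indexed_coboundary_def
    by (simp add: c x ix_closed hd_tuples[OF gs] tl_tuples[OF gs] butlast_tuples[OF gs])
qed

lemma indexed_coboundary_eq_bd: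
  assumes c: "\<And>x gs. \<lbrakk>x \<in> I; gs \<in> tuples G n\<rbrakk> \<Longrightarrow> c x gs \<in> carrier M"
    and x: "x \<in> I" and gs: "gs \<in> tuples G (Suc n)"
  shows "indexed_coboundary n c x gs = bd M (homogeneous n c x) (parts G \<one>\<^bsub>G\<^esub> gs)"
proof -
  have "homogeneous n c x (parts G \<one>\<^bsub>G\<^esub> gs) = c x gs" if "x \<in> I" "gs \<in> tuples G n" for x gs
    by (rule homogeneous_parts[where n = n and c = c, OF c]) (use that in auto)
  from bd_parts[OF equivariant_homogeneous[where n = n and c = c, OF c] x gs]
    indexed_coboundary_cong[OF this c x gs]
  show ?thesis by simp
qed

text \<open>Additivity is transported through \<open>bd\<close>, for which it is already proved by
  induction, rather than derived from the signed sum.\<close>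

lemma indexed_coboundary_minus:
  assumes c: "\<And>x gs. \<lbrakk>x \<in> I; gs \<in> tuples G n\<rbrakk> \<Longrightarrow> c x gs \<in> carrier M"
    and c': "\<And>x gs. \<lbrakk>x \<in> I; gs \<in> tuples G n\<rbrakk> \<Longrightarrow> c' x gs \<in> carrier M"
    and x: "x \<in> I" and gs: "gs \<in> tuples G (Suc n)"
  shows "indexed_coboundary n (\<lambda>x gs. c x gs \<ominus>\<^bsub>M\<^esub> c' x gs) x gs
    = indexed_coboundary n c x gs \<ominus>\<^bsub>M\<^esub> indexed_coboundary n c' x gs"
proof -
  let ?P = "parts G \<one>\<^bsub>G\<^esub> gs"
  have P: "?P \<in> lists (carrier G)" using gs by (simp add: tuples_lists G.parts_closed)
  have hom: "homogeneous n (\<lambda>x gs. c x gs \<ominus>\<^bsub>M\<^esub> c' x gs) x l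
      = homogeneous n c x l \<ominus>\<^bsub>M\<^esub> homogeneous n c' x l" if l: "l \<in> lists (carrier G)" for l
  proof (cases "length l = Suc n")
    case True
    then have h: "hd l \<in> carrier G" using l by (cases l) auto
    have d: "increments G l \<in> tuples G n" using True l G.increments_closed[OF l] by (simp add: tuples_lists)
    have y: "\<tau> (inv\<^bsub>G\<^esub> hd l) x \<in> I" using h x by (simp add: ix_closed)
    show ?thesis using True act_minus[OF h c[OF y d] c'[OF y d]] by (simp add: homogeneous_def)
  next
    case False
    then show ?thesis by (simp add: homogeneous_def a_minus_def M.r_neg)
  qed
  have cc': "c x gs \<ominus>\<^bsub>M\<^esub> c' x gs \<in> carrier M" if "x \<in> I" "gs \<in> tuples G n" for x gs
    by (rule M.minus_closed[OF c[OF that] c'[OF that]])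
  have "indexed_coboundary n (\<lambda>x gs. c x gs \<ominus>\<^bsub>M\<^esub> c' x gs) x gs
      = bd M (homogeneous n (\<lambda>x gs. c x gs \<ominus>\<^bsub>M\<^esub> c' x gs) x) ?P"
    by (rule indexed_coboundary_eq_bd[OF cc' x gs])
  also have "\<dots> = bd M (\<lambda>l. homogeneous n c x l \<ominus>\<^bsub>M\<^esub> homogeneous n c' x l) ?P"
    by (rule bd_cong, rule hom) (use P in auto)
  also have "\<dots> = bd M (homogeneous n c x) ?P \<ominus>\<^bsub>M\<^esub> bd M (homogeneous n c' x) ?P"
    by (rule M.bd_minus[OF
          equivariant_closed[OF equivariant_homogeneous[where n = n and c = c, OF c] x]
          equivariant_closed[OF equivariant_homogeneous[where n = n and c = c', OF c'] x] P])
  finally show ?thesis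
    using indexed_coboundary_eq_bd[where n = n and c = c, OF c x gs]
      indexed_coboundary_eq_bd[where n = n and c = c', OF c' x gs] by simp
qed

text \<open>
  \<open>G\<close> acts freely on pairs \<open>(x, a)\<close> with \<open>a \<in> G\<close>, so an equivariant map
  \<open>(x, a) \<mapsto> p x a\<close> into the pairs satisfying \<open>P\<close> is given by its values at \<open>a = 1\<close>, which may be
  chosen freely.
  The prism operator of \<open>p\<close> transports a primitive from the simplices with vertices in \<open>P\<close>.
\<close>

theorem coboundary_if_locally_coboundary:
  assumes c: "\<And>x gs. \<lbrakk>x \<in> I; gs \<in> tuples G (Suc m)\<rbrakk> \<Longrightarrow> c x gs \<in> carrier M"
    and cocycle: "\<And>x gs. \<lbrakk>x \<in> I; gs \<in> tuples G (Suc (Suc m))\<rbrakk> \<Longrightarrow>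
      indexed_coboundary (Suc m) c x gs = \<zero>\<^bsub>M\<^esub>"
    and v: "\<And>x gs. \<lbrakk>x \<in> I; gs \<in> tuples G m\<rbrakk> \<Longrightarrow> v x gs \<in> carrier M"
    and P_ex: "\<And>x. x \<in> I \<Longrightarrow> \<exists>a\<in>carrier G. P a x"
    and P_eq: "\<And>x a g. \<lbrakk>x \<in> I; a \<in> carrier G; g \<in> carrier G; P a x\<rbrakk> \<Longrightarrow> P (g \<otimes>\<^bsub>G\<^esub> a) (\<tau> g x)"
    and local: "\<And>x gs. \<lbrakk>x \<in> I; gs \<in> tuples G (Suc m); \<And>a. a \<in> set (parts G \<one>\<^bsub>G\<^esub> gs) \<Longrightarrow> P a x\<rbrakk> \<Longrightarrow>
      c x gs = indexed_coboundary m v x gs"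
  obtains f where "\<And>x gs. \<lbrakk>x \<in> I; gs \<in> tuples G m\<rbrakk> \<Longrightarrow> f x gs \<in> carrier M"
    and "\<And>x gs. \<lbrakk>x \<in> I; gs \<in> tuples G (Suc m)\<rbrakk> \<Longrightarrow> indexed_coboundary m f x gs = c x gs"
proof -
  define F where "F = homogeneous (Suc m) c"
  define V where "V = homogeneous m v"
  have F: "equivariant F" unfolding F_def by (rule equivariant_homogeneous) (rule c)
  have V: "equivariant V" unfolding V_def by (rule equivariant_homogeneous) (rule v)
  have Fp: "F x (parts G \<one>\<^bsub>G\<^esub> gs) = c x gs" if "x \<in> I" "gs \<in> tuples G (Suc m)" for x gs
    unfolding F_def by (rule homogeneous_parts[where n = "Suc m" and c = c, OF c]) (use that in auto)
  have Vp: "V x (parts G \<one>\<^bsub>G\<^esub> gs) = v x gs" if "x \<in> I" "gs \<in> tuples G m" for x gs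
    unfolding V_def by (rule homogeneous_parts[where n = m and c = v, OF v]) (use that in auto)
  \<comment> \<open>The cocycle hypothesis speaks of simplices starting at the identity; translation
    by the first vertex extends it to all simplices of this dimension.\<close>
  have dF: "bd M (F x) l = \<zero>\<^bsub>M\<^esub>"
    if "x \<in> I" "l \<in> lists (carrier G)" "length l = Suc (Suc (Suc m))" for x l
  proof -
    let ?d = "increments G l" and ?y = "\<tau> (inv\<^bsub>G\<^esub> hd l) x"
    have l: "l \<noteq> []" "hd l \<in> carrier G" using that by (cases l; auto)+
    have d: "?d \<in> tuples G (Suc (Suc m))" using that G.increments_closed by (simp add: tuples_lists)
    have y: "?y \<in> I" using ix_closed that l by simp
    have "bd M (F ?y) (parts G \<one>\<^bsub>G\<^esub> ?d) = \<zero>\<^bsub>M\<^esub>"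
      using bd_parts[OF F y d] indexed_coboundary_cong[OF Fp c y d] cocycle[OF y d] by simp
    then show ?thesis
      using equivariant_increments[OF equivariant_bd[OF F] that(1,2) l(1)] act_zero[OF l(2)] by simp
  qed
  \<comment> \<open>The same translation for the local primitive. Here \<open>P_eq\<close> is needed
    too: it carries the vertices of l into the admissible set of the translated index.\<close>
  have FV: "F x l = bd M (V x) l"
    if x: "x \<in> I" and l: "l \<in> lists (carrier G)" "length l = Suc (Suc m)"
      and P: "\<And>a. a \<in> set l \<Longrightarrow> P a x" for x l
  proof -
    let ?d = "increments G l" and ?y = "\<tau> (inv\<^bsub>G\<^esub> hd l) x"
    have h: "l \<noteq> []" "hd l \<in> carrier G" using l by (cases l; auto)+
    have d: "?d \<in> tuples G (Suc m)" using l G.increments_closed by (simp add: tuples_lists)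
    have y: "?y \<in> I" using ix_closed x h by simp
    have map: "map ((\<otimes>\<^bsub>G\<^esub>) (inv\<^bsub>G\<^esub> hd l)) l = parts G \<one>\<^bsub>G\<^esub> ?d"
      using G.map_parts[of "inv\<^bsub>G\<^esub> hd l" "hd l" ?d] G.parts_increments[OF l(1) h(1)] h d
      by (simp add: tuples_lists)
    have "P a ?y" if a: "a \<in> set (parts G \<one>\<^bsub>G\<^esub> ?d)" for a
    proof -
      obtain b where "b \<in> set l" "a = inv\<^bsub>G\<^esub> hd l \<otimes>\<^bsub>G\<^esub> b" using a unfolding map[symmetric] set_map by (rule imageE)
      then show ?thesis using P P_eq[OF x, of b "inv\<^bsub>G\<^esub> hd l"] l h by auto
    qed
    then have "F ?y (parts G \<one>\<^bsub>G\<^esub> ?d) = bd M (V ?y) (parts G \<one>\<^bsub>G\<^esub> ?d)"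
      using local[OF y d] Fp[OF y d] bd_parts[OF V y d] indexed_coboundary_cong[OF Vp v y d] by simp
    then show ?thesis
      using equivariant_increments[OF F x l(1) h(1)] equivariant_increments[OF equivariant_bd[OF V] x l(1) h(1)] by simp
  qed
  \<comment> \<open>The choices for different x are unrelated, even within one orbit.\<close>
  define s where "s x = (SOME a. a \<in> carrier G \<and> P a x)" for x
  have s: "s x \<in> carrier G" "P (s x) x" if "x \<in> I" for x
    using someI_ex[of "\<lambda>a. a \<in> carrier G \<and> P a x"] P_ex[OF that] unfolding s_def by blast+
  \<comment> \<open>The equivariant extension of the choice \<open>s\<close>: the pair (x, a) is the
    translate by a of the pair consisting of \<open>\<tau> (inv a) x\<close> and the identity, so
    its value must be a times the value chosen there.\<close>
  define p where "p x a = a \<otimes>\<^bsub>G\<^esub> s (\<tau> (inv\<^bsub>G\<^esub> a) x)" for x a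
  have p: "p x \<in> carrier G \<rightarrow> carrier G" if "x \<in> I" for x
    unfolding p_def using s ix_closed that by auto
  have pP: "P (p x a) x" if "x \<in> I" "a \<in> carrier G" for x a
    using P_eq[OF ix_closed s(1) that(2) s(2), of "inv\<^bsub>G\<^esub> a" x] that
    by (simp add: p_def ix_closed ix_inv)
  have p_eq: "p (\<tau> g x) (g \<otimes>\<^bsub>G\<^esub> a) = g \<otimes>\<^bsub>G\<^esub> p x a"
    if "x \<in> I" "g \<in> carrier G" "a \<in> carrier G" for x g a
  proof -
    have "\<tau> (inv\<^bsub>G\<^esub> (g \<otimes>\<^bsub>G\<^esub> a)) (\<tau> g x) = \<tau> (inv\<^bsub>G\<^esub> a) x"
      using that by (simp flip: ix_mult add: G.inv_mult_group G.m_assoc)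
    then show ?thesis using that s ix_closed by (simp add: p_def G.m_assoc)
  qed
  define H where "H x l = V x (map (p x) l) \<ominus>\<^bsub>M\<^esub> prism M (p x) (F x) l" for x l
  have pV: "equivariant (\<lambda>x l. V x (map (p x) l))" by (rule equivariant_pullback[OF V p p_eq])
  have hF: "equivariant (\<lambda>x. prism M (p x) (F x))" by (rule equivariant_prism[OF F p p_eq])
  have H: "equivariant H"
    using equivariant_minus[OF pV hF] by (simp add: H_def[abs_def])
  have dH: "bd M (H x) l = F x l"
    if x: "x \<in> I" and l: "l \<in> lists (carrier G)" "length l = Suc (Suc m)" for x l
  proof -
    have pl: "map (p x) l \<in> lists (carrier G)" using p[OF x] l by (auto simp: in_lists_conv_set)
    have Fc: "F x l \<in> carrier M" "F x (map (p x) l) \<in> carrier M"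
      using equivariant_closed[OF F x] l pl by auto
    have hc: "bd M (prism M (p x) (F x)) l \<in> carrier M"
      using M.bd_closed[OF equivariant_closed[OF hF x]] l by simp
    have "prism M (p x) (bd M (F x)) l = \<zero>\<^bsub>M\<^esub>"
    proof (rule M.prism_zero)
      fix k assume k: "length k = Suc (length l)" "set k \<subseteq> set l \<union> p x ` set l"
      then have "k \<in> lists (carrier G)" using l p[OF x] by (fastforce simp: in_lists_conv_set)
      then show "bd M (F x) k = \<zero>\<^bsub>M\<^esub>" using dF[OF x] k l by simp
    qed
    then have h: "bd M (prism M (p x) (F x)) l = F x (map (p x) l) \<ominus>\<^bsub>M\<^esub> F x l"
      using M.prism_homotopy[OF equivariant_closed[OF F x] l(1) p[OF x]] hc by simp
    have "bd M (H x) l = bd M (V x) (map (p x) l) \<ominus>\<^bsub>M\<^esub> (F x (map (p x) l) \<ominus>\<^bsub>M\<^esub> F x l)"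
      unfolding H_def[abs_def] h[symmetric] bd_map[symmetric]
      by (rule M.bd_minus[OF equivariant_closed[OF pV x] equivariant_closed[OF hF x] l(1)])
    also have "bd M (V x) (map (p x) l) = F x (map (p x) l)"
      by (rule FV[symmetric, OF x pl]) (use l pP[OF x] in auto)
    also have "F x (map (p x) l) \<ominus>\<^bsub>M\<^esub> (F x (map (p x) l) \<ominus>\<^bsub>M\<^esub> F x l) = F x l"
      using Fc by (simp add: a_minus_def M.minus_add M.minus_minus M.a_assoc[symmetric] M.r_neg)
    finally show ?thesis .
  qed
  show ?thesis
  proof (rule that[of "\<lambda>x gs. H x (parts G \<one>\<^bsub>G\<^esub> gs)"])
    fix x gs assume "x \<in> I" "gs \<in> tuples G m"
    then show "H x (parts G \<one>\<^bsub>G\<^esub> gs) \<in> carrier M"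
      using equivariant_closed[OF H] G.parts_closed[OF G.one_closed] by (auto simp: tuples_lists Pi_def)
  next
    fix x gs assume x: "x \<in> I" and gs: "gs \<in> tuples G (Suc m)"
    then have "parts G \<one>\<^bsub>G\<^esub> gs \<in> lists (carrier G)" "length (parts G \<one>\<^bsub>G\<^esub> gs) = Suc (Suc m)"
      using G.parts_closed[OF G.one_closed] by (auto simp: tuples_lists)
    then show "indexed_coboundary m (\<lambda>x gs. H x (parts G \<one>\<^bsub>G\<^esub> gs)) x gs = c x gs"
      using bd_parts[OF H x gs] dH[OF x] Fp[OF x gs] by simp
  qed
qed

end

section \<open>Primitive central idempotents\<close>

text \<open>Minimality is expressed by products with arbitrary central idempotents, so that it makes
  sense in B, which may have no unit.\<close>

definition primitive_idempotent :: "('a, 'q) ring_scheme \<Rightarrow> 'a \<Rightarrow> bool"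
  where "primitive_idempotent R x \<longleftrightarrow> central_idempotent R x \<and> x \<noteq> \<zero>\<^bsub>R\<^esub> \<and>
    (\<forall>c. central_idempotent R c \<longrightarrow> x \<otimes>\<^bsub>R\<^esub> c = x \<or> x \<otimes>\<^bsub>R\<^esub> c = \<zero>\<^bsub>R\<^esub>)"

text \<open>A nonzero product of two primitive idempotents equals each factor in turn.\<close>

lemma primitive_idempotent_eq:
  assumes "primitive_idempotent R x" "primitive_idempotent R y" "x \<otimes>\<^bsub>R\<^esub> y \<noteq> \<zero>\<^bsub>R\<^esub>"
  shows "x = y"
  using assms unfolding primitive_idempotent_def central_idempotent_def by metis

context
  fixes A (structure) and \<Lambda> :: "'l set" and S :: "'l \<Rightarrow> ('c, 't) ring_scheme"
  assumes ring_A: "ring A"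
    and S: "\<And>l. l \<in> \<Lambda> \<Longrightarrow> indecomposable_ring (S l)"
    and iso: "A \<simeq> product_ring \<Lambda> S"
begin

interpretation A: ring A by (rule ring_A)

lemma product_components:
  obtains \<psi> where "\<And>l. l \<in> \<Lambda> \<Longrightarrow> \<psi> l \<in> ring_hom A (S l)"
    and "\<And>a b. \<lbrakk>a \<in> carrier A; b \<in> carrier A; \<And>l. l \<in> \<Lambda> \<Longrightarrow> \<psi> l a = \<psi> l b\<rbrakk> \<Longrightarrow> a = b"
    and "\<And>s. (\<And>l. l \<in> \<Lambda> \<Longrightarrow> s l \<in> carrier (S l)) \<Longrightarrow> \<exists>a\<in>carrier A. \<forall>l\<in>\<Lambda>. \<psi> l a = s l"
proof -
  obtain h where "h \<in> ring_iso A (product_ring \<Lambda> S)"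
    using iso by (auto simp: is_ring_iso_def)
  then have h: "h \<in> ring_hom A (product_ring \<Lambda> S)"
    and bij: "bij_betw h (carrier A) (\<Pi>\<^sub>E l\<in>\<Lambda>. carrier (S l))"
    by (auto simp: ring_iso_def product_ring_def)
  have hc: "h a \<in> (\<Pi>\<^sub>E l\<in>\<Lambda>. carrier (S l))" if "a \<in> carrier A" for a
    using bij that by (auto simp: bij_betw_def)
  show ?thesis
  proof (rule that[of "\<lambda>l a. h a l"])
    fix l assume "l \<in> \<Lambda>"
    then show "(\<lambda>a. h a l) \<in> ring_hom A (S l)"
      using hc ring_hom_mult[OF h] ring_hom_add[OF h] ring_hom_one[OF h]
      by (intro ring_hom_memI) (auto simp: product_ring_def)
  next
    fix a b assume ab: "a \<in> carrier A" "b \<in> carrier A" "\<And>l. l \<in> \<Lambda> \<Longrightarrow> h a l = h b l"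
    then have "h a = h b" by (intro PiE_ext[OF hc hc])
    then show "a = b" using bij ab by (auto simp: bij_betw_def inj_on_def)
  next
    fix s assume "\<And>l. l \<in> \<Lambda> \<Longrightarrow> s l \<in> carrier (S l)"
    then have "restrict s \<Lambda> \<in> h ` carrier A" using bij by (auto simp: bij_betw_def)
    then obtain a where "a \<in> carrier A" "h a = restrict s \<Lambda>" by auto
    then show "\<exists>a\<in>carrier A. \<forall>l\<in>\<Lambda>. h a l = s l" by (intro bexI[of _ a]) auto
  qed
qed

text \<open>\<open>E l\<close> has coordinate one at l and zero elsewhere. Its primitivity is the
  indecomposability of \<open>S l\<close>, and gluing over all of \<open>\<Lambda>\<close>, possibly
  infinite, is surjectivity onto the full product.\<close>

lemma product_idempotents:
  obtains E where "\<And>l. l \<in> \<Lambda> \<Longrightarrow> primitive_idempotent A (E l)"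
    and "\<And>a. \<lbrakk>a \<in> carrier A; \<And>l. l \<in> \<Lambda> \<Longrightarrow> E l \<otimes> a = \<zero>\<rbrakk> \<Longrightarrow> a = \<zero>"
    and "\<And>f. (\<And>l. l \<in> \<Lambda> \<Longrightarrow> f l \<in> carrier A) \<Longrightarrow> \<exists>a\<in>carrier A. \<forall>l\<in>\<Lambda>. E l \<otimes> a = E l \<otimes> f l"
proof -
  from product_components obtain \<psi>
    where hom: "\<And>l. l \<in> \<Lambda> \<Longrightarrow> \<psi> l \<in> ring_hom A (S l)"
    and ext: "\<And>a b. \<lbrakk>a \<in> carrier A; b \<in> carrier A; \<And>l. l \<in> \<Lambda> \<Longrightarrow> \<psi> l a = \<psi> l b\<rbrakk> \<Longrightarrow> a = b"
    and ex: "\<And>s. (\<And>l. l \<in> \<Lambda> \<Longrightarrow> s l \<in> carrier (S l)) \<Longrightarrow> \<exists>a\<in>carrier A. \<forall>l\<in>\<Lambda>. \<psi> l a = s l"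
    by blast
  have S_ring: "ring (S l)" if "l \<in> \<Lambda>" for l using S[OF that] by (simp add: indecomposable_ring_def)
  have S_one: "\<one>\<^bsub>S l\<^esub> \<in> carrier (S l)" and S_zero: "\<zero>\<^bsub>S l\<^esub> \<in> carrier (S l)" if "l \<in> \<Lambda>" for l
    using ring.ring_simprules(2,6)[OF S_ring[OF that]] by auto
  have null: "s \<otimes>\<^bsub>S l\<^esub> \<zero>\<^bsub>S l\<^esub> = \<zero>\<^bsub>S l\<^esub>" "\<zero>\<^bsub>S l\<^esub> \<otimes>\<^bsub>S l\<^esub> s = \<zero>\<^bsub>S l\<^esub>"
    and unit: "s \<otimes>\<^bsub>S l\<^esub> \<one>\<^bsub>S l\<^esub> = s" "\<one>\<^bsub>S l\<^esub> \<otimes>\<^bsub>S l\<^esub> s = s"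
    if "l \<in> \<Lambda>" "s \<in> carrier (S l)" for l s
  proof -
    interpret Sl: ring "S l" by (rule S_ring[OF that(1)])
    show "s \<otimes>\<^bsub>S l\<^esub> \<zero>\<^bsub>S l\<^esub> = \<zero>\<^bsub>S l\<^esub>" "\<zero>\<^bsub>S l\<^esub> \<otimes>\<^bsub>S l\<^esub> s = \<zero>\<^bsub>S l\<^esub>"
      "s \<otimes>\<^bsub>S l\<^esub> \<one>\<^bsub>S l\<^esub> = s" "\<one>\<^bsub>S l\<^esub> \<otimes>\<^bsub>S l\<^esub> s = s"
      using that by simp_all
  qed
  have hc: "\<psi> l a \<in> carrier (S l)" if "l \<in> \<Lambda>" "a \<in> carrier A" for l a
    using ring_hom_closed[OF hom] that by blast
  have hm: "\<psi> l (a \<otimes> b) = \<psi> l a \<otimes>\<^bsub>S l\<^esub> \<psi> l b"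
    if "l \<in> \<Lambda>" "a \<in> carrier A" "b \<in> carrier A" for l a b
    using ring_hom_mult[OF hom] that by blast
  have hz: "\<psi> l \<zero> = \<zero>\<^bsub>S l\<^esub>" if "l \<in> \<Lambda>" for l
    using ring_hom_zero[OF hom[OF that] ring_A S_ring[OF that]] .
  have "\<forall>l\<in>\<Lambda>. \<exists>a\<in>carrier A. \<forall>m\<in>\<Lambda>. \<psi> m a = (if m = l then \<one>\<^bsub>S m\<^esub> else \<zero>\<^bsub>S m\<^esub>)"
    by (intro ballI ex) (use S_one S_zero in auto)
  then obtain E where Ec: "\<And>l. l \<in> \<Lambda> \<Longrightarrow> E l \<in> carrier A"
    and E: "\<And>l m. \<lbrakk>l \<in> \<Lambda>; m \<in> \<Lambda>\<rbrakk> \<Longrightarrow> \<psi> m (E l) = (if m = l then \<one>\<^bsub>S m\<^esub> else \<zero>\<^bsub>S m\<^esub>)"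
    by metis
  have Em: "\<psi> m (E l \<otimes> a) = (if m = l then \<psi> m a else \<zero>\<^bsub>S m\<^esub>)"
    "\<psi> m (a \<otimes> E l) = (if m = l then \<psi> m a else \<zero>\<^bsub>S m\<^esub>)"
    if "l \<in> \<Lambda>" "m \<in> \<Lambda>" "a \<in> carrier A" for l m a
    using that by (auto simp: hm Ec E null unit hc)
  show ?thesis
  proof (rule that[of E])
    fix l assume l: "l \<in> \<Lambda>"
    have "E l \<otimes> E l = E l" by (rule ext) (use l Ec in \<open>auto simp: Em E\<close>)
    moreover have "E l \<otimes> a = a \<otimes> E l" if "a \<in> carrier A" for a
      by (rule ext) (use l Ec that in \<open>auto simp: Em\<close>)
    ultimately have ci: "central_idempotent A (E l)"
      using Ec[OF l] unfolding central_idempotent_def by blast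
    have nz: "E l \<noteq> \<zero>"
    proof
      assume "E l = \<zero>"
      then have "\<one>\<^bsub>S l\<^esub> = \<zero>\<^bsub>S l\<^esub>" using E[OF l l] hz[OF l] by simp
      then show False using S[OF l] by (simp add: indecomposable_ring_def)
    qed
    have "E l \<otimes> c = E l \<or> E l \<otimes> c = \<zero>" if c: "central_idempotent A c" for c
    proof -
      have cA: "c \<in> carrier A" using c by (simp add: central_idempotent_def)
      \<comment> \<open>Centrality in the factor uses that every element of \<open>S l\<close> is a
        coordinate of some element of A.\<close>
      have "central_idempotent (S l) (\<psi> l c)"
        unfolding central_idempotent_def
      proof (intro conjI ballI)
        show "\<psi> l c \<otimes>\<^bsub>S l\<^esub> \<psi> l c = \<psi> l c"
          using c cA l by (simp flip: hm add: central_idempotent_def)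
        fix s assume s: "s \<in> carrier (S l)"
        have "\<exists>a\<in>carrier A. \<forall>m\<in>\<Lambda>. \<psi> m a = (if m = l then s else \<zero>\<^bsub>S m\<^esub>)"
          by (rule ex) (use s S_zero in auto)
        then obtain a where a: "a \<in> carrier A" "\<psi> l a = s" using l by auto
        then show "\<psi> l c \<otimes>\<^bsub>S l\<^esub> s = s \<otimes>\<^bsub>S l\<^esub> \<psi> l c"
          using c cA l by (auto simp flip: hm simp add: central_idempotent_def)
      qed (use hc l cA in simp)
      then have "\<psi> l c = \<zero>\<^bsub>S l\<^esub> \<or> \<psi> l c = \<one>\<^bsub>S l\<^esub>"
        using S[OF l] by (simp add: indecomposable_ring_def)
      then show ?thesis
      proof
        assume "\<psi> l c = \<zero>\<^bsub>S l\<^esub>"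
        then have "E l \<otimes> c = \<zero>" by (intro ext) (use l cA Ec in \<open>auto simp: Em hz\<close>)
        then show ?thesis ..
      next
        assume "\<psi> l c = \<one>\<^bsub>S l\<^esub>"
        then have "E l \<otimes> c = E l" by (intro ext) (use l cA Ec in \<open>auto simp: Em E\<close>)
        then show ?thesis ..
      qed
    qed
    with ci nz show "primitive_idempotent A (E l)" by (simp add: primitive_idempotent_def)
  next
    fix a assume a: "a \<in> carrier A" "\<And>l. l \<in> \<Lambda> \<Longrightarrow> E l \<otimes> a = \<zero>"
    show "a = \<zero>"
    proof (rule ext)
      fix l assume l: "l \<in> \<Lambda>"
      show "\<psi> l a = \<psi> l \<zero>" using Em(1)[OF l l a(1)] a(2)[OF l] by simp
    qed (use a in simp_all)
  next
    fix f assume f: "\<And>l. l \<in> \<Lambda> \<Longrightarrow> f l \<in> carrier A"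
    obtain a where a: "a \<in> carrier A" "\<And>l. l \<in> \<Lambda> \<Longrightarrow> \<psi> l a = \<psi> l (f l)"
      using ex[of "\<lambda>l. \<psi> l (f l)"] hc f by auto
    have "E l \<otimes> a = E l \<otimes> f l" if l: "l \<in> \<Lambda>" for l
      by (rule ext) (use l a f Ec in \<open>auto simp: Em\<close>)
    then show "\<exists>a\<in>carrier A. \<forall>l\<in>\<Lambda>. E l \<otimes> a = E l \<otimes> f l" using a by auto
  qed
qed

lemma product_primitive_separate:
  assumes "a \<in> carrier A" "\<And>x. primitive_idempotent A x \<Longrightarrow> x \<otimes> a = \<zero>"
  shows "a = \<zero>"
  using product_idempotents assms by metis

text \<open>A primitive idempotent x is nonzero, so some \<open>E l\<close> has nonzero product with
  it, and then x is that \<open>E l\<close>. This trades the index set \<open>\<Lambda>\<close>, on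
  which G does not act, for intrinsic idempotents whose images in B the action permutes.\<close>

lemma product_primitive_glue:
  assumes f: "\<And>x. primitive_idempotent A x \<Longrightarrow> f x \<in> carrier A"
  shows "\<exists>a\<in>carrier A. \<forall>x. primitive_idempotent A x \<longrightarrow> x \<otimes> a = x \<otimes> f x"
proof -
  from product_idempotents obtain E
    where prim: "\<And>l. l \<in> \<Lambda> \<Longrightarrow> primitive_idempotent A (E l)"
    and sep: "\<And>a. \<lbrakk>a \<in> carrier A; \<And>l. l \<in> \<Lambda> \<Longrightarrow> E l \<otimes> a = \<zero>\<rbrakk> \<Longrightarrow> a = \<zero>"
    and glue: "\<And>f. (\<And>l. l \<in> \<Lambda> \<Longrightarrow> f l \<in> carrier A) \<Longrightarrow>
      \<exists>a\<in>carrier A. \<forall>l\<in>\<Lambda>. E l \<otimes> a = E l \<otimes> f l"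
    by blast
  obtain a where a: "a \<in> carrier A" "\<And>l. l \<in> \<Lambda> \<Longrightarrow> E l \<otimes> a = E l \<otimes> f (E l)"
    using glue[of "\<lambda>l. f (E l)"] f prim by blast
  have "x \<otimes> a = x \<otimes> f x" if x: "primitive_idempotent A x" for x
  proof -
    have "x \<in> carrier A" "x \<noteq> \<zero>"
      using x by (auto simp: primitive_idempotent_def central_idempotent_def)
    then obtain l where "l \<in> \<Lambda>" "E l \<otimes> x \<noteq> \<zero>" using sep by blast
    then show ?thesis using primitive_idempotent_eq[OF prim x] a by auto
  qed
  then show ?thesis using a by blast
qed

end

section \<open>Enveloping actions\<close>

context nonunital_algebra
begin

lemma mult_hom_l: "x \<in> carrier B \<Longrightarrow> (\<lambda>y. x \<otimes>\<^bsub>B\<^esub> y) \<in> hom (add_monoid B) (add_monoid B)"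
  by (auto simp: hom_def mult_closed mult_r_distr)

lemma mult_hom_r: "x \<in> carrier B \<Longrightarrow> (\<lambda>y. y \<otimes>\<^bsub>B\<^esub> x) \<in> hom (add_monoid B) (add_monoid B)"
  by (auto simp: hom_def mult_closed mult_l_distr)

lemmas mult_zero_r = add_hom_zero[OF M.abelian_group_axioms M.abelian_group_axioms mult_hom_l]
lemmas mult_zero_l = add_hom_zero[OF M.abelian_group_axioms M.abelian_group_axioms mult_hom_r]
lemmas mult_minus_r = add_hom_minus[OF M.abelian_group_axioms M.abelian_group_axioms mult_hom_l]
lemmas mult_finsum_r = add_hom_finsum[OF M.abelian_group_axioms M.abelian_group_axioms mult_hom_l]

lemma central_idempotentD:
  assumes "central_idempotent B c"
  shows "c \<in> carrier B" "c \<otimes>\<^bsub>B\<^esub> c = c" "b \<in> carrier B \<Longrightarrow> b \<otimes>\<^bsub>B\<^esub> c = c \<otimes>\<^bsub>B\<^esub> b"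
  using assms by (simp_all add: central_idempotent_def)

lemma central_left_commute:
  "\<lbrakk>central_idempotent B c; a \<in> carrier B; b \<in> carrier B\<rbrakk> \<Longrightarrow>
    a \<otimes>\<^bsub>B\<^esub> (c \<otimes>\<^bsub>B\<^esub> b) = c \<otimes>\<^bsub>B\<^esub> (a \<otimes>\<^bsub>B\<^esub> b)"
  by (metis central_idempotentD(1,3) mult_assoc)

lemma mult_closed_PiI: "x \<in> carrier B \<Longrightarrow> f \<in> I \<rightarrow> carrier B \<Longrightarrow> (\<lambda>i. x \<otimes>\<^bsub>B\<^esub> f i) \<in> I \<rightarrow> carrier B"
  by (auto intro: mult_closed)

text \<open>As \<open>c h\<close> kills b, one has \<open>b = b - c h b\<close>. Distributing over
  the sum turns each \<open>f g\<close> into \<open>f g - c h f g\<close>, and the summand at h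
  drops out. This is the identity saying that the product of all 1 - c_g kills the sum of the
  ideals, arranged so that no unit of B is needed.\<close>

lemma sum_of_unital_ideals_separate:
  assumes "finite F" "\<And>g. g \<in> F \<Longrightarrow> central_idempotent B (c g)"
    and "f \<in> F \<rightarrow> carrier B" "\<And>g. g \<in> F \<Longrightarrow> c g \<otimes>\<^bsub>B\<^esub> f g = f g"
    and "b = (\<Oplus>\<^bsub>B\<^esub>g\<in>F. f g)" "\<And>g. g \<in> F \<Longrightarrow> c g \<otimes>\<^bsub>B\<^esub> b = \<zero>\<^bsub>B\<^esub>"
  shows "b = \<zero>\<^bsub>B\<^esub>"
  using assms
proof (induction F arbitrary: f b rule: finite_induct)
  case (insert h F)
  note ch = insert.prems(1)[OF insertI1]
  have chB: "c h \<in> carrier B" by (rule central_idempotentD(1)[OF ch])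
  have f: "f h \<in> carrier B" "f \<in> F \<rightarrow> carrier B" using insert.prems by auto
  have b: "b = f h \<oplus>\<^bsub>B\<^esub> (\<Oplus>\<^bsub>B\<^esub>g\<in>F. f g)" using insert f by simp
  let ?f = "\<lambda>g. f g \<ominus>\<^bsub>B\<^esub> c h \<otimes>\<^bsub>B\<^esub> f g"
  have cf: "(\<lambda>g. c h \<otimes>\<^bsub>B\<^esub> f g) \<in> F \<rightarrow> carrier B" using mult_closed_PiI[OF chB f(2)] .
  have ncf: "(\<lambda>g. \<ominus>\<^bsub>B\<^esub> (c h \<otimes>\<^bsub>B\<^esub> f g)) \<in> F \<rightarrow> carrier B" using cf by auto
  have hb: "c h \<otimes>\<^bsub>B\<^esub> b = \<zero>\<^bsub>B\<^esub>" by (rule insert.prems(5)) simp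
  have uh: "(\<lambda>x. \<ominus>\<^bsub>B\<^esub> x) \<in> hom (add_monoid B) (add_monoid B)"
    by (auto simp: hom_def M.minus_add)
  have chfh: "c h \<otimes>\<^bsub>B\<^esub> f h = f h" by (rule insert.prems(3)) simp
  have "(\<Oplus>\<^bsub>B\<^esub>g\<in>F. ?f g) = (\<Oplus>\<^bsub>B\<^esub>g\<in>F. f g) \<ominus>\<^bsub>B\<^esub> (\<Oplus>\<^bsub>B\<^esub>g\<in>F. c h \<otimes>\<^bsub>B\<^esub> f g)"
    unfolding a_minus_def M.finsum_addf[OF f(2) ncf]
    using add_hom_finsum[OF M.abelian_group_axioms M.abelian_group_axioms uh cf] by simp
  also have "(\<Oplus>\<^bsub>B\<^esub>g\<in>F. c h \<otimes>\<^bsub>B\<^esub> f g) = c h \<otimes>\<^bsub>B\<^esub> (\<Oplus>\<^bsub>B\<^esub>g\<in>F. f g)"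
    using mult_finsum_r[OF chB f(2)] by simp
  also have "\<dots> = \<ominus>\<^bsub>B\<^esub> f h"
  proof (rule M.minus_equality[symmetric])
    show "c h \<otimes>\<^bsub>B\<^esub> (\<Oplus>\<^bsub>B\<^esub>g\<in>F. f g) \<oplus>\<^bsub>B\<^esub> f h = \<zero>\<^bsub>B\<^esub>"
      using hb f M.finsum_closed[OF f(2)] chB unfolding b
      by (simp add: mult_r_distr chfh M.a_comm mult_closed)
  qed (use f M.finsum_closed[OF f(2)] chB in \<open>simp_all add: mult_closed\<close>)
  also have "(\<Oplus>\<^bsub>B\<^esub>g\<in>F. f g) \<ominus>\<^bsub>B\<^esub> \<ominus>\<^bsub>B\<^esub> f h = b"
    using f M.finsum_closed[OF f(2)] by (simp add: b a_minus_def M.minus_minus M.a_comm)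
  finally have sum: "b = (\<Oplus>\<^bsub>B\<^esub>g\<in>F. ?f g)" ..
  show ?case
  proof (rule insert.IH[OF _ _ _ sum])
    show "?f \<in> F \<rightarrow> carrier B" using f cf by auto
    fix g assume g: "g \<in> F"
    then show "central_idempotent B (c g)" "c g \<otimes>\<^bsub>B\<^esub> b = \<zero>\<^bsub>B\<^esub>" using insert.prems by auto
    have cg: "central_idempotent B (c g)" "c g \<otimes>\<^bsub>B\<^esub> f g = f g" "f g \<in> carrier B"
      using g insert.prems by auto
    then show "c g \<otimes>\<^bsub>B\<^esub> ?f g = ?f g"
      using chB central_left_commute[OF ch, of "c g" "f g"]
      by (simp add: mult_minus_r central_idempotentD mult_closed)
  qed
qed simp

end

text \<open>The two assumptions \<open>separate\<close> and \<open>glue\<close> carry everything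
  that is used of the product decomposition of A, stated without its index set or factors.\<close>

locale enveloping = unital_partial_action K A G D \<alpha> e
  for K :: "('k, 'p) ring_scheme" (structure) and A :: "('k, 'a, 'q) module_scheme" (structure)
    and G :: "('g, 'r) monoid_scheme" (structure) and D and \<alpha> and e +
  fixes B :: "('k, 'b, 's) module_scheme" and \<beta> and \<phi>
  assumes env: "enveloping_action K A G D \<alpha> B \<beta> \<phi>"
    and separate: "\<And>a. \<lbrakk>a \<in> carrier A; \<And>x. primitive_idempotent A x \<Longrightarrow> x \<otimes>\<^bsub>A\<^esub> a = \<zero>\<^bsub>A\<^esub>\<rbrakk> \<Longrightarrow> a = \<zero>\<^bsub>A\<^esub>"
    and glue: "\<And>f. (\<And>x. primitive_idempotent A x \<Longrightarrow> f x \<in> carrier A) \<Longrightarrow>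
      \<exists>a\<in>carrier A. \<forall>x. primitive_idempotent A x \<longrightarrow> x \<otimes>\<^bsub>A\<^esub> a = x \<otimes>\<^bsub>A\<^esub> f x"
begin

lemma global: "global_action K B G \<beta>"
  using env unfolding enveloping_action_def by (rule conjunct1)

sublocale B: nonunital_algebra K B
  using global by (simp add: global_action_def)

sublocale action: group_action G "carrier B" \<beta>
  using global by (simp add: global_action_def)

lemma beta_iso: "g \<in> carrier G \<Longrightarrow> \<beta> g \<in> algebra_iso K B B"
  using global by (simp add: global_action_def)

lemma beta_closed: "\<lbrakk>g \<in> carrier G; b \<in> carrier B\<rbrakk> \<Longrightarrow> \<beta> g b \<in> carrier B"
  and beta_add: "\<lbrakk>g \<in> carrier G; b \<in> carrier B; c \<in> carrier B\<rbrakk> \<Longrightarrow> \<beta> g (b \<oplus>\<^bsub>B\<^esub> c) = \<beta> g b \<oplus>\<^bsub>B\<^esub> \<beta> g c"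
  and beta_mult: "\<lbrakk>g \<in> carrier G; b \<in> carrier B; c \<in> carrier B\<rbrakk> \<Longrightarrow> \<beta> g (b \<otimes>\<^bsub>B\<^esub> c) = \<beta> g b \<otimes>\<^bsub>B\<^esub> \<beta> g c"
  and beta_smult: "\<lbrakk>g \<in> carrier G; k \<in> carrier K; b \<in> carrier B\<rbrakk> \<Longrightarrow> \<beta> g (k \<odot>\<^bsub>B\<^esub> b) = k \<odot>\<^bsub>B\<^esub> \<beta> g b"
  using beta_iso[of g] unfolding algebra_iso_def algebra_hom_def by blast+

lemma beta_comp: "\<lbrakk>g \<in> carrier G; h \<in> carrier G; b \<in> carrier B\<rbrakk> \<Longrightarrow> \<beta> g (\<beta> h b) = \<beta> (g \<otimes>\<^bsub>G\<^esub> h) b"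
  by (rule action.composition_rule[symmetric])

lemma beta_one: "b \<in> carrier B \<Longrightarrow> \<beta> \<one>\<^bsub>G\<^esub> b = b"
  using fun_cong[OF action.id_eq_one, of b] by simp

lemma beta_inv:
  assumes "g \<in> carrier G" "b \<in> carrier B"
  shows "\<beta> (inv\<^bsub>G\<^esub> g) (\<beta> g b) = b" "\<beta> g (\<beta> (inv\<^bsub>G\<^esub> g) b) = b"
  using assms by (simp_all add: beta_comp beta_one)

lemma beta_hom: "g \<in> carrier G \<Longrightarrow> \<beta> g \<in> hom (add_monoid B) (add_monoid B)"
  by (auto simp: hom_def beta_closed beta_add)

lemmas beta_zero = add_hom_zero[OF B.M.abelian_group_axioms B.M.abelian_group_axioms beta_hom]

lemma phi_closed: "a \<in> carrier A \<Longrightarrow> \<phi> a \<in> carrier B"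
  and phi_add: "\<lbrakk>a \<in> carrier A; b \<in> carrier A\<rbrakk> \<Longrightarrow> \<phi> (a \<oplus>\<^bsub>A\<^esub> b) = \<phi> a \<oplus>\<^bsub>B\<^esub> \<phi> b"
  and phi_mult: "\<lbrakk>a \<in> carrier A; b \<in> carrier A\<rbrakk> \<Longrightarrow> \<phi> (a \<otimes>\<^bsub>A\<^esub> b) = \<phi> a \<otimes>\<^bsub>B\<^esub> \<phi> b"
proof -
  have "\<phi> \<in> algebra_hom K A B" using env unfolding enveloping_action_def by (elim conjE)
  then show "a \<in> carrier A \<Longrightarrow> \<phi> a \<in> carrier B"
    and "\<lbrakk>a \<in> carrier A; b \<in> carrier A\<rbrakk> \<Longrightarrow> \<phi> (a \<oplus>\<^bsub>A\<^esub> b) = \<phi> a \<oplus>\<^bsub>B\<^esub> \<phi> b"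
    and "\<lbrakk>a \<in> carrier A; b \<in> carrier A\<rbrakk> \<Longrightarrow> \<phi> (a \<otimes>\<^bsub>A\<^esub> b) = \<phi> a \<otimes>\<^bsub>B\<^esub> \<phi> b"
    unfolding algebra_hom_def by blast+
qed

lemma phi_inj: "inj_on \<phi> (carrier A)"
  using env unfolding enveloping_action_def by (elim conjE)

lemma phi_hom: "\<phi> \<in> hom (add_monoid A) (add_monoid B)"
  by (auto simp: hom_def phi_closed phi_add)

lemmas phi_zero = add_hom_zero[OF A.M.abelian_group_axioms B.M.abelian_group_axioms phi_hom]
lemmas phi_minus = add_hom_minus[OF A.M.abelian_group_axioms B.M.abelian_group_axioms phi_hom]

text \<open>The unit of the translate \<open>\<beta> g (\<phi> A)\<close>, a central idempotent of
  B. A vertex a belongs to the set \<open>S\<^sub>x\<close> exactly when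
  \<open>x \<otimes> eps a = x\<close>.\<close>

definition eps where "eps g = \<beta> g (\<phi> \<one>\<^bsub>A\<^esub>)"

lemma phi_ideal:
  assumes "a \<in> carrier A" "b \<in> carrier B"
  shows "b \<otimes>\<^bsub>B\<^esub> \<phi> a \<in> \<phi> ` carrier A" "\<phi> a \<otimes>\<^bsub>B\<^esub> b \<in> \<phi> ` carrier A"
proof -
  have "two_sided_ideal K B (\<phi> ` carrier A)"
    using env unfolding enveloping_action_def by (elim conjE)
  then show "b \<otimes>\<^bsub>B\<^esub> \<phi> a \<in> \<phi> ` carrier A" "\<phi> a \<otimes>\<^bsub>B\<^esub> b \<in> \<phi> ` carrier A"
    using assms unfolding two_sided_ideal_def by blast+
qed

lemma one_phi:
  assumes "a \<in> carrier A"
  shows "\<phi> \<one>\<^bsub>A\<^esub> \<otimes>\<^bsub>B\<^esub> \<phi> a = \<phi> a" "\<phi> a \<otimes>\<^bsub>B\<^esub> \<phi> \<one>\<^bsub>A\<^esub> = \<phi> a"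
  using assms by (simp_all flip: phi_mult)

text \<open>Both one-sided products of b with \<open>\<phi> \<one>\<close> lie in the ideal
  \<open>\<phi> A\<close>, on which \<open>\<phi> \<one>\<close> is a two-sided unit; hence both
  equal the product with \<open>\<phi> \<one>\<close> on either side of b.\<close>

lemma central_phi_one: "central_idempotent B (\<phi> \<one>\<^bsub>A\<^esub>)"
  unfolding central_idempotent_def
proof (intro conjI ballI)
  show cl: "\<phi> \<one>\<^bsub>A\<^esub> \<in> carrier B" by (simp add: phi_closed)
  show "\<phi> \<one>\<^bsub>A\<^esub> \<otimes>\<^bsub>B\<^esub> \<phi> \<one>\<^bsub>A\<^esub> = \<phi> \<one>\<^bsub>A\<^esub>" by (simp add: one_phi)
  fix b assume b: "b \<in> carrier B"
  obtain a where a: "a \<in> carrier A" "\<phi> \<one>\<^bsub>A\<^esub> \<otimes>\<^bsub>B\<^esub> b = \<phi> a"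
    using phi_ideal(2)[OF A.one_closed b] by auto
  obtain a' where a': "a' \<in> carrier A" "b \<otimes>\<^bsub>B\<^esub> \<phi> \<one>\<^bsub>A\<^esub> = \<phi> a'"
    using phi_ideal(1)[OF A.one_closed b] by auto
  have "\<phi> \<one>\<^bsub>A\<^esub> \<otimes>\<^bsub>B\<^esub> b = (\<phi> \<one>\<^bsub>A\<^esub> \<otimes>\<^bsub>B\<^esub> b) \<otimes>\<^bsub>B\<^esub> \<phi> \<one>\<^bsub>A\<^esub>"
    using a one_phi by simp
  also have "\<dots> = \<phi> \<one>\<^bsub>A\<^esub> \<otimes>\<^bsub>B\<^esub> (b \<otimes>\<^bsub>B\<^esub> \<phi> \<one>\<^bsub>A\<^esub>)" using cl b by (rule B.mult_assoc[OF _ _ cl])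
  also have "\<dots> = b \<otimes>\<^bsub>B\<^esub> \<phi> \<one>\<^bsub>A\<^esub>" using a' one_phi by simp
  finally show "\<phi> \<one>\<^bsub>A\<^esub> \<otimes>\<^bsub>B\<^esub> b = b \<otimes>\<^bsub>B\<^esub> \<phi> \<one>\<^bsub>A\<^esub>" .
qed

lemma mem_phi_iff: "b \<in> \<phi> ` carrier A \<longleftrightarrow> b \<in> carrier B \<and> \<phi> \<one>\<^bsub>A\<^esub> \<otimes>\<^bsub>B\<^esub> b = b"
proof
  assume "b \<in> carrier B \<and> \<phi> \<one>\<^bsub>A\<^esub> \<otimes>\<^bsub>B\<^esub> b = b"
  then show "b \<in> \<phi> ` carrier A" using phi_ideal(2)[OF A.one_closed] by metis
qed (auto simp: phi_closed one_phi)

lemma central_beta: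
  assumes c: "central_idempotent B c" and g: "g \<in> carrier G"
  shows "central_idempotent B (\<beta> g c)"
  unfolding central_idempotent_def
proof (intro conjI ballI)
  note cB = B.central_idempotentD[OF c]
  show "\<beta> g c \<in> carrier B" by (rule beta_closed[OF g cB(1)])
  show "\<beta> g c \<otimes>\<^bsub>B\<^esub> \<beta> g c = \<beta> g c" using cB(1,2) g by (simp flip: beta_mult)
  fix b assume b: "b \<in> carrier B"
  let ?d = "\<beta> (inv\<^bsub>G\<^esub> g) b"
  have d: "?d \<in> carrier B" using b g by (simp add: beta_closed)
  have "\<beta> g c \<otimes>\<^bsub>B\<^esub> \<beta> g ?d = \<beta> g ?d \<otimes>\<^bsub>B\<^esub> \<beta> g c"
    using cB(3)[OF d] cB(1) g d by (simp flip: beta_mult)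
  then show "\<beta> g c \<otimes>\<^bsub>B\<^esub> b = b \<otimes>\<^bsub>B\<^esub> \<beta> g c" using b g by (simp add: beta_inv)
qed

lemma central_eps: "g \<in> carrier G \<Longrightarrow> central_idempotent B (eps g)"
  unfolding eps_def by (rule central_beta[OF central_phi_one])

lemma eps_closed: "g \<in> carrier G \<Longrightarrow> eps g \<in> carrier B"
  using B.central_idempotentD(1)[OF central_eps] .

lemma eps_one: "eps \<one>\<^bsub>G\<^esub> = \<phi> \<one>\<^bsub>A\<^esub>"
  by (simp add: eps_def beta_one phi_closed)

lemma beta_eps: "\<lbrakk>g \<in> carrier G; h \<in> carrier G\<rbrakk> \<Longrightarrow> \<beta> g (eps h) = eps (g \<otimes>\<^bsub>G\<^esub> h)"
  by (simp add: eps_def beta_comp phi_closed)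

lemma mem_beta_phi_iff:
  assumes "g \<in> carrier G"
  shows "b \<in> \<beta> g ` \<phi> ` carrier A \<longleftrightarrow> b \<in> carrier B \<and> eps g \<otimes>\<^bsub>B\<^esub> b = b"
proof
  assume "b \<in> \<beta> g ` \<phi> ` carrier A"
  then obtain a where a: "a \<in> carrier A" "b = \<beta> g (\<phi> a)" by auto
  then show "b \<in> carrier B \<and> eps g \<otimes>\<^bsub>B\<^esub> b = b"
    using assms by (auto simp: eps_def beta_closed phi_closed one_phi simp flip: beta_mult)
next
  assume b: "b \<in> carrier B \<and> eps g \<otimes>\<^bsub>B\<^esub> b = b"
  let ?c = "\<beta> (inv\<^bsub>G\<^esub> g) b"
  have c: "?c \<in> carrier B" using b assms by (simp add: beta_closed)
  have "\<phi> \<one>\<^bsub>A\<^esub> \<otimes>\<^bsub>B\<^esub> ?c = \<beta> (inv\<^bsub>G\<^esub> g) (eps g) \<otimes>\<^bsub>B\<^esub> ?c"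
    using assms by (simp add: beta_eps eps_one)
  also have "\<dots> = ?c" using assms b eps_closed by (simp flip: beta_mult)
  finally have "?c \<in> \<phi> ` carrier A" using c mem_phi_iff by simp
  then show "b \<in> \<beta> g ` \<phi> ` carrier A" using beta_inv(2)[OF assms] b by (metis image_eqI)
qed

text \<open>Both sides are units of the same ideal, the intersection of \<open>\<phi> A\<close> with
  its translate by g, so each absorbs the other. This is the link between the idempotents of the
  partial action and the translates in B.\<close>

lemma phi_e:
  assumes g: "g \<in> carrier G"
  shows "\<phi> (e g) = \<phi> \<one>\<^bsub>A\<^esub> \<otimes>\<^bsub>B\<^esub> eps g"
proof -
  let ?u = "\<phi> \<one>\<^bsub>A\<^esub> \<otimes>\<^bsub>B\<^esub> eps g"
  have eA: "e g \<in> carrier A" "e g \<otimes>\<^bsub>A\<^esub> e g = e g"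
    using idem[OF g] by (auto simp: central_idempotent_def)
  have o: "\<phi> \<one>\<^bsub>A\<^esub> \<in> carrier B" "eps g \<in> carrier B" by (simp_all add: phi_closed eps_closed g)
  have D: "\<phi> ` D g = \<phi> ` carrier A \<inter> \<beta> g ` \<phi> ` carrier A"
    using env g unfolding enveloping_action_def by (elim conjE) (rule bspec)
  have u: "?u \<in> carrier B" using o by (rule B.mult_closed)
  have "?u \<in> \<phi> ` carrier A"
    using phi_ideal(2)[OF A.one_closed o(2)] .
  moreover have "?u \<in> \<beta> g ` \<phi> ` carrier A"
    unfolding mem_beta_phi_iff[OF g]
    using o u B.central_left_commute[OF central_eps[OF g] o(1) o(2)]
    by (simp add: B.central_idempotentD(2)[OF central_eps[OF g]])
  ultimately have "?u \<in> \<phi> ` D g" using D by simp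
  then obtain a where a: "a \<in> carrier A" "?u = \<phi> (e g \<otimes>\<^bsub>A\<^esub> a)"
    unfolding D_eq[OF g] by auto
  then have "\<phi> (e g) \<otimes>\<^bsub>B\<^esub> ?u = ?u"
    using eA by (simp flip: phi_mult A.m_assoc)
  moreover have "\<phi> (e g) \<in> \<phi> ` D g" using eA unfolding D_eq[OF g] by (metis imageI)
  then have "\<phi> (e g) \<in> \<beta> g ` \<phi> ` carrier A" using D by simp
  then have "eps g \<otimes>\<^bsub>B\<^esub> \<phi> (e g) = \<phi> (e g)" unfolding mem_beta_phi_iff[OF g] by simp
  then have "\<phi> (e g) \<otimes>\<^bsub>B\<^esub> ?u = \<phi> (e g)"
    using eA o phi_closed[OF eA(1)] B.central_idempotentD(3)[OF central_eps[OF g], of "\<phi> (e g)"]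
    by (simp flip: B.mult_assoc add: one_phi)
  ultimately show ?thesis by simp
qed

lemma sum_of_translates:
  assumes "b \<in> carrier B"
  obtains F f where "finite F" "F \<subseteq> carrier G" "f \<in> F \<rightarrow> carrier B"
    "\<And>g. g \<in> F \<Longrightarrow> eps g \<otimes>\<^bsub>B\<^esub> f g = f g" "b = (\<Oplus>\<^bsub>B\<^esub>g\<in>F. f g)"
proof -
  have "b \<in> {finsum B b F | F b. finite F \<and> F \<subseteq> carrier G \<and>
                   b \<in> (\<Pi> g\<in>F. \<beta> g ` \<phi> ` carrier A)}"
    using env assms unfolding enveloping_action_def by (elim conjE) (rule equalityD1[THEN subsetD])
  then obtain F f where F: "finite F" "F \<subseteq> carrier G" "f \<in> (\<Pi> g\<in>F. \<beta> g ` \<phi> ` carrier A)"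
    "b = finsum B f F" by blast
  then have "f g \<in> carrier B \<and> eps g \<otimes>\<^bsub>B\<^esub> f g = f g" if "g \<in> F" for g
    using mem_beta_phi_iff that by (blast dest: Pi_mem)
  then show ?thesis using F that[of F f] by auto
qed

text \<open>An additive property of B needs to be checked only on elements of a single translate,
  since these generate B under finite sums.\<close>

lemma translate_induct [consumes 1, case_names zero add translate]:
  assumes "b \<in> carrier B" "P \<zero>\<^bsub>B\<^esub>"
    and "\<And>b c. \<lbrakk>b \<in> carrier B; c \<in> carrier B; P b; P c\<rbrakk> \<Longrightarrow> P (b \<oplus>\<^bsub>B\<^esub> c)"
    and "\<And>g b. \<lbrakk>g \<in> carrier G; b \<in> carrier B; eps g \<otimes>\<^bsub>B\<^esub> b = b\<rbrakk> \<Longrightarrow> P b"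
  shows "P b"
proof -
  obtain F f where F: "finite F" "F \<subseteq> carrier G" "f \<in> F \<rightarrow> carrier B"
    "\<And>g. g \<in> F \<Longrightarrow> eps g \<otimes>\<^bsub>B\<^esub> f g = f g" "b = (\<Oplus>\<^bsub>B\<^esub>g\<in>F. f g)"
    using sum_of_translates[OF assms(1)] by blast
  from F(1-4) have "P (\<Oplus>\<^bsub>B\<^esub>g\<in>F. f g)"
  proof (induction rule: finite_induct)
    case (insert g F)
    then have "f g \<in> carrier B" "f \<in> F \<rightarrow> carrier B" by auto
    with insert assms(3)[of "f g" "\<Oplus>\<^bsub>B\<^esub>g\<in>F. f g"] assms(4)[of g "f g"] show ?case
      by (simp add: B.M.finsum_closed)
  qed (simp add: assms)
  then show ?thesis using F by simp
qed

section \<open>Atoms of B: comparison with A, separation and gluing\<close>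

definition atoms where "atoms = {x. primitive_idempotent B x}"

lemma atom_central: "x \<in> atoms \<Longrightarrow> central_idempotent B x"
  by (simp add: atoms_def primitive_idempotent_def)

lemma atom_closed: "x \<in> atoms \<Longrightarrow> x \<in> carrier B"
  using atom_central B.central_idempotentD(1) by blast

lemma atom_idem: "x \<in> atoms \<Longrightarrow> x \<otimes>\<^bsub>B\<^esub> x = x"
  using atom_central B.central_idempotentD(2) by blast

lemma atom_mult_cases:
  "\<lbrakk>x \<in> atoms; central_idempotent B c\<rbrakk> \<Longrightarrow> x \<otimes>\<^bsub>B\<^esub> c = x \<or> x \<otimes>\<^bsub>B\<^esub> c = \<zero>\<^bsub>B\<^esub>"
  by (auto simp: atoms_def primitive_idempotent_def)

lemma atom_beta:
  assumes x: "x \<in> atoms" and g: "g \<in> carrier G"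
  shows "\<beta> g x \<in> atoms"
proof -
  have xB: "x \<in> carrier B" by (rule atom_closed[OF x])
  have ig: "inv\<^bsub>G\<^esub> g \<in> carrier G" using g by simp
  have "\<beta> g x \<otimes>\<^bsub>B\<^esub> c = \<beta> g x \<or> \<beta> g x \<otimes>\<^bsub>B\<^esub> c = \<zero>\<^bsub>B\<^esub>" if c: "central_idempotent B c" for c
  proof -
    have cB: "c \<in> carrier B" by (rule B.central_idempotentD(1)[OF c])
    have "\<beta> g x \<otimes>\<^bsub>B\<^esub> c = \<beta> g (x \<otimes>\<^bsub>B\<^esub> \<beta> (inv\<^bsub>G\<^esub> g) c)"
      using g cB xB by (simp add: beta_mult beta_inv beta_closed)
    then show ?thesis using atom_mult_cases[OF x central_beta[OF c ig]] beta_zero[OF g] by auto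
  qed
  moreover have "\<beta> g x \<noteq> \<zero>\<^bsub>B\<^esub>"
  proof
    assume "\<beta> g x = \<zero>\<^bsub>B\<^esub>"
    then have "x = \<zero>\<^bsub>B\<^esub>" using beta_inv(1)[OF g xB] beta_zero[OF ig] by simp
    then show False using x by (simp add: atoms_def primitive_idempotent_def)
  qed
  ultimately show ?thesis
    using central_beta[OF atom_central[OF x] g] by (simp add: atoms_def primitive_idempotent_def)
qed

text \<open>An atom annihilated by the units of all translates annihilates every translate, hence B,
  hence itself. This makes the vertex sets \<open>S\<^sub>x\<close> nonempty.\<close>

lemma atom_ex_translate:
  assumes x: "x \<in> atoms"
  shows "\<exists>g\<in>carrier G. x \<otimes>\<^bsub>B\<^esub> eps g = x"
proof (rule ccontr)
  assume "\<not> ?thesis"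
  then have z: "x \<otimes>\<^bsub>B\<^esub> eps g = \<zero>\<^bsub>B\<^esub>" if "g \<in> carrier G" for g
    using atom_mult_cases[OF x central_eps] that by blast
  note xB = atom_closed[OF x]
  have "x \<otimes>\<^bsub>B\<^esub> b = \<zero>\<^bsub>B\<^esub>" if "b \<in> carrier B" for b
    using that
  proof (induction rule: translate_induct)
    case (translate g b)
    then have "x \<otimes>\<^bsub>B\<^esub> b = (x \<otimes>\<^bsub>B\<^esub> eps g) \<otimes>\<^bsub>B\<^esub> b" using xB by (simp add: B.mult_assoc eps_closed)
    then show ?case using translate z by (simp add: B.mult_zero_l)
  qed (simp_all add: B.mult_zero_r B.mult_r_distr xB)
  then have "x = \<zero>\<^bsub>B\<^esub>" using atom_idem[OF x] xB by metis
  then show False using x by (simp add: atoms_def primitive_idempotent_def)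
qed

lemma central_phi:
  assumes c: "central_idempotent A c"
  shows "central_idempotent B (\<phi> c)"
  unfolding central_idempotent_def
proof (intro conjI ballI)
  have cA: "c \<in> carrier A" "c \<otimes>\<^bsub>A\<^esub> c = c" using c by (auto simp: central_idempotent_def)
  show cB: "\<phi> c \<in> carrier B" "\<phi> c \<otimes>\<^bsub>B\<^esub> \<phi> c = \<phi> c"
    using cA by (simp_all add: phi_closed flip: phi_mult)
  fix b assume b: "b \<in> carrier B"
  have o: "\<phi> \<one>\<^bsub>A\<^esub> \<in> carrier B" by (simp add: phi_closed)
  obtain a where a: "a \<in> carrier A" "\<phi> \<one>\<^bsub>A\<^esub> \<otimes>\<^bsub>B\<^esub> b = \<phi> a"
    using phi_ideal(2)[OF A.one_closed b] by auto
  have "\<phi> c \<otimes>\<^bsub>B\<^esub> b = (\<phi> c \<otimes>\<^bsub>B\<^esub> \<phi> \<one>\<^bsub>A\<^esub>) \<otimes>\<^bsub>B\<^esub> b" by (simp add: one_phi cA)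
  also have "\<dots> = \<phi> (c \<otimes>\<^bsub>A\<^esub> a)" using a cA cB b o by (simp add: B.mult_assoc phi_mult)
  also have "c \<otimes>\<^bsub>A\<^esub> a = a \<otimes>\<^bsub>A\<^esub> c" using c a by (simp add: central_idempotent_def)
  also have "\<phi> (a \<otimes>\<^bsub>A\<^esub> c) = (b \<otimes>\<^bsub>B\<^esub> \<phi> \<one>\<^bsub>A\<^esub>) \<otimes>\<^bsub>B\<^esub> \<phi> c"
    using a cA b B.central_idempotentD(3)[OF central_phi_one b] by (simp add: phi_mult)
  also have "\<dots> = b \<otimes>\<^bsub>B\<^esub> \<phi> c" using b o cA cB by (simp add: B.mult_assoc one_phi)
  finally show "\<phi> c \<otimes>\<^bsub>B\<^esub> b = b \<otimes>\<^bsub>B\<^esub> \<phi> c" .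
qed

lemma central_phiD:
  assumes a: "a \<in> carrier A" and c: "central_idempotent B (\<phi> a)"
  shows "central_idempotent A a"
  unfolding central_idempotent_def
proof (intro conjI ballI)
  show "a \<otimes>\<^bsub>A\<^esub> a = a"
    using inj_onD[OF phi_inj, of "a \<otimes>\<^bsub>A\<^esub> a" a] a B.central_idempotentD(2)[OF c] by (simp add: phi_mult)
  fix b assume b: "b \<in> carrier A"
  show "a \<otimes>\<^bsub>A\<^esub> b = b \<otimes>\<^bsub>A\<^esub> a"
    using inj_onD[OF phi_inj, of "a \<otimes>\<^bsub>A\<^esub> b" "b \<otimes>\<^bsub>A\<^esub> a"] a b
      B.central_idempotentD(3)[OF c phi_closed[OF b]] by (simp add: phi_mult)
qed (rule a)

lemma phi_eq_zero: "a \<in> carrier A \<Longrightarrow> \<phi> a = \<zero>\<^bsub>B\<^esub> \<longleftrightarrow> a = \<zero>\<^bsub>A\<^esub>"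
  using phi_zero inj_onD[OF phi_inj, of a "\<zero>\<^bsub>A\<^esub>"] by auto

text \<open>A central idempotent c of B acts on \<open>\<phi> A\<close> as
  \<open>\<phi> \<one> \<otimes> c\<close>, which is the image of a central idempotent d of A;
  primitivity of x is applied to d.\<close>

lemma phi_primitive:
  assumes x: "primitive_idempotent A x"
  shows "\<phi> x \<in> atoms"
proof -
  have xc: "central_idempotent A x" and xA: "x \<in> carrier A" and nz: "x \<noteq> \<zero>\<^bsub>A\<^esub>"
    using x by (auto simp: primitive_idempotent_def central_idempotent_def)
  have "\<phi> x \<otimes>\<^bsub>B\<^esub> c = \<phi> x \<or> \<phi> x \<otimes>\<^bsub>B\<^esub> c = \<zero>\<^bsub>B\<^esub>" if c: "central_idempotent B c" for c
  proof -
    have cB: "c \<in> carrier B" using B.central_idempotentD(1)[OF c] .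
    have o: "\<phi> \<one>\<^bsub>A\<^esub> \<in> carrier B" by (simp add: phi_closed)
    obtain d where d: "d \<in> carrier A" "\<phi> \<one>\<^bsub>A\<^esub> \<otimes>\<^bsub>B\<^esub> c = \<phi> d"
      using phi_ideal(2)[OF A.one_closed cB] by auto
    have "central_idempotent B (\<phi> \<one>\<^bsub>A\<^esub> \<otimes>\<^bsub>B\<^esub> c)"
      unfolding central_idempotent_def
    proof (intro conjI ballI)
      show "\<phi> \<one>\<^bsub>A\<^esub> \<otimes>\<^bsub>B\<^esub> c \<in> carrier B" using o cB by (rule B.mult_closed)
      show "(\<phi> \<one>\<^bsub>A\<^esub> \<otimes>\<^bsub>B\<^esub> c) \<otimes>\<^bsub>B\<^esub> (\<phi> \<one>\<^bsub>A\<^esub> \<otimes>\<^bsub>B\<^esub> c) = \<phi> \<one>\<^bsub>A\<^esub> \<otimes>\<^bsub>B\<^esub> c"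
        using o cB by (metis B.central_idempotentD(2) B.central_left_commute B.mult_assoc B.mult_closed c central_phi_one)
      fix b assume b: "b \<in> carrier B"
      show "(\<phi> \<one>\<^bsub>A\<^esub> \<otimes>\<^bsub>B\<^esub> c) \<otimes>\<^bsub>B\<^esub> b = b \<otimes>\<^bsub>B\<^esub> (\<phi> \<one>\<^bsub>A\<^esub> \<otimes>\<^bsub>B\<^esub> c)"
        using o cB b by (metis B.central_idempotentD(3) B.central_left_commute B.mult_assoc c central_phi_one)
    qed
    then have "central_idempotent A d" using central_phiD d by simp
    then have "x \<otimes>\<^bsub>A\<^esub> d = x \<or> x \<otimes>\<^bsub>A\<^esub> d = \<zero>\<^bsub>A\<^esub>" using x by (simp add: primitive_idempotent_def)
    moreover have "\<phi> x \<otimes>\<^bsub>B\<^esub> c = \<phi> (x \<otimes>\<^bsub>A\<^esub> d)"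
    proof -
      have "\<phi> x \<otimes>\<^bsub>B\<^esub> c = (\<phi> x \<otimes>\<^bsub>B\<^esub> \<phi> \<one>\<^bsub>A\<^esub>) \<otimes>\<^bsub>B\<^esub> c" by (simp add: one_phi xA)
      then show ?thesis using xA d o cB by (simp add: B.mult_assoc phi_mult phi_closed)
    qed
    ultimately show ?thesis using phi_zero by auto
  qed
  then show ?thesis
    using central_phi[OF xc] nz phi_eq_zero[OF xA] by (simp add: atoms_def primitive_idempotent_def)
qed

lemma atom_in_phi:
  assumes x: "x \<in> atoms" and le: "\<phi> \<one>\<^bsub>A\<^esub> \<otimes>\<^bsub>B\<^esub> x = x"
  obtains y where "primitive_idempotent A y" "x = \<phi> y"
proof -
  obtain y where y: "y \<in> carrier A" "x = \<phi> y" using mem_phi_iff atom_closed[OF x] le by auto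
  have yc: "central_idempotent A y" using central_phiD y atom_central[OF x] by simp
  have "y \<otimes>\<^bsub>A\<^esub> c = y \<or> y \<otimes>\<^bsub>A\<^esub> c = \<zero>\<^bsub>A\<^esub>" if c: "central_idempotent A c" for c
  proof -
    have cA: "c \<in> carrier A" using c by (simp add: central_idempotent_def)
    have "\<phi> (y \<otimes>\<^bsub>A\<^esub> c) = \<phi> y \<or> \<phi> (y \<otimes>\<^bsub>A\<^esub> c) = \<zero>\<^bsub>B\<^esub>"
      using atom_mult_cases[OF x central_phi[OF c]] y cA by (simp add: phi_mult)
    then show ?thesis using inj_onD[OF phi_inj, of "y \<otimes>\<^bsub>A\<^esub> c" y] phi_eq_zero y cA by auto
  qed
  moreover have "y \<noteq> \<zero>\<^bsub>A\<^esub>"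
    using x phi_zero y by (auto simp: atoms_def primitive_idempotent_def)
  ultimately have "primitive_idempotent A y" using yc unfolding primitive_idempotent_def by blast
  then show ?thesis using that y by blast
qed

text \<open>The part of b in one translate is moved into \<open>\<phi> A\<close> by the action,
  where \<open>separate\<close> shows that it vanishes. An element of B whose parts in all
  translates vanish is zero by \<open>sum_of_unital_ideals_separate\<close>.\<close>

lemma atoms_separate:
  assumes b: "b \<in> carrier B" and z: "\<And>x. x \<in> atoms \<Longrightarrow> x \<otimes>\<^bsub>B\<^esub> b = \<zero>\<^bsub>B\<^esub>"
  shows "b = \<zero>\<^bsub>B\<^esub>"
proof -
  have eps_z: "eps g \<otimes>\<^bsub>B\<^esub> b = \<zero>\<^bsub>B\<^esub>" if g: "g \<in> carrier G" for g
  proof -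
    let ?c = "\<beta> (inv\<^bsub>G\<^esub> g) b"
    have c: "?c \<in> carrier B" using b g by (simp add: beta_closed)
    obtain a where a: "a \<in> carrier A" "\<phi> \<one>\<^bsub>A\<^esub> \<otimes>\<^bsub>B\<^esub> ?c = \<phi> a"
      using phi_ideal(2)[OF A.one_closed c] by auto
    have "a = \<zero>\<^bsub>A\<^esub>"
    proof (rule separate[OF a(1)])
      fix x assume x: "primitive_idempotent A x"
      then have xA: "x \<in> carrier A" by (simp add: primitive_idempotent_def central_idempotent_def)
      have "\<phi> (x \<otimes>\<^bsub>A\<^esub> a) = (\<phi> x \<otimes>\<^bsub>B\<^esub> \<phi> \<one>\<^bsub>A\<^esub>) \<otimes>\<^bsub>B\<^esub> ?c"
        using xA a c by (simp add: phi_mult B.mult_assoc phi_closed flip: a(2))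
      also have "\<dots> = \<phi> x \<otimes>\<^bsub>B\<^esub> ?c" using xA by (simp add: one_phi)
      also have "\<dots> = \<beta> (inv\<^bsub>G\<^esub> g) (\<beta> g (\<phi> x) \<otimes>\<^bsub>B\<^esub> b)"
        using xA g b by (simp add: beta_mult beta_inv beta_closed phi_closed)
      also have "\<dots> = \<zero>\<^bsub>B\<^esub>" using z[OF atom_beta[OF phi_primitive[OF x] g]] beta_zero g by simp
      finally show "x \<otimes>\<^bsub>A\<^esub> a = \<zero>\<^bsub>A\<^esub>" using phi_eq_zero xA a by simp
    qed
    then have "\<phi> \<one>\<^bsub>A\<^esub> \<otimes>\<^bsub>B\<^esub> ?c = \<zero>\<^bsub>B\<^esub>" using a phi_zero by simp
    moreover have "eps g \<otimes>\<^bsub>B\<^esub> b = \<beta> g (\<phi> \<one>\<^bsub>A\<^esub> \<otimes>\<^bsub>B\<^esub> ?c)"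
      using g b c by (simp add: beta_mult beta_inv phi_closed eps_def)
    ultimately show ?thesis using beta_zero g by simp
  qed
  obtain F f where F: "finite F" "F \<subseteq> carrier G" "f \<in> F \<rightarrow> carrier B"
    "\<And>g. g \<in> F \<Longrightarrow> eps g \<otimes>\<^bsub>B\<^esub> f g = f g" "b = (\<Oplus>\<^bsub>B\<^esub>g\<in>F. f g)"
    using sum_of_translates[OF b] by blast
  show ?thesis
  proof (rule B.sum_of_unital_ideals_separate[where c = eps, OF F(1) _ F(3) _ F(5)])
    fix g assume "g \<in> F"
    then have g: "g \<in> carrier G" using F(2) by blast
    show "central_idempotent B (eps g)" by (rule central_eps[OF g])
    show "eps g \<otimes>\<^bsub>B\<^esub> b = \<zero>\<^bsub>B\<^esub>" by (rule eps_z[OF g])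
  qed (rule F(4))
qed

lemma atoms_ext:
  assumes "b \<in> carrier B" "c \<in> carrier B" "\<And>x. x \<in> atoms \<Longrightarrow> x \<otimes>\<^bsub>B\<^esub> b = x \<otimes>\<^bsub>B\<^esub> c"
  shows "b = c"
proof -
  have "x \<otimes>\<^bsub>B\<^esub> (b \<ominus>\<^bsub>B\<^esub> c) = \<zero>\<^bsub>B\<^esub>" if x: "x \<in> atoms" for x
  proof -
    have "x \<otimes>\<^bsub>B\<^esub> (b \<ominus>\<^bsub>B\<^esub> c) = x \<otimes>\<^bsub>B\<^esub> c \<ominus>\<^bsub>B\<^esub> x \<otimes>\<^bsub>B\<^esub> c"
      using B.mult_minus_r[OF atom_closed[OF x] assms(1,2)] assms(3)[OF x] by simp
    also have "\<dots> = \<zero>\<^bsub>B\<^esub>"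
      unfolding a_minus_def by (rule B.M.r_neg[OF B.mult_closed[OF atom_closed[OF x] assms(2)]])
    finally show ?thesis .
  qed
  with B.M.minus_closed[OF assms(1,2)] have "b \<ominus>\<^bsub>B\<^esub> c = \<zero>\<^bsub>B\<^esub>" by (rule atoms_separate)
  then show ?thesis
    using assms B.M.minus_equality[of b "\<ominus>\<^bsub>B\<^esub> c"] by (simp add: a_minus_def B.M.minus_minus)
qed

text \<open>After cutting by \<open>eps g\<close> the family lives in a translate of A, so it is
  moved into A and glued there. Atoms outside this translate are orthogonal to \<open>eps g\<close>
  and see zero on both sides.\<close>

lemma atoms_glue_translate:
  assumes g: "g \<in> carrier G" and f: "\<And>x. x \<in> atoms \<Longrightarrow> f x \<in> carrier B"
  shows "\<exists>c\<in>carrier B. \<forall>x\<in>atoms. x \<otimes>\<^bsub>B\<^esub> c = x \<otimes>\<^bsub>B\<^esub> (eps g \<otimes>\<^bsub>B\<^esub> f x)"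
proof -
  have "\<exists>a\<in>carrier A. \<phi> a = \<phi> \<one>\<^bsub>A\<^esub> \<otimes>\<^bsub>B\<^esub> \<beta> (inv\<^bsub>G\<^esub> g) (f (\<beta> g (\<phi> y)))"
    if y: "primitive_idempotent A y" for y
  proof -
    have "\<beta> (inv\<^bsub>G\<^esub> g) (f (\<beta> g (\<phi> y))) \<in> carrier B"
      using f[OF atom_beta[OF phi_primitive[OF y] g]] g by (simp add: beta_closed)
    from phi_ideal(2)[OF A.one_closed this] show ?thesis by auto
  qed
  then obtain f' where f': "\<And>y. primitive_idempotent A y \<Longrightarrow> f' y \<in> carrier A"
    "\<And>y. primitive_idempotent A y \<Longrightarrow> \<phi> (f' y) = \<phi> \<one>\<^bsub>A\<^esub> \<otimes>\<^bsub>B\<^esub> \<beta> (inv\<^bsub>G\<^esub> g) (f (\<beta> g (\<phi> y)))"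
    by metis
  obtain a where a: "a \<in> carrier A" "\<And>y. primitive_idempotent A y \<Longrightarrow> y \<otimes>\<^bsub>A\<^esub> a = y \<otimes>\<^bsub>A\<^esub> f' y"
    using glue[of f'] f'(1) by blast
  have aB: "\<phi> a \<in> carrier B" "\<beta> g (\<phi> a) \<in> carrier B" using a g by (auto simp: phi_closed beta_closed)
  have epsB: "eps g \<in> carrier B" using g by (rule eps_closed)
  have ega: "eps g \<otimes>\<^bsub>B\<^esub> \<beta> g (\<phi> a) = \<beta> g (\<phi> a)"
    using g a by (simp add: eps_def one_phi phi_closed flip: beta_mult)
  have "x \<otimes>\<^bsub>B\<^esub> \<beta> g (\<phi> a) = x \<otimes>\<^bsub>B\<^esub> (eps g \<otimes>\<^bsub>B\<^esub> f x)" if x: "x \<in> atoms" for x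
  proof -
    have xB: "x \<in> carrier B" by (rule atom_closed[OF x])
    consider "x \<otimes>\<^bsub>B\<^esub> eps g = x" | "x \<otimes>\<^bsub>B\<^esub> eps g = \<zero>\<^bsub>B\<^esub>"
      using atom_mult_cases[OF x central_eps[OF g]] by blast
    then show ?thesis
    proof cases
      case 1
      let ?z = "\<beta> (inv\<^bsub>G\<^esub> g) x"
      have zB: "?z \<in> carrier B" using g xB by (simp add: beta_closed)
      have z: "?z \<in> atoms" using atom_beta[OF x] g by simp
      have "\<phi> \<one>\<^bsub>A\<^esub> \<otimes>\<^bsub>B\<^esub> ?z = \<beta> (inv\<^bsub>G\<^esub> g) (eps g \<otimes>\<^bsub>B\<^esub> x)"
        using g xB epsB by (simp add: beta_mult beta_eps eps_one)
      also have "\<dots> = ?z" using 1 B.central_idempotentD(3)[OF central_eps[OF g] xB] by simp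
      finally obtain y where y: "primitive_idempotent A y" "?z = \<phi> y"
        using atom_in_phi[OF z] by blast
      have yA: "y \<in> carrier A" using y by (simp add: primitive_idempotent_def central_idempotent_def)
      have xy: "x = \<beta> g (\<phi> y)" using y(2) beta_inv(2)[OF g xB] by simp
      have "x \<otimes>\<^bsub>B\<^esub> \<beta> g (\<phi> a) = \<beta> g (\<phi> (y \<otimes>\<^bsub>A\<^esub> a))"
        using yA a g by (simp add: xy phi_mult beta_mult phi_closed)
      also have "\<dots> = \<beta> g (\<phi> y) \<otimes>\<^bsub>B\<^esub> \<beta> g (\<phi> (f' y))"
        using a(2)[OF y(1)] f'(1)[OF y(1)] yA g by (simp add: phi_mult beta_mult phi_closed)
      also have "\<beta> g (\<phi> (f' y)) = eps g \<otimes>\<^bsub>B\<^esub> f x"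
        unfolding f'(2)[OF y(1)] using f[OF x] g
        by (simp flip: xy add: beta_mult beta_inv beta_closed phi_closed eps_def)
      finally show ?thesis using xy by simp
    next
      case 2
      have "x \<otimes>\<^bsub>B\<^esub> \<beta> g (\<phi> a) = (x \<otimes>\<^bsub>B\<^esub> eps g) \<otimes>\<^bsub>B\<^esub> \<beta> g (\<phi> a)"
        using xB epsB aB ega by (simp add: B.mult_assoc)
      moreover have "x \<otimes>\<^bsub>B\<^esub> (eps g \<otimes>\<^bsub>B\<^esub> f x) = (x \<otimes>\<^bsub>B\<^esub> eps g) \<otimes>\<^bsub>B\<^esub> f x"
        using xB epsB f[OF x] by (simp add: B.mult_assoc)
      ultimately show ?thesis using 2 aB f[OF x] by (simp add: B.mult_zero_l)
    qed
  qed
  then show ?thesis using aB by blast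
qed

text \<open>The factor b, a finite sum of elements of translates, reduces the gluing to finitely
  many translates; this is how an arbitrary family \<open>f\<close> can act on B without being glued
  in B itself.\<close>

lemma atoms_glue_right:
  assumes b: "b \<in> carrier B" and f: "\<And>x. x \<in> atoms \<Longrightarrow> f x \<in> carrier B"
  shows "\<exists>c\<in>carrier B. \<forall>x\<in>atoms. x \<otimes>\<^bsub>B\<^esub> c = x \<otimes>\<^bsub>B\<^esub> (b \<otimes>\<^bsub>B\<^esub> f x)"
  using b
proof (induction rule: translate_induct)
  case zero
  show ?case using f by (intro bexI[of _ "\<zero>\<^bsub>B\<^esub>"]) (auto simp: B.mult_zero_l)
next
  case (add b c)
  then obtain b' c' where "b' \<in> carrier B" "\<forall>x\<in>atoms. x \<otimes>\<^bsub>B\<^esub> b' = x \<otimes>\<^bsub>B\<^esub> (b \<otimes>\<^bsub>B\<^esub> f x)"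
    "c' \<in> carrier B" "\<forall>x\<in>atoms. x \<otimes>\<^bsub>B\<^esub> c' = x \<otimes>\<^bsub>B\<^esub> (c \<otimes>\<^bsub>B\<^esub> f x)" by blast
  then show ?case using add f
    by (intro bexI[of _ "b' \<oplus>\<^bsub>B\<^esub> c'"])
      (auto simp: B.mult_r_distr B.mult_l_distr B.mult_closed atom_closed)
next
  case (translate g b)
  have "\<exists>c\<in>carrier B. \<forall>x\<in>atoms. x \<otimes>\<^bsub>B\<^esub> c = x \<otimes>\<^bsub>B\<^esub> (eps g \<otimes>\<^bsub>B\<^esub> (b \<otimes>\<^bsub>B\<^esub> f x))"
    by (rule atoms_glue_translate) (use translate f B.mult_closed in auto)
  then obtain c where "c \<in> carrier B"
    "\<And>x. x \<in> atoms \<Longrightarrow> x \<otimes>\<^bsub>B\<^esub> c = x \<otimes>\<^bsub>B\<^esub> (eps g \<otimes>\<^bsub>B\<^esub> (b \<otimes>\<^bsub>B\<^esub> f x))" by blast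
  then show ?case
    using translate f by (intro bexI[of _ c]) (auto simp flip: B.mult_assoc simp add: eps_closed)
qed

lemma atoms_glue_left:
  assumes b: "b \<in> carrier B" and f: "\<And>x. x \<in> atoms \<Longrightarrow> f x \<in> carrier B"
  shows "\<exists>c\<in>carrier B. \<forall>x\<in>atoms. x \<otimes>\<^bsub>B\<^esub> c = x \<otimes>\<^bsub>B\<^esub> (f x \<otimes>\<^bsub>B\<^esub> b)"
  using b
proof (induction rule: translate_induct)
  case zero
  show ?case using f by (intro bexI[of _ "\<zero>\<^bsub>B\<^esub>"]) (auto simp: B.mult_zero_r)
next
  case (add b c)
  then obtain b' c' where "b' \<in> carrier B" "\<forall>x\<in>atoms. x \<otimes>\<^bsub>B\<^esub> b' = x \<otimes>\<^bsub>B\<^esub> (f x \<otimes>\<^bsub>B\<^esub> b)"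
    "c' \<in> carrier B" "\<forall>x\<in>atoms. x \<otimes>\<^bsub>B\<^esub> c' = x \<otimes>\<^bsub>B\<^esub> (f x \<otimes>\<^bsub>B\<^esub> c)" by blast
  then show ?case using add f
    by (intro bexI[of _ "b' \<oplus>\<^bsub>B\<^esub> c'"])
      (auto simp: B.mult_r_distr B.mult_l_distr B.mult_closed atom_closed)
next
  case (translate g b)
  have "\<exists>c\<in>carrier B. \<forall>x\<in>atoms. x \<otimes>\<^bsub>B\<^esub> c = x \<otimes>\<^bsub>B\<^esub> (eps g \<otimes>\<^bsub>B\<^esub> (f x \<otimes>\<^bsub>B\<^esub> b))"
    by (rule atoms_glue_translate) (use translate f B.mult_closed in auto)
  \<comment> \<open>On this side \<open>eps g\<close> has to pass \<open>f x\<close> to reach b,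
    which its centrality allows.\<close>
  moreover have "eps g \<otimes>\<^bsub>B\<^esub> (f x \<otimes>\<^bsub>B\<^esub> b) = f x \<otimes>\<^bsub>B\<^esub> b" if "x \<in> atoms" for x
    using B.central_left_commute[OF central_eps, of g "f x" b] translate f[OF that] by simp
  ultimately show ?case by simp
qed

end

section \<open>The multiplier algebra\<close>

lemma linear_endosD:
  assumes "T \<in> linear_endos K B"
  shows "T \<in> carrier B \<rightarrow>\<^sub>E carrier B" "x \<in> carrier B \<Longrightarrow> T x \<in> carrier B"
    "\<lbrakk>x \<in> carrier B; y \<in> carrier B\<rbrakk> \<Longrightarrow> T (x \<oplus>\<^bsub>B\<^esub> y) = T x \<oplus>\<^bsub>B\<^esub> T y"
    "\<lbrakk>k \<in> carrier K; x \<in> carrier B\<rbrakk> \<Longrightarrow> T (k \<odot>\<^bsub>B\<^esub> x) = k \<odot>\<^bsub>B\<^esub> T x"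
  using assms unfolding linear_endos_def by blast+

lemma linear_endosI:
  assumes "T \<in> carrier B \<rightarrow>\<^sub>E carrier B"
    and "\<And>x y. \<lbrakk>x \<in> carrier B; y \<in> carrier B\<rbrakk> \<Longrightarrow> T (x \<oplus>\<^bsub>B\<^esub> y) = T x \<oplus>\<^bsub>B\<^esub> T y"
    and "\<And>k x. \<lbrakk>k \<in> carrier K; x \<in> carrier B\<rbrakk> \<Longrightarrow> T (k \<odot>\<^bsub>B\<^esub> x) = k \<odot>\<^bsub>B\<^esub> T x"
  shows "T \<in> linear_endos K B"
  using assms unfolding linear_endos_def by blast

lemma multiplierD:
  assumes "\<gamma> \<in> carrier (multiplier_algebra K B)"
  shows "fst \<gamma> \<in> linear_endos K B" "snd \<gamma> \<in> linear_endos K B"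
    and "\<lbrakk>a \<in> carrier B; b \<in> carrier B\<rbrakk> \<Longrightarrow> fst \<gamma> (a \<otimes>\<^bsub>B\<^esub> b) = a \<otimes>\<^bsub>B\<^esub> fst \<gamma> b"
    and "\<lbrakk>a \<in> carrier B; b \<in> carrier B\<rbrakk> \<Longrightarrow> snd \<gamma> (a \<otimes>\<^bsub>B\<^esub> b) = snd \<gamma> a \<otimes>\<^bsub>B\<^esub> b"
    and "\<lbrakk>a \<in> carrier B; b \<in> carrier B\<rbrakk> \<Longrightarrow> fst \<gamma> a \<otimes>\<^bsub>B\<^esub> b = a \<otimes>\<^bsub>B\<^esub> snd \<gamma> b"
  using assms
  by (auto simp: multiplier_algebra_def left_module_endos_def right_module_endos_def)

lemma multiplierI:
  assumes "R \<in> linear_endos K B" "L \<in> linear_endos K B"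
    and "\<And>a b. \<lbrakk>a \<in> carrier B; b \<in> carrier B\<rbrakk> \<Longrightarrow> R (a \<otimes>\<^bsub>B\<^esub> b) = a \<otimes>\<^bsub>B\<^esub> R b"
    and "\<And>a b. \<lbrakk>a \<in> carrier B; b \<in> carrier B\<rbrakk> \<Longrightarrow> L (a \<otimes>\<^bsub>B\<^esub> b) = L a \<otimes>\<^bsub>B\<^esub> b"
    and "\<And>a b. \<lbrakk>a \<in> carrier B; b \<in> carrier B\<rbrakk> \<Longrightarrow> R a \<otimes>\<^bsub>B\<^esub> b = a \<otimes>\<^bsub>B\<^esub> L b"
  shows "(R, L) \<in> carrier (multiplier_algebra K B)"
  using assms
  by (simp add: multiplier_algebra_def left_module_endos_def right_module_endos_def)

lemma multiplier_add:
  "\<gamma> \<oplus>\<^bsub>multiplier_algebra K B\<^esub> \<gamma>' =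
    (\<lambda>b\<in>carrier B. fst \<gamma> b \<oplus>\<^bsub>B\<^esub> fst \<gamma>' b, \<lambda>b\<in>carrier B. snd \<gamma> b \<oplus>\<^bsub>B\<^esub> snd \<gamma>' b)"
  by (cases \<gamma>; cases \<gamma>') (simp add: multiplier_algebra_def)

lemma multiplier_zero:
  "\<zero>\<^bsub>multiplier_algebra K B\<^esub> = (\<lambda>b\<in>carrier B. \<zero>\<^bsub>B\<^esub>, \<lambda>b\<in>carrier B. \<zero>\<^bsub>B\<^esub>)"
  by (simp add: multiplier_algebra_def)

context nonunital_algebra
begin

lemma linear_endos_add:
  assumes "S \<in> linear_endos K B" "T \<in> linear_endos K B"
  shows "(\<lambda>b\<in>carrier B. S b \<oplus>\<^bsub>B\<^esub> T b) \<in> linear_endos K B"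
proof (rule linear_endosI)
  note S = linear_endosD(2-)[OF assms(1)] and T = linear_endosD(2-)[OF assms(2)]
  show "(\<lambda>b\<in>carrier B. S b \<oplus>\<^bsub>B\<^esub> T b) \<in> carrier B \<rightarrow>\<^sub>E carrier B"
    using S(1) T(1) by simp
  fix x y assume x: "x \<in> carrier B"
  show "(\<lambda>b\<in>carrier B. S b \<oplus>\<^bsub>B\<^esub> T b) (k \<odot>\<^bsub>B\<^esub> x) = k \<odot>\<^bsub>B\<^esub> (\<lambda>b\<in>carrier B. S b \<oplus>\<^bsub>B\<^esub> T b) x"
    if "k \<in> carrier K" for k
    using S T x that by (simp add: smult_r_distr)
  assume y: "y \<in> carrier B"
  show "(\<lambda>b\<in>carrier B. S b \<oplus>\<^bsub>B\<^esub> T b) (x \<oplus>\<^bsub>B\<^esub> y) =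
      (\<lambda>b\<in>carrier B. S b \<oplus>\<^bsub>B\<^esub> T b) x \<oplus>\<^bsub>B\<^esub> (\<lambda>b\<in>carrier B. S b \<oplus>\<^bsub>B\<^esub> T b) y"
    using S(1,2) T(1,2) x y by (simp add: M.a_ac)
qed

lemma linear_endos_uminus:
  assumes "S \<in> linear_endos K B"
  shows "(\<lambda>b\<in>carrier B. \<ominus>\<^bsub>B\<^esub> S b) \<in> linear_endos K B"
proof (rule linear_endosI)
  note S = linear_endosD(2-)[OF assms]
  show "(\<lambda>b\<in>carrier B. \<ominus>\<^bsub>B\<^esub> S b) \<in> carrier B \<rightarrow>\<^sub>E carrier B" using S(1) by simp
qed (use linear_endosD(2-)[OF assms] in \<open>simp_all add: M.minus_add smult_r_minus\<close>)

lemma linear_endos_zero: "(\<lambda>b\<in>carrier B. \<zero>\<^bsub>B\<^esub>) \<in> linear_endos K B"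
  by (rule linear_endosI) simp_all

lemma mult_uminus:
  "\<lbrakk>a \<in> carrier B; b \<in> carrier B\<rbrakk> \<Longrightarrow> a \<otimes>\<^bsub>B\<^esub> (\<ominus>\<^bsub>B\<^esub> b) = \<ominus>\<^bsub>B\<^esub> (a \<otimes>\<^bsub>B\<^esub> b)"
  "\<lbrakk>a \<in> carrier B; b \<in> carrier B\<rbrakk> \<Longrightarrow> (\<ominus>\<^bsub>B\<^esub> a) \<otimes>\<^bsub>B\<^esub> b = \<ominus>\<^bsub>B\<^esub> (a \<otimes>\<^bsub>B\<^esub> b)"
  using add_hom_uminus[OF M.abelian_group_axioms M.abelian_group_axioms mult_hom_l]
    add_hom_uminus[OF M.abelian_group_axioms M.abelian_group_axioms mult_hom_r] by blast+

lemma multiplier_add_closed: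
  assumes \<gamma>: "\<gamma> \<in> carrier (multiplier_algebra K B)" "\<gamma>' \<in> carrier (multiplier_algebra K B)"
  shows "\<gamma> \<oplus>\<^bsub>multiplier_algebra K B\<^esub> \<gamma>' \<in> carrier (multiplier_algebra K B)"
proof -
  note m = multiplierD[OF \<gamma>(1)] and m' = multiplierD[OF \<gamma>(2)]
  note c = linear_endosD(2)[OF m(1)] linear_endosD(2)[OF m(2)]
    linear_endosD(2)[OF m'(1)] linear_endosD(2)[OF m'(2)]
  show ?thesis
    unfolding multiplier_add
    by (rule multiplierI)
      (use linear_endos_add m(1,2) m'(1,2) in blast,
       use linear_endos_add m(1,2) m'(1,2) in blast,
       simp_all add: m(3-5) m'(3-5) c mult_closed mult_l_distr mult_r_distr)
qed

lemma multiplier_uminus_closed: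
  assumes \<gamma>: "\<gamma> \<in> carrier (multiplier_algebra K B)"
  shows "(\<lambda>b\<in>carrier B. \<ominus>\<^bsub>B\<^esub> fst \<gamma> b, \<lambda>b\<in>carrier B. \<ominus>\<^bsub>B\<^esub> snd \<gamma> b)
    \<in> carrier (multiplier_algebra K B)"
proof -
  note m = multiplierD[OF \<gamma>]
  note c = linear_endosD(2)[OF m(1)] linear_endosD(2)[OF m(2)]
  show ?thesis
    by (rule multiplierI)
      (use linear_endos_uminus m(1,2) in blast,
       use linear_endos_uminus m(1,2) in blast,
       simp_all add: m(3-5) c mult_closed mult_uminus)
qed

lemma multiplier_zero_closed:
  "\<zero>\<^bsub>multiplier_algebra K B\<^esub> \<in> carrier (multiplier_algebra K B)"
  unfolding multiplier_zero
  by (rule multiplierI) (simp_all add: linear_endos_zero mult_closed mult_zero_l mult_zero_r)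

lemma multiplier_ext:
  assumes "\<gamma> \<in> carrier (multiplier_algebra K B)" "\<gamma>' \<in> carrier (multiplier_algebra K B)"
    and "\<And>b. b \<in> carrier B \<Longrightarrow> fst \<gamma> b = fst \<gamma>' b" "\<And>b. b \<in> carrier B \<Longrightarrow> snd \<gamma> b = snd \<gamma>' b"
  shows "\<gamma> = \<gamma>'"
  by (rule prod_eqI)
    (rule PiE_ext[OF linear_endosD(1)[OF multiplierD(1)] linear_endosD(1)[OF multiplierD(1)]]
      PiE_ext[OF linear_endosD(1)[OF multiplierD(2)] linear_endosD(1)[OF multiplierD(2)]],
     use assms in blast, use assms in blast, use assms in blast)+

lemma multiplier_closed:
  assumes "\<gamma> \<in> carrier (multiplier_algebra K B)" "b \<in> carrier B"
  shows fst_multiplier_closed: "fst \<gamma> b \<in> carrier B" and snd_multiplier_closed: "snd \<gamma> b \<in> carrier B"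
  by (rule linear_endosD(2)[OF multiplierD(1)[OF assms(1)] assms(2)]
      linear_endosD(2)[OF multiplierD(2)[OF assms(1)] assms(2)])+

lemma multiplier_group: "abelian_group (multiplier_algebra K B)"
proof (rule abelian_groupI)
  let ?M = "multiplier_algebra K B"
  note c = multiplier_closed
  fix x y z assume x: "x \<in> carrier ?M"
  show "\<zero>\<^bsub>?M\<^esub> \<oplus>\<^bsub>?M\<^esub> x = x"
    by (rule multiplier_ext[OF multiplier_add_closed[OF multiplier_zero_closed x] x])
      (simp_all add: x multiplier_add multiplier_zero c)
  show "\<exists>y\<in>carrier ?M. y \<oplus>\<^bsub>?M\<^esub> x = \<zero>\<^bsub>?M\<^esub>"
  proof (rule bexI)
    show "(\<lambda>b\<in>carrier B. \<ominus>\<^bsub>B\<^esub> fst x b, \<lambda>b\<in>carrier B. \<ominus>\<^bsub>B\<^esub> snd x b) \<oplus>\<^bsub>?M\<^esub> x = \<zero>\<^bsub>?M\<^esub>"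
      using x by (simp add: multiplier_add multiplier_zero c M.l_neg cong: restrict_cong)
  qed (rule multiplier_uminus_closed[OF x])
  assume y: "y \<in> carrier ?M"
  show "x \<oplus>\<^bsub>?M\<^esub> y \<in> carrier ?M" by (rule multiplier_add_closed[OF x y])
  show "x \<oplus>\<^bsub>?M\<^esub> y = y \<oplus>\<^bsub>?M\<^esub> x"
    using x y by (simp add: multiplier_add c M.a_comm cong: restrict_cong)
  assume z: "z \<in> carrier ?M"
  show "(x \<oplus>\<^bsub>?M\<^esub> y) \<oplus>\<^bsub>?M\<^esub> z = x \<oplus>\<^bsub>?M\<^esub> (y \<oplus>\<^bsub>?M\<^esub> z)"
    using x y z by (simp add: multiplier_add c M.a_assoc cong: restrict_cong)
qed (rule multiplier_zero_closed)

text \<open>Computations with cochains of multipliers are done after evaluating the first component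
  at a fixed element; the second component is recovered by
  \<open>multiplier_atoms_ext\<close>.\<close>

lemma fst_multiplier_hom:
  "b \<in> carrier B \<Longrightarrow>
    (\<lambda>\<gamma>. fst \<gamma> b) \<in> hom (add_monoid (multiplier_algebra K B)) (add_monoid B)"
  by (auto simp: hom_def fst_multiplier_closed multiplier_add)

lemmas fst_multiplier_add = add_hom_add[OF multiplier_group M.abelian_group_axioms fst_multiplier_hom]
lemmas fst_multiplier_zero = add_hom_zero[OF multiplier_group M.abelian_group_axioms fst_multiplier_hom]
lemmas fst_multiplier_minus = add_hom_minus[OF multiplier_group M.abelian_group_axioms fst_multiplier_hom]
lemmas fst_multiplier_finsum = add_hom_finsum[OF multiplier_group M.abelian_group_axioms fst_multiplier_hom]
lemmas fst_multiplier_alt_sign = add_hom_alt_sign[OF multiplier_group M.abelian_group_axioms fst_multiplier_hom]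

end

text \<open>The multiplier algebra is the product of the algebras \<open>x B\<close> over the atoms \<open>x\<close>.\<close>

context enveloping
begin

lemma fst_multiplier_mult:
  assumes \<gamma>: "\<gamma> \<in> carrier (multiplier_algebra K B)" and c: "central_idempotent B c" and b: "b \<in> carrier B"
  shows "c \<otimes>\<^bsub>B\<^esub> fst \<gamma> b = b \<otimes>\<^bsub>B\<^esub> fst \<gamma> c"
  using multiplierD(3)[OF \<gamma> B.central_idempotentD(1)[OF c] b]
    multiplierD(3)[OF \<gamma> b B.central_idempotentD(1)[OF c]] B.central_idempotentD(3)[OF c b] by simp

text \<open>The values \<open>R x\<close> at atoms determine everything, since
  \<open>x \<otimes> R b = b \<otimes> R x\<close> and
  \<open>x \<otimes> L b = R x \<otimes> b\<close>, and atoms separate the elements of B.\<close>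

lemma multiplier_atoms_ext:
  assumes \<gamma>: "\<gamma> \<in> carrier (multiplier_algebra K B)" "\<gamma>' \<in> carrier (multiplier_algebra K B)"
    and eq: "\<And>x. x \<in> atoms \<Longrightarrow> fst \<gamma> x = fst \<gamma>' x"
  shows "\<gamma> = \<gamma>'"
proof (rule B.multiplier_ext[OF \<gamma>])
  fix b assume b: "b \<in> carrier B"
  show "fst \<gamma> b = fst \<gamma>' b"
  proof (rule atoms_ext)
    fix x assume x: "x \<in> atoms"
    show "x \<otimes>\<^bsub>B\<^esub> fst \<gamma> b = x \<otimes>\<^bsub>B\<^esub> fst \<gamma>' b"
      using fst_multiplier_mult[OF _ atom_central[OF x] b] \<gamma> eq[OF x] by simp
  qed (use b \<gamma> B.fst_multiplier_closed in auto)
  show "snd \<gamma> b = snd \<gamma>' b"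
  proof (rule atoms_ext)
    fix x assume x: "x \<in> atoms"
    show "x \<otimes>\<^bsub>B\<^esub> snd \<gamma> b = x \<otimes>\<^bsub>B\<^esub> snd \<gamma>' b"
      using multiplierD(5)[OF \<gamma>(1) atom_closed[OF x] b] multiplierD(5)[OF \<gamma>(2) atom_closed[OF x] b]
        eq[OF x] by simp
  qed (use b linear_endosD(2)[OF multiplierD(2)[OF \<gamma>(1)]] linear_endosD(2)[OF multiplierD(2)[OF \<gamma>(2)]] in auto)
qed

text \<open>T is obtained by choosing a glued element for each argument separately. It is
  nevertheless linear, because its components \<open>t x\<close> are and atoms separate.\<close>

lemma glue_linear_endo:
  assumes T: "\<And>b. b \<in> carrier B \<Longrightarrow> T b \<in> carrier B"
    and t: "\<And>x. x \<in> atoms \<Longrightarrow> t x \<in> hom (add_monoid B) (add_monoid B)"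
    and smult: "\<And>x k b. \<lbrakk>x \<in> atoms; k \<in> carrier K; b \<in> carrier B\<rbrakk> \<Longrightarrow> t x (k \<odot>\<^bsub>B\<^esub> b) = k \<odot>\<^bsub>B\<^esub> t x b"
    and eq: "\<And>x b. \<lbrakk>x \<in> atoms; b \<in> carrier B\<rbrakk> \<Longrightarrow> x \<otimes>\<^bsub>B\<^esub> T b = t x b"
  shows "restrict T (carrier B) \<in> linear_endos K B"
proof (rule linear_endosI)
  show "restrict T (carrier B) \<in> carrier B \<rightarrow>\<^sub>E carrier B" using T by simp
  have "T (b \<oplus>\<^bsub>B\<^esub> c) = T b \<oplus>\<^bsub>B\<^esub> T c" if b: "b \<in> carrier B" and c: "c \<in> carrier B" for b c
  proof (rule atoms_ext)
    fix x assume x: "x \<in> atoms"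
    show "x \<otimes>\<^bsub>B\<^esub> T (b \<oplus>\<^bsub>B\<^esub> c) = x \<otimes>\<^bsub>B\<^esub> (T b \<oplus>\<^bsub>B\<^esub> T c)"
      using x b c T atom_closed[OF x] add_hom_add[OF B.M.abelian_group_axioms B.M.abelian_group_axioms t[OF x] b c]
      by (simp add: B.mult_r_distr eq)
  qed (use b c T in simp_all)
  then show "restrict T (carrier B) (b \<oplus>\<^bsub>B\<^esub> c) = restrict T (carrier B) b \<oplus>\<^bsub>B\<^esub> restrict T (carrier B) c"
    if "b \<in> carrier B" "c \<in> carrier B" for b c using that by simp
  have "T (k \<odot>\<^bsub>B\<^esub> b) = k \<odot>\<^bsub>B\<^esub> T b" if k: "k \<in> carrier K" and b: "b \<in> carrier B" for k b
  proof (rule atoms_ext)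
    fix x assume x: "x \<in> atoms"
    show "x \<otimes>\<^bsub>B\<^esub> T (k \<odot>\<^bsub>B\<^esub> b) = x \<otimes>\<^bsub>B\<^esub> (k \<odot>\<^bsub>B\<^esub> T b)"
      using x b k T atom_closed[OF x] smult[OF x k b] by (simp add: B.smult_mult_r eq)
  qed (use b k T in simp_all)
  then show "restrict T (carrier B) (k \<odot>\<^bsub>B\<^esub> b) = k \<odot>\<^bsub>B\<^esub> restrict T (carrier B) b"
    if "k \<in> carrier K" "b \<in> carrier B" for k b using that by simp
qed

lemma atom_left_commute:
  "\<lbrakk>x \<in> atoms; a \<in> carrier B; b \<in> carrier B\<rbrakk> \<Longrightarrow> x \<otimes>\<^bsub>B\<^esub> (a \<otimes>\<^bsub>B\<^esub> b) = a \<otimes>\<^bsub>B\<^esub> (x \<otimes>\<^bsub>B\<^esub> b)"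
  by (rule B.central_left_commute[OF atom_central, symmetric])

text \<open>R and L glue the families \<open>b \<otimes> f x\<close> and
  \<open>f x \<otimes> b\<close>. Each identity required of a multiplier is checked after
  multiplication by an atom, where it becomes associativity together with centrality of the
  atom.\<close>

lemma multiplier_glue:
  assumes f: "\<And>x. x \<in> atoms \<Longrightarrow> f x \<in> carrier B"
  shows "\<exists>\<gamma>\<in>carrier (multiplier_algebra K B). \<forall>x\<in>atoms. fst \<gamma> x = x \<otimes>\<^bsub>B\<^esub> f x"
proof -
  obtain R where R: "\<And>b. b \<in> carrier B \<Longrightarrow> R b \<in> carrier B"
    "\<And>b x. \<lbrakk>b \<in> carrier B; x \<in> atoms\<rbrakk> \<Longrightarrow> x \<otimes>\<^bsub>B\<^esub> R b = x \<otimes>\<^bsub>B\<^esub> (b \<otimes>\<^bsub>B\<^esub> f x)"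
    using atoms_glue_right[of _ f] f by metis
  obtain L where L: "\<And>b. b \<in> carrier B \<Longrightarrow> L b \<in> carrier B"
    "\<And>b x. \<lbrakk>b \<in> carrier B; x \<in> atoms\<rbrakk> \<Longrightarrow> x \<otimes>\<^bsub>B\<^esub> L b = x \<otimes>\<^bsub>B\<^esub> (f x \<otimes>\<^bsub>B\<^esub> b)"
    using atoms_glue_left[of _ f] f by metis
  note xB = atom_closed
  let ?\<gamma> = "(restrict R (carrier B), restrict L (carrier B))"
  have "?\<gamma> \<in> carrier (multiplier_algebra K B)"
  proof (rule multiplierI)
    show "restrict R (carrier B) \<in> linear_endos K B"
      by (rule glue_linear_endo[where t = "\<lambda>x b. x \<otimes>\<^bsub>B\<^esub> (b \<otimes>\<^bsub>B\<^esub> f x)"])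
        (auto simp: hom_def R f xB B.mult_closed B.mult_l_distr B.mult_r_distr B.smult_mult_l B.smult_mult_r)
    show "restrict L (carrier B) \<in> linear_endos K B"
      by (rule glue_linear_endo[where t = "\<lambda>x b. x \<otimes>\<^bsub>B\<^esub> (f x \<otimes>\<^bsub>B\<^esub> b)"])
        (auto simp: hom_def L f xB B.mult_closed B.mult_l_distr B.mult_r_distr B.smult_mult_l B.smult_mult_r)
    fix a b assume a: "a \<in> carrier B" and b: "b \<in> carrier B"
    have "R (a \<otimes>\<^bsub>B\<^esub> b) = a \<otimes>\<^bsub>B\<^esub> R b"
    proof (rule atoms_ext)
      fix x assume x: "x \<in> atoms"
      have "x \<otimes>\<^bsub>B\<^esub> (a \<otimes>\<^bsub>B\<^esub> R b) = a \<otimes>\<^bsub>B\<^esub> (x \<otimes>\<^bsub>B\<^esub> (b \<otimes>\<^bsub>B\<^esub> f x))"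
        using atom_left_commute[OF x a R(1)[OF b]] R(2)[OF b x] by simp
      also have "\<dots> = x \<otimes>\<^bsub>B\<^esub> (a \<otimes>\<^bsub>B\<^esub> (b \<otimes>\<^bsub>B\<^esub> f x))"
        by (rule atom_left_commute[OF x a B.mult_closed[OF b f[OF x]], symmetric])
      finally show "x \<otimes>\<^bsub>B\<^esub> R (a \<otimes>\<^bsub>B\<^esub> b) = x \<otimes>\<^bsub>B\<^esub> (a \<otimes>\<^bsub>B\<^esub> R b)"
        using x a b f R by (simp add: B.mult_closed B.mult_assoc)
    qed (use a b R B.mult_closed in auto)
    then show "restrict R (carrier B) (a \<otimes>\<^bsub>B\<^esub> b) = a \<otimes>\<^bsub>B\<^esub> restrict R (carrier B) b"
      using a b B.mult_closed by simp
    have "L (a \<otimes>\<^bsub>B\<^esub> b) = L a \<otimes>\<^bsub>B\<^esub> b"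
    proof (rule atoms_ext)
      fix x assume x: "x \<in> atoms"
      have "x \<otimes>\<^bsub>B\<^esub> (L a \<otimes>\<^bsub>B\<^esub> b) = (x \<otimes>\<^bsub>B\<^esub> (f x \<otimes>\<^bsub>B\<^esub> a)) \<otimes>\<^bsub>B\<^esub> b"
        using x a b L xB[OF x] by (simp flip: B.mult_assoc)
      then show "x \<otimes>\<^bsub>B\<^esub> L (a \<otimes>\<^bsub>B\<^esub> b) = x \<otimes>\<^bsub>B\<^esub> (L a \<otimes>\<^bsub>B\<^esub> b)"
        using x a b f L xB[OF x] by (simp add: B.mult_closed B.mult_assoc)
    qed (use a b L B.mult_closed in auto)
    then show "restrict L (carrier B) (a \<otimes>\<^bsub>B\<^esub> b) = restrict L (carrier B) a \<otimes>\<^bsub>B\<^esub> b"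
      using a b B.mult_closed by simp
    have "R a \<otimes>\<^bsub>B\<^esub> b = a \<otimes>\<^bsub>B\<^esub> L b"
    proof (rule atoms_ext)
      fix x assume x: "x \<in> atoms"
      have "x \<otimes>\<^bsub>B\<^esub> (R a \<otimes>\<^bsub>B\<^esub> b) = (x \<otimes>\<^bsub>B\<^esub> (a \<otimes>\<^bsub>B\<^esub> f x)) \<otimes>\<^bsub>B\<^esub> b"
        using x a b R xB[OF x] by (simp flip: B.mult_assoc)
      also have "\<dots> = a \<otimes>\<^bsub>B\<^esub> (x \<otimes>\<^bsub>B\<^esub> (f x \<otimes>\<^bsub>B\<^esub> b))"
        using atom_left_commute[OF x a B.mult_closed[OF f[OF x] b]] a b f[OF x] xB[OF x]
        by (simp add: B.mult_assoc B.mult_closed)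
      also have "\<dots> = x \<otimes>\<^bsub>B\<^esub> (a \<otimes>\<^bsub>B\<^esub> L b)"
        using atom_left_commute[OF x a L(1)[OF b]] L(2)[OF b x] by simp
      finally show "x \<otimes>\<^bsub>B\<^esub> (R a \<otimes>\<^bsub>B\<^esub> b) = x \<otimes>\<^bsub>B\<^esub> (a \<otimes>\<^bsub>B\<^esub> L b)" .
    qed (use a b R L B.mult_closed in auto)
    then show "restrict R (carrier B) a \<otimes>\<^bsub>B\<^esub> b = a \<otimes>\<^bsub>B\<^esub> restrict L (carrier B) b"
      using a b by simp
  qed
  moreover have "fst ?\<gamma> x = x \<otimes>\<^bsub>B\<^esub> f x" if x: "x \<in> atoms" for x
  proof -
    \<comment> \<open>Only the components of \<open>R x\<close> are known. Distinct atoms are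
      orthogonal, so every component at an atom other than x is zero on both sides.\<close>
    have "R x = x \<otimes>\<^bsub>B\<^esub> f x"
    proof (rule atoms_ext)
      fix y assume y: "y \<in> atoms"
      show "y \<otimes>\<^bsub>B\<^esub> R x = y \<otimes>\<^bsub>B\<^esub> (x \<otimes>\<^bsub>B\<^esub> f x)"
      proof (cases "y \<otimes>\<^bsub>B\<^esub> x = \<zero>\<^bsub>B\<^esub>")
        case True
        have "y \<otimes>\<^bsub>B\<^esub> (x \<otimes>\<^bsub>B\<^esub> c) = \<zero>\<^bsub>B\<^esub>" if "c \<in> carrier B" for c
          using True that xB[OF x] xB[OF y] by (simp add: B.mult_zero_l flip: B.mult_assoc)
        then show ?thesis using R(2)[OF xB[OF x] y] f x y by simp
      next
        case False
        then have "x = y" using primitive_idempotent_eq[of B y x] x y by (simp add: atoms_def)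
        then show ?thesis using R(2)[OF xB[OF x] y] by simp
      qed
    qed (use x f R xB B.mult_closed in auto)
    then show ?thesis using xB[OF x] by simp
  qed
  ultimately show ?thesis by blast
qed

lemma multiplier_action_apply:
  assumes "g \<in> carrier G" "b \<in> carrier B"
  shows "fst (multiplier_action B \<beta> g \<gamma>) b = \<beta> g (fst \<gamma> (\<beta> (inv\<^bsub>G\<^esub> g) b))"
    and "snd (multiplier_action B \<beta> g \<gamma>) b = \<beta> g (snd \<gamma> (\<beta> (inv\<^bsub>G\<^esub> g) b))"
proof -
  have "inv_into (carrier B) (\<beta> g) b = \<beta> (inv\<^bsub>G\<^esub> g) b"
    by (rule inv_into_f_eq[OF action.inj_prop]) (use assms in \<open>simp_all add: beta_closed beta_inv\<close>)
  then show "fst (multiplier_action B \<beta> g \<gamma>) b = \<beta> g (fst \<gamma> (\<beta> (inv\<^bsub>G\<^esub> g) b))"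
    "snd (multiplier_action B \<beta> g \<gamma>) b = \<beta> g (snd \<gamma> (\<beta> (inv\<^bsub>G\<^esub> g) b))"
    using assms by (simp_all add: multiplier_action_def split_beta)
qed

lemma linear_endos_conj:
  assumes g: "g \<in> carrier G" and S: "S \<in> linear_endos K B" and T: "T \<in> extensional (carrier B)"
    and eq: "\<And>b. b \<in> carrier B \<Longrightarrow> T b = \<beta> g (S (\<beta> (inv\<^bsub>G\<^esub> g) b))"
  shows "T \<in> linear_endos K B"
proof (rule linear_endosI)
  note S' = linear_endosD(2-)[OF S]
  show "T \<in> carrier B \<rightarrow>\<^sub>E carrier B"
    using T g eq S'(1) by (auto simp: PiE_def beta_closed)
qed (use linear_endosD(2-)[OF S] g in \<open>simp_all add: eq beta_closed beta_add beta_smult\<close>)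

lemma multiplier_action_closed:
  assumes g: "g \<in> carrier G" and \<gamma>: "\<gamma> \<in> carrier (multiplier_algebra K B)"
  shows "multiplier_action B \<beta> g \<gamma> \<in> carrier (multiplier_algebra K B)"
proof -
  let ?R = "fst (multiplier_action B \<beta> g \<gamma>)" and ?L = "snd (multiplier_action B \<beta> g \<gamma>)"
  note m = multiplierD[OF \<gamma>]
  note c = linear_endosD(2)[OF m(1)] linear_endosD(2)[OF m(2)]
  have ext: "?R \<in> extensional (carrier B)" "?L \<in> extensional (carrier B)"
    by (simp_all add: multiplier_action_def split_beta)
  have "(?R, ?L) \<in> carrier (multiplier_algebra K B)"
  proof (rule multiplierI)
    show "?R \<in> linear_endos K B"
      by (rule linear_endos_conj[OF g m(1) ext(1)]) (simp add: multiplier_action_apply g)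
    show "?L \<in> linear_endos K B"
      by (rule linear_endos_conj[OF g m(2) ext(2)]) (simp add: multiplier_action_apply g)
    fix a b assume ab: "a \<in> carrier B" "b \<in> carrier B"
    show "?R (a \<otimes>\<^bsub>B\<^esub> b) = a \<otimes>\<^bsub>B\<^esub> ?R b" "?L (a \<otimes>\<^bsub>B\<^esub> b) = ?L a \<otimes>\<^bsub>B\<^esub> b"
      using g ab c
      by (simp_all add: multiplier_action_apply B.mult_closed beta_mult beta_closed m(3,4) beta_inv)
    have "?R a \<otimes>\<^bsub>B\<^esub> b = \<beta> g (fst \<gamma> (\<beta> (inv\<^bsub>G\<^esub> g) a) \<otimes>\<^bsub>B\<^esub> \<beta> (inv\<^bsub>G\<^esub> g) b)"
      using g ab c by (simp add: multiplier_action_apply beta_mult beta_closed beta_inv)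
    also have "\<dots> = \<beta> g (\<beta> (inv\<^bsub>G\<^esub> g) a \<otimes>\<^bsub>B\<^esub> snd \<gamma> (\<beta> (inv\<^bsub>G\<^esub> g) b))"
      using g ab by (simp add: m(5) beta_closed)
    also have "\<dots> = a \<otimes>\<^bsub>B\<^esub> ?L b"
      using g ab c by (simp add: multiplier_action_apply beta_mult beta_closed beta_inv)
    finally show "?R a \<otimes>\<^bsub>B\<^esub> b = a \<otimes>\<^bsub>B\<^esub> ?L b" .
  qed
  then show ?thesis by simp
qed

end

section \<open>Cohomologous globalizations\<close>

context enveloping
begin

text \<open>The action \<open>\<beta>\<close> serves twice: on B as the coefficient group, and on
  atoms as the index set. A multiplier becomes the function sending an atom x to its value
  \<open>R x\<close> in B.\<close>

sublocale IC: indexed_coefficients G B \<beta> atoms \<beta>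
proof unfold_locales
  fix g h x assume "g \<in> carrier G" "h \<in> carrier G"
  then show "x \<in> carrier B \<Longrightarrow> \<beta> (g \<otimes>\<^bsub>G\<^esub> h) x = \<beta> g (\<beta> h x)"
    and "x \<in> atoms \<Longrightarrow> \<beta> (g \<otimes>\<^bsub>G\<^esub> h) x = \<beta> g (\<beta> h x)"
    using beta_comp atom_closed by auto
qed (use beta_hom beta_one atom_beta atom_closed in auto)

abbreviation multipliers ("\<M>") where "\<M> \<equiv> multiplier_algebra K B"

abbreviation conj_action ("\<sigma>") where "\<sigma> \<equiv> multiplier_action B \<beta>"

lemma multiplier_coboundary_summands:
  assumes u: "u \<in> cochains \<M> G n" and gs: "gs \<in> tuples G (Suc n)"
  shows "\<sigma> (hd gs) (u (tl gs)) \<in> carrier \<M>"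
    and "(\<lambda>i. alt_sign \<M> i (u (merge G i gs))) \<in> {1..n} \<rightarrow> carrier \<M>"
    and "alt_sign \<M> (Suc n) (u (butlast gs)) \<in> carrier \<M>"
proof -
  interpret M: abelian_group \<M> by (rule B.multiplier_group)
  have uc: "u ks \<in> carrier \<M>" if "ks \<in> tuples G n" for ks
    using u that by (auto simp: cochains_def)
  show "\<sigma> (hd gs) (u (tl gs)) \<in> carrier \<M>"
    by (rule multiplier_action_closed[OF hd_tuples[OF gs] uc[OF tl_tuples[OF gs]]])
  show "(\<lambda>i. alt_sign \<M> i (u (merge G i gs))) \<in> {1..n} \<rightarrow> carrier \<M>"
    using M.alt_sign_closed[OF uc[OF G.merge_tuples[OF gs]]] by blast
  show "alt_sign \<M> (Suc n) (u (butlast gs)) \<in> carrier \<M>"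
    by (rule M.alt_sign_closed[OF uc[OF butlast_tuples[OF gs]]])
qed

lemma coboundary_map_closed:
  assumes u: "u \<in> cochains \<M> G n" and gs: "gs \<in> tuples G (Suc n)"
  shows "coboundary_map \<M> G \<sigma> n u gs \<in> carrier \<M>"
proof -
  interpret M: abelian_group \<M> by (rule B.multiplier_group)
  note s = multiplier_coboundary_summands[OF u gs]
  show ?thesis
    using M.a_closed[OF M.a_closed[OF s(1) M.finsum_closed[OF s(2)]] s(3)] gs
    by (simp add: coboundary_map_def)
qed

text \<open>Conjugation by \<open>\<beta> g\<close> evaluates at x to \<open>\<beta> g\<close>
  applied to the value at the atom translated by the inverse of g, which is the index shift built
  into \<open>indexed_coboundary\<close>.\<close>

lemma fst_coboundary_map:
  assumes u: "u \<in> cochains \<M> G n" and x: "x \<in> atoms" and gs: "gs \<in> tuples G (Suc n)"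
  shows "fst (coboundary_map \<M> G \<sigma> n u gs) x = IC.indexed_coboundary n (\<lambda>x gs. fst (u gs) x) x gs"
proof -
  interpret M: abelian_group \<M> by (rule B.multiplier_group)
  note s = multiplier_coboundary_summands[OF u gs]
  note xB = atom_closed[OF x]
  have uc: "u ks \<in> carrier \<M>" if "ks \<in> tuples G n" for ks
    using u that by (auto simp: cochains_def)
  have fs: "fst (\<Oplus>\<^bsub>\<M>\<^esub>i\<in>{1..n}. alt_sign \<M> i (u (merge G i gs))) x
      = (\<Oplus>\<^bsub>B\<^esub>i\<in>{1..n}. alt_sign B i (fst (u (merge G i gs)) x))"
  proof -
    have al: "fst (alt_sign \<M> i (u (merge G i gs))) x = alt_sign B i (fst (u (merge G i gs)) x)"
      if "i \<in> {1..n}" for i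
      by (rule B.fst_multiplier_alt_sign[OF xB uc[OF G.merge_tuples[OF gs that]]])
    have "alt_sign B i (fst (u (merge G i gs)) x) \<in> carrier B" if "i \<in> {1..n}" for i
      by (rule B.M.alt_sign_closed[OF B.fst_multiplier_closed[OF uc[OF G.merge_tuples[OF gs that]] xB]])
    then show ?thesis
      unfolding B.fst_multiplier_finsum[OF xB s(2)]
      by (intro B.M.finsum_cong' al) auto
  qed
  have "fst (coboundary_map \<M> G \<sigma> n u gs) x
      = fst (\<sigma> (hd gs) (u (tl gs))) x
        \<oplus>\<^bsub>B\<^esub> fst (\<Oplus>\<^bsub>\<M>\<^esub>i\<in>{1..n}. alt_sign \<M> i (u (merge G i gs))) x
        \<oplus>\<^bsub>B\<^esub> fst (alt_sign \<M> (Suc n) (u (butlast gs))) x"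
    using gs B.fst_multiplier_add[OF xB M.a_closed[OF s(1) M.finsum_closed[OF s(2)]] s(3)]
      B.fst_multiplier_add[OF xB s(1) M.finsum_closed[OF s(2)]]
    by (simp add: coboundary_map_def)
  then show ?thesis
    unfolding IC.indexed_coboundary_def fs
      B.fst_multiplier_alt_sign[OF xB uc[OF butlast_tuples[OF gs]]]
      multiplier_action_apply(1)[OF hd_tuples[OF gs] xB] .
qed

text \<open>Multiplying each component by its own index commutes with the action, since
  \<open>\<beta> g\<close> carries the translated atom to x. It is needed because gluing turns a
  primitive \<open>f x\<close> into \<open>x \<otimes> f x\<close>.\<close>

lemma mult_indexed_coboundary:
  assumes c: "\<And>x gs. \<lbrakk>x \<in> atoms; gs \<in> tuples G n\<rbrakk> \<Longrightarrow> c x gs \<in> carrier B"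
    and x: "x \<in> atoms" and gs: "gs \<in> tuples G (Suc n)"
  shows "x \<otimes>\<^bsub>B\<^esub> IC.indexed_coboundary n c x gs
    = IC.indexed_coboundary n (\<lambda>x gs. x \<otimes>\<^bsub>B\<^esub> c x gs) x gs"
proof -
  note xB = atom_closed[OF x] and h = hd_tuples[OF gs]
  note sgn = add_hom_alt_sign[OF B.M.abelian_group_axioms B.M.abelian_group_axioms B.mult_hom_l]
  let ?y = "\<beta> (inv\<^bsub>G\<^esub> hd gs) x"
  have y: "?y \<in> atoms" using x h by (simp add: atom_beta)
  have c0: "c ?y (tl gs) \<in> carrier B" by (rule c[OF y tl_tuples[OF gs]])
  have ci: "c x (merge G i gs) \<in> carrier B" if "i \<in> {1..n}" for i
    by (rule c[OF x G.merge_tuples[OF gs that]])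
  have cn: "c x (butlast gs) \<in> carrier B" by (rule c[OF x butlast_tuples[OF gs]])
  have P: "(\<lambda>i. alt_sign B i (c x (merge G i gs))) \<in> {1..n} \<rightarrow> carrier B"
    using ci B.M.alt_sign_closed by blast
  have "(\<Oplus>\<^bsub>B\<^esub>i\<in>{1..n}. x \<otimes>\<^bsub>B\<^esub> alt_sign B i (c x (merge G i gs)))
      = (\<Oplus>\<^bsub>B\<^esub>i\<in>{1..n}. alt_sign B i (x \<otimes>\<^bsub>B\<^esub> c x (merge G i gs)))"
    by (rule B.M.finsum_cong'[OF refl])
      (use sgn[OF xB ci] B.M.alt_sign_closed[OF B.mult_closed[OF xB ci]] in auto)
  then have S: "x \<otimes>\<^bsub>B\<^esub> (\<Oplus>\<^bsub>B\<^esub>i\<in>{1..n}. alt_sign B i (c x (merge G i gs)))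
      = (\<Oplus>\<^bsub>B\<^esub>i\<in>{1..n}. alt_sign B i (x \<otimes>\<^bsub>B\<^esub> c x (merge G i gs)))"
    using B.mult_finsum_r[OF xB P] by simp
  have T: "x \<otimes>\<^bsub>B\<^esub> \<beta> (hd gs) (c ?y (tl gs)) = \<beta> (hd gs) (?y \<otimes>\<^bsub>B\<^esub> c ?y (tl gs))"
    using h xB c0 by (simp add: beta_mult beta_closed beta_inv)
  have b0: "\<beta> (hd gs) (c ?y (tl gs)) \<in> carrier B" by (rule beta_closed[OF h c0])
  show ?thesis
    unfolding IC.indexed_coboundary_def
      B.mult_r_distr[OF xB B.M.a_closed[OF b0 B.M.finsum_closed[OF P]] B.M.alt_sign_closed[OF cn]]
      B.mult_r_distr[OF xB b0 B.M.finsum_closed[OF P]] sgn[OF xB cn] S T ..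
qed

section \<open>Partial cochains seen from an atom\<close>

lemma e_closed: "g \<in> carrier G \<Longrightarrow> e g \<in> carrier A"
  using idem by (simp add: central_idempotent_def)

lemma phi_alpha: "\<lbrakk>g \<in> carrier G; a \<in> D (inv\<^bsub>G\<^esub> g)\<rbrakk> \<Longrightarrow> \<phi> (\<alpha> g a) = \<beta> g (\<phi> a)"
  using env unfolding enveloping_action_def by (elim conjE) (drule bspec, assumption, erule bspec)

lemma alpha_closed:
  assumes g: "g \<in> carrier G" and a: "a \<in> D (inv\<^bsub>G\<^esub> g)"
  shows "\<alpha> g a \<in> carrier A"
proof -
  have "\<alpha> g a \<in> D g" using iso[OF g] a by (auto simp: algebra_iso_def algebra_hom_def)
  then show ?thesis using D_eq[OF g] e_closed[OF g] by auto
qed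

text \<open>By \<open>phi_e\<close>, \<open>\<phi> (e g)\<close> is the product of the units of the
  translates at the identity and at g; an atom lying in both translates absorbs it.\<close>

lemma atom_phi_e_mult:
  assumes x: "x \<in> atoms" and x1: "x \<otimes>\<^bsub>B\<^esub> eps \<one>\<^bsub>G\<^esub> = x"
    and g: "g \<in> carrier G" and xg: "x \<otimes>\<^bsub>B\<^esub> eps g = x" and a: "a \<in> carrier A"
  shows "x \<otimes>\<^bsub>B\<^esub> \<phi> (e g \<otimes>\<^bsub>A\<^esub> a) = x \<otimes>\<^bsub>B\<^esub> \<phi> a"
proof -
  note c = atom_closed[OF x] phi_closed[OF a] eps_closed[OF g] eps_closed[OF G.one_closed]
  have "x \<otimes>\<^bsub>B\<^esub> \<phi> (e g \<otimes>\<^bsub>A\<^esub> a) = ((x \<otimes>\<^bsub>B\<^esub> eps \<one>\<^bsub>G\<^esub>) \<otimes>\<^bsub>B\<^esub> eps g) \<otimes>\<^bsub>B\<^esub> \<phi> a"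
    using c a by (simp add: phi_mult e_closed g phi_e B.mult_assoc B.mult_closed flip: eps_one)
  then show ?thesis by (simp add: x1 xg)
qed

text \<open>Only an inclusion is sought: the product of idempotents starts with index 1, whereas
  \<open>parts\<close> also lists the vertex at index 0, the identity.\<close>

lemma tuple_idem_set:
  assumes "gs \<in> tuples G n"
  shows "(\<lambda>i. e (mult_list G (take i gs))) ` set [1..<Suc (length gs)] \<subseteq> e ` set (parts G \<one>\<^bsub>G\<^esub> gs)"
proof
  fix a assume "a \<in> (\<lambda>i. e (mult_list G (take i gs))) ` set [1..<Suc (length gs)]"
  then obtain i where "i \<in> set [1..<Suc (length gs)]" "a = e (mult_list G (take i gs))" by blast
  then have i: "i \<le> length gs" "a = e (mult_list G (take i gs))" by auto
  have gl: "gs \<in> lists (carrier G)" using assms by (simp add: tuples_lists)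
  have "mult_list G (take i gs) \<in> carrier G"
    by (rule G.mult_list_closed) (use gl in \<open>auto dest: in_set_takeD\<close>)
  then have "mult_list G (take i gs) = parts G \<one>\<^bsub>G\<^esub> gs ! i"
    using G.nth_parts[OF G.one_closed gl i(1)] by simp
  then show "a \<in> e ` set (parts G \<one>\<^bsub>G\<^esub> gs)" using i by (auto intro!: imageI nth_mem)
qed

lemma tuple_idem_closed:
  assumes gs: "gs \<in> tuples G n"
  shows "tuple_idem A G e gs \<in> carrier A"
proof -
  have "set (parts G \<one>\<^bsub>G\<^esub> gs) \<subseteq> carrier G"
    using G.parts_closed[OF G.one_closed] gs by (auto simp: tuples_lists)
  then have "e ` set (parts G \<one>\<^bsub>G\<^esub> gs) \<subseteq> carrier A" using e_closed by auto
  then show ?thesis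
    unfolding tuple_idem_def using tuple_idem_set[OF gs] by (intro A.mult_list_closed) auto
qed

lemma atom_tuple_idem:
  assumes x: "x \<in> atoms" and gs: "gs \<in> tuples G n"
    and le: "\<And>a. a \<in> set (parts G \<one>\<^bsub>G\<^esub> gs) \<Longrightarrow> x \<otimes>\<^bsub>B\<^esub> eps a = x"
  shows "x \<otimes>\<^bsub>B\<^esub> \<phi> (tuple_idem A G e gs) = x"
proof -
  have P: "set (parts G \<one>\<^bsub>G\<^esub> gs) \<subseteq> carrier G"
    using G.parts_closed[OF G.one_closed] gs by (auto simp: tuples_lists)
  then have eP: "e ` set (parts G \<one>\<^bsub>G\<^esub> gs) \<subseteq> carrier A" using e_closed by auto
  have x1: "x \<otimes>\<^bsub>B\<^esub> eps \<one>\<^bsub>G\<^esub> = x"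
    by (rule le) (cases gs; simp)
  \<comment> \<open>The empty product is the unit of A, absorbed by x because the identity is always
    a vertex; each further idempotent belongs to a vertex of the simplex and is absorbed by
    \<open>atom_phi_e_mult\<close>.\<close>
  have "x \<otimes>\<^bsub>B\<^esub> \<phi> (mult_list A as) = x" if "set as \<subseteq> e ` set (parts G \<one>\<^bsub>G\<^esub> gs)" for as
    using that
  proof (induction as)
    case Nil
    then show ?case using x1 by (simp add: mult_list_def eps_one)
  next
    case (Cons a as)
    then obtain g where g: "g \<in> set (parts G \<one>\<^bsub>G\<^esub> gs)" "a = e g" by auto
    have "mult_list A as \<in> carrier A" by (rule A.mult_list_closed) (use Cons.prems eP in auto)
    then show ?case
      using Cons atom_phi_e_mult[OF x x1 _ le[OF g(1)]] g P by (auto simp: mult_list_def)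
  qed
  then show ?thesis using tuple_idem_set[OF gs] by (simp add: tuple_idem_def)
qed

lemma par_cochain_closed:
  assumes "f \<in> par_cochains A G e n" "gs \<in> tuples G n"
  shows "f gs \<in> carrier A"
proof -
  have "f gs \<in> (\<lambda>a. tuple_idem A G e gs \<otimes>\<^bsub>A\<^esub> a) ` carrier A"
    using assms unfolding par_cochains_def by (rule PiE_mem)
  then show ?thesis using tuple_idem_closed[OF assms(2)] by auto
qed

text \<open>For an atom lying in the translates at all vertices, the idempotents in the partial
  coboundary are invisible and \<open>\<alpha>\<close> agrees with \<open>\<beta>\<close>, so what
  remains is a global coboundary. The restriction on vertices is what makes the hypothesis on the
  partial cocycles local.\<close>

lemma atom_par_coboundary:
  assumes v: "v \<in> par_cochains A G e m" and x: "x \<in> atoms" and gs: "gs \<in> tuples G (Suc m)"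
    and le: "\<And>a. a \<in> set (parts G \<one>\<^bsub>G\<^esub> gs) \<Longrightarrow> x \<otimes>\<^bsub>B\<^esub> eps a = x"
  shows "x \<otimes>\<^bsub>B\<^esub> \<phi> (par_coboundary_map A G \<alpha> e m v gs)
    = IC.indexed_coboundary m (\<lambda>x gs. x \<otimes>\<^bsub>B\<^esub> \<phi> (v gs)) x gs"
proof -
  note vA = par_cochain_closed[OF v]
  note xB = atom_closed[OF x] and h = hd_tuples[OF gs]
  let ?g = "hd gs" and ?z = "\<beta> (inv\<^bsub>G\<^esub> hd gs) x"
  have gl: "gs \<in> lists (carrier G)" and len: "length gs = Suc m" using gs by (auto simp: tuples_lists)
  have ih: "inv\<^bsub>G\<^esub> ?g \<in> carrier G" using h by simp
  have x1: "x \<otimes>\<^bsub>B\<^esub> eps \<one>\<^bsub>G\<^esub> = x" by (rule le) (cases gs; simp)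
  have P: "mult_list G (take i gs) \<in> carrier G \<and> x \<otimes>\<^bsub>B\<^esub> eps (mult_list G (take i gs)) = x"
    if i: "i \<le> Suc m" for i
  proof -
    have c: "mult_list G (take i gs) \<in> carrier G"
      by (rule G.mult_list_closed) (use gl in \<open>auto simp: in_lists_conv_set dest: in_set_takeD\<close>)
    then have "mult_list G (take i gs) = parts G \<one>\<^bsub>G\<^esub> gs ! i"
      using G.nth_parts[OF G.one_closed gl] i len by simp
    then show ?thesis using c le i len by (metis le_imp_less_Suc length_parts nth_mem)
  qed
  have xg: "x \<otimes>\<^bsub>B\<^esub> eps ?g = x"
    using P[of 1] h len by (cases gs) (auto simp: mult_list_def)
  have z: "?z \<in> atoms" by (rule atom_beta[OF x ih])
  \<comment> \<open>Translation by the inverse of g sends the vertices g and 1 to 1 and the inverse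
    of g, so the translated atom absorbs the idempotent under \<open>\<alpha>\<close>.\<close>
  have z1: "?z \<otimes>\<^bsub>B\<^esub> eps \<one>\<^bsub>G\<^esub> = ?z" and zg: "?z \<otimes>\<^bsub>B\<^esub> eps (inv\<^bsub>G\<^esub> ?g) = ?z"
    using arg_cong[OF xg, of "\<beta> (inv\<^bsub>G\<^esub> ?g)"] arg_cong[OF x1, of "\<beta> (inv\<^bsub>G\<^esub> ?g)"] h ih xB
    by (simp_all add: beta_mult beta_eps eps_closed)
  have v0: "v (tl gs) \<in> carrier A" by (rule vA[OF tl_tuples[OF gs]])
  have ev0: "e (inv\<^bsub>G\<^esub> ?g) \<otimes>\<^bsub>A\<^esub> v (tl gs) \<in> carrier A" using e_closed[OF ih] v0 by simp
  have d0: "e (inv\<^bsub>G\<^esub> ?g) \<otimes>\<^bsub>A\<^esub> v (tl gs) \<in> D (inv\<^bsub>G\<^esub> ?g)"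
    using D_eq[OF ih] v0 by simp
  have T0: "x \<otimes>\<^bsub>B\<^esub> \<phi> (\<alpha> ?g (e (inv\<^bsub>G\<^esub> ?g) \<otimes>\<^bsub>A\<^esub> v (tl gs))) = \<beta> ?g (?z \<otimes>\<^bsub>B\<^esub> \<phi> (v (tl gs)))"
  proof -
    have "x \<otimes>\<^bsub>B\<^esub> \<phi> (\<alpha> ?g (e (inv\<^bsub>G\<^esub> ?g) \<otimes>\<^bsub>A\<^esub> v (tl gs)))
        = \<beta> ?g (?z \<otimes>\<^bsub>B\<^esub> \<phi> (e (inv\<^bsub>G\<^esub> ?g) \<otimes>\<^bsub>A\<^esub> v (tl gs)))"
      unfolding phi_alpha[OF h d0]
      using beta_mult[OF h atom_closed[OF z] phi_closed[OF ev0]] beta_inv(2)[OF h xB] by simp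
    then show ?thesis unfolding atom_phi_e_mult[OF z z1 ih zg v0] .
  qed
  have a0: "\<alpha> ?g (e (inv\<^bsub>G\<^esub> ?g) \<otimes>\<^bsub>A\<^esub> v (tl gs)) \<in> carrier A" by (rule alpha_closed[OF h d0])
  have sgn: "x \<otimes>\<^bsub>B\<^esub> \<phi> (alt_sign A i (e (mult_list G (take j gs)) \<otimes>\<^bsub>A\<^esub> a)) = alt_sign B i (x \<otimes>\<^bsub>B\<^esub> \<phi> a)"
    and sgnA: "alt_sign A i (e (mult_list G (take j gs)) \<otimes>\<^bsub>A\<^esub> a) \<in> carrier A"
    and sgnB: "alt_sign B i (x \<otimes>\<^bsub>B\<^esub> \<phi> a) \<in> carrier B"
    if "j \<le> Suc m" "a \<in> carrier A" for i j a
  proof -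
    have ea: "e (mult_list G (take j gs)) \<otimes>\<^bsub>A\<^esub> a \<in> carrier A" using e_closed P that by simp
    then show "alt_sign A i (e (mult_list G (take j gs)) \<otimes>\<^bsub>A\<^esub> a) \<in> carrier A"
      by (rule A.M.alt_sign_closed)
    show "alt_sign B i (x \<otimes>\<^bsub>B\<^esub> \<phi> a) \<in> carrier B"
      by (rule B.M.alt_sign_closed[OF B.mult_closed[OF xB phi_closed[OF that(2)]]])
    show "x \<otimes>\<^bsub>B\<^esub> \<phi> (alt_sign A i (e (mult_list G (take j gs)) \<otimes>\<^bsub>A\<^esub> a)) = alt_sign B i (x \<otimes>\<^bsub>B\<^esub> \<phi> a)"
      unfolding add_hom_alt_sign[OF A.M.abelian_group_axioms B.M.abelian_group_axioms phi_hom ea]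
        add_hom_alt_sign[OF B.M.abelian_group_axioms B.M.abelian_group_axioms B.mult_hom_l[OF xB] phi_closed[OF ea]]
      using atom_phi_e_mult[OF x x1 _ _ that(2)] P[OF that(1)] by simp
  qed
  let ?s = "\<lambda>i. alt_sign A i (e (mult_list G (take i gs)) \<otimes>\<^bsub>A\<^esub> v (merge G i gs))"
  have vi: "v (merge G i gs) \<in> carrier A" if "i \<in> {1..m}" for i
    by (rule vA[OF G.merge_tuples[OF gs that]])
  have sA: "?s \<in> {1..m} \<rightarrow> carrier A" using sgnA[OF _ vi] by auto
  have sB: "(\<lambda>i. \<phi> (?s i)) \<in> {1..m} \<rightarrow> carrier B" using sA phi_closed by blast
  have S: "x \<otimes>\<^bsub>B\<^esub> \<phi> (\<Oplus>\<^bsub>A\<^esub>i\<in>{1..m}. ?s i)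
      = (\<Oplus>\<^bsub>B\<^esub>i\<in>{1..m}. alt_sign B i (x \<otimes>\<^bsub>B\<^esub> \<phi> (v (merge G i gs))))"
    unfolding add_hom_finsum[OF A.M.abelian_group_axioms B.M.abelian_group_axioms phi_hom sA]
      B.mult_finsum_r[OF xB sB]
    by (rule B.M.finsum_cong'[OF refl]) (use sgn[OF _ vi] sgnB[OF order_refl vi] in auto)
  have vn: "v (butlast gs) \<in> carrier A" by (rule vA[OF butlast_tuples[OF gs]])
  have full: "mult_list G gs = mult_list G (take (Suc m) gs)" using len by simp
  let ?n = "alt_sign A (Suc m) (e (mult_list G gs) \<otimes>\<^bsub>A\<^esub> v (butlast gs))"
  have nA: "?n \<in> carrier A" unfolding full by (rule sgnA[OF order_refl vn])
  have N: "x \<otimes>\<^bsub>B\<^esub> \<phi> ?n = alt_sign B (Suc m) (x \<otimes>\<^bsub>B\<^esub> \<phi> (v (butlast gs)))"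
    unfolding full by (rule sgn[OF order_refl vn])
  note SA = A.M.finsum_closed[OF sA]
  have "par_coboundary_map A G \<alpha> e m v gs = \<alpha> ?g (e (inv\<^bsub>G\<^esub> ?g) \<otimes>\<^bsub>A\<^esub> v (tl gs))
      \<oplus>\<^bsub>A\<^esub> (\<Oplus>\<^bsub>A\<^esub>i\<in>{1..m}. ?s i) \<oplus>\<^bsub>A\<^esub> ?n"
    using gs by (simp add: par_coboundary_map_def)
  then show ?thesis
    unfolding IC.indexed_coboundary_def
    by (simp only: phi_add[OF A.M.a_closed[OF a0 SA] nA] phi_add[OF a0 SA]
        B.mult_r_distr[OF xB B.M.a_closed[OF phi_closed[OF a0] phi_closed[OF SA]] phi_closed[OF nA]]
        B.mult_r_distr[OF xB phi_closed[OF a0] phi_closed[OF SA]] T0 S N)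
qed

theorem cohomologous_globalizations:
  assumes v: "v \<in> par_cochains A G e m"
    and w: "w1 \<in> par_cocycles A G \<alpha> e (Suc m)" "w2 \<in> par_cocycles A G \<alpha> e (Suc m)"
    and wv: "\<And>gs. gs \<in> tuples G (Suc m) \<Longrightarrow> w1 gs \<ominus>\<^bsub>A\<^esub> w2 gs = par_coboundary_map A G \<alpha> e m v gs"
    and u: "globalization K A G e B \<beta> \<phi> (Suc m) w1 u1" "globalization K A G e B \<beta> \<phi> (Suc m) w2 u2"
  shows "cohomologous \<M> G \<sigma> (Suc m) u1 u2"
proof -
  interpret M: abelian_group \<M> by (rule B.multiplier_group)
  have coch: "u1 \<in> cochains \<M> G (Suc m)" "u2 \<in> cochains \<M> G (Suc m)"
    using u by (auto simp: globalization_def cocycles_def)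
  have uc: "u1 gs \<in> carrier \<M>" "u2 gs \<in> carrier \<M>" if "gs \<in> tuples G (Suc m)" for gs
    using coch that by (auto simp: cochains_def)
  have wc: "w1 gs \<in> carrier A" "w2 gs \<in> carrier A" if "gs \<in> tuples G (Suc m)" for gs
    using w par_cochain_closed[OF _ that] by (auto simp: par_cocycles_def)
  define c1 c2 where "c1 x gs = fst (u1 gs) x" and "c2 x gs = fst (u2 gs) x" for x gs
  have c: "c1 x gs \<in> carrier B" "c2 x gs \<in> carrier B" if "x \<in> atoms" "gs \<in> tuples G (Suc m)" for x gs
    unfolding c1_def c2_def
    using B.fst_multiplier_closed[OF uc(1)[OF that(2)] atom_closed[OF that(1)]]
      B.fst_multiplier_closed[OF uc(2)[OF that(2)] atom_closed[OF that(1)]] by auto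
  have cocycle: "IC.indexed_coboundary (Suc m) c1 x gs = \<zero>\<^bsub>B\<^esub>"
    "IC.indexed_coboundary (Suc m) c2 x gs = \<zero>\<^bsub>B\<^esub>"
    if x: "x \<in> atoms" and gs: "gs \<in> tuples G (Suc (Suc m))" for x gs
  proof -
    have "coboundary_map \<M> G \<sigma> (Suc m) u1 gs = \<zero>\<^bsub>\<M>\<^esub>" "coboundary_map \<M> G \<sigma> (Suc m) u2 gs = \<zero>\<^bsub>\<M>\<^esub>"
      using u gs by (auto simp: globalization_def cocycles_def)
    then show "IC.indexed_coboundary (Suc m) c1 x gs = \<zero>\<^bsub>B\<^esub>"
      "IC.indexed_coboundary (Suc m) c2 x gs = \<zero>\<^bsub>B\<^esub>"
      unfolding c1_def[abs_def] c2_def[abs_def]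
      using fst_coboundary_map[OF coch(1) x gs] fst_coboundary_map[OF coch(2) x gs]
        B.fst_multiplier_zero[OF atom_closed[OF x]] by simp_all
  qed
  \<comment> \<open>The globalization identity evaluates the multiplier at \<open>\<phi>\<close> of
    the tuple idempotent. Multiplying by x on the left moves x inside the left module map, where it
    absorbs that idempotent, leaving the component at x.\<close>
  have local_glob: "fst (u' gs) x = x \<otimes>\<^bsub>B\<^esub> \<phi> (w gs)"
    if glob: "globalization K A G e B \<beta> \<phi> (Suc m) w u'"
      and x: "x \<in> atoms" and gs: "gs \<in> tuples G (Suc m)"
      and le: "\<And>a. a \<in> set (parts G \<one>\<^bsub>G\<^esub> gs) \<Longrightarrow> x \<otimes>\<^bsub>B\<^esub> eps a = x" for w u' x gs
  proof -
    have u': "u' gs \<in> carrier \<M>" and eq: "\<phi> (w gs) = fst (u' gs) (\<phi> (tuple_idem A G e gs))"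
      using glob gs by (auto simp: globalization_def cocycles_def cochains_def right_mult_def)
    show ?thesis
      unfolding eq using atom_tuple_idem[OF x gs le]
        multiplierD(3)[OF u' atom_closed[OF x] phi_closed[OF tuple_idem_closed[OF gs]]] by simp
  qed
  obtain f where f: "\<And>x gs. \<lbrakk>x \<in> atoms; gs \<in> tuples G m\<rbrakk> \<Longrightarrow> f x gs \<in> carrier B"
    and df: "\<And>x gs. \<lbrakk>x \<in> atoms; gs \<in> tuples G (Suc m)\<rbrakk> \<Longrightarrow>
      IC.indexed_coboundary m f x gs = c1 x gs \<ominus>\<^bsub>B\<^esub> c2 x gs"
  \<comment> \<open>\<open>P a x\<close> expresses that a is in \<open>S\<^sub>x\<close>, and the
    local primitive at x is the component of \<open>\<phi>\<close> applied to the partial primitive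
    v.\<close>
  proof (rule IC.coboundary_if_locally_coboundary[where m = m and P = "\<lambda>a x. x \<otimes>\<^bsub>B\<^esub> eps a = x"
        and c = "\<lambda>x gs. c1 x gs \<ominus>\<^bsub>B\<^esub> c2 x gs" and v = "\<lambda>x gs. x \<otimes>\<^bsub>B\<^esub> \<phi> (v gs)"])
    show "c1 x gs \<ominus>\<^bsub>B\<^esub> c2 x gs \<in> carrier B" if "x \<in> atoms" "gs \<in> tuples G (Suc m)" for x gs
      by (rule B.M.minus_closed[OF c[OF that]])
    show "IC.indexed_coboundary (Suc m) (\<lambda>x gs. c1 x gs \<ominus>\<^bsub>B\<^esub> c2 x gs) x gs = \<zero>\<^bsub>B\<^esub>"
      if "x \<in> atoms" "gs \<in> tuples G (Suc (Suc m))" for x gs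
      using IC.indexed_coboundary_minus[where c = c1 and c' = c2, OF c that] cocycle[OF that]
      by (simp add: a_minus_def B.M.r_neg)
    show "x \<otimes>\<^bsub>B\<^esub> \<phi> (v gs) \<in> carrier B" if "x \<in> atoms" "gs \<in> tuples G m" for x gs
      by (rule B.mult_closed[OF atom_closed[OF that(1)] phi_closed[OF par_cochain_closed[OF v that(2)]]])
    show "\<exists>a\<in>carrier G. x \<otimes>\<^bsub>B\<^esub> eps a = x" if "x \<in> atoms" for x
      by (rule atom_ex_translate[OF that])
    show "\<beta> g x \<otimes>\<^bsub>B\<^esub> eps (g \<otimes>\<^bsub>G\<^esub> a) = \<beta> g x"
      if "x \<in> atoms" "a \<in> carrier G" "g \<in> carrier G" "x \<otimes>\<^bsub>B\<^esub> eps a = x" for x a g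
      using arg_cong[OF that(4), of "\<beta> g"] that(1-3)
      by (simp add: beta_mult beta_eps eps_closed atom_closed)
    show "c1 x gs \<ominus>\<^bsub>B\<^esub> c2 x gs = IC.indexed_coboundary m (\<lambda>x gs. x \<otimes>\<^bsub>B\<^esub> \<phi> (v gs)) x gs"
      if x: "x \<in> atoms" and gs: "gs \<in> tuples G (Suc m)"
        and le: "\<And>a. a \<in> set (parts G \<one>\<^bsub>G\<^esub> gs) \<Longrightarrow> x \<otimes>\<^bsub>B\<^esub> eps a = x" for x gs
    proof -
      have "c1 x gs \<ominus>\<^bsub>B\<^esub> c2 x gs = x \<otimes>\<^bsub>B\<^esub> \<phi> (w1 gs) \<ominus>\<^bsub>B\<^esub> x \<otimes>\<^bsub>B\<^esub> \<phi> (w2 gs)"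
        unfolding c1_def c2_def using local_glob[OF u(1) x gs le] local_glob[OF u(2) x gs le] by simp
      also have "\<dots> = x \<otimes>\<^bsub>B\<^esub> \<phi> (w1 gs \<ominus>\<^bsub>A\<^esub> w2 gs)"
        using wc[OF gs] atom_closed[OF x] by (simp add: phi_minus B.mult_minus_r phi_closed)
      also have "\<dots> = IC.indexed_coboundary m (\<lambda>x gs. x \<otimes>\<^bsub>B\<^esub> \<phi> (v gs)) x gs"
        unfolding wv[OF gs] using le by (rule atom_par_coboundary[OF v x gs])
      finally show ?thesis .
    qed
  qed (rule that, assumption, assumption)
  \<comment> \<open>Nothing forces \<open>f x gs\<close> into the ideal of x, so the glued
    multiplier has component \<open>x \<otimes> f x gs\<close> instead.\<close>
  have "\<exists>\<gamma>\<in>carrier \<M>. \<forall>x\<in>atoms. fst \<gamma> x = x \<otimes>\<^bsub>B\<^esub> f x gs" if "gs \<in> tuples G m" for gs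
    by (rule multiplier_glue[where f = "\<lambda>x. f x gs"]) (rule f[OF _ that])
  then obtain \<gamma> where \<gamma>: "\<And>gs. gs \<in> tuples G m \<Longrightarrow> \<gamma> gs \<in> carrier \<M>"
    "\<And>gs x. \<lbrakk>gs \<in> tuples G m; x \<in> atoms\<rbrakk> \<Longrightarrow> fst (\<gamma> gs) x = x \<otimes>\<^bsub>B\<^esub> f x gs"
    by metis
  define t where "t = restrict \<gamma> (tuples G m)"
  have t: "t \<in> cochains \<M> G m" using \<gamma>(1) by (simp add: t_def cochains_def)
  have ft: "fst (t gs) x = x \<otimes>\<^bsub>B\<^esub> f x gs" if "x \<in> atoms" "gs \<in> tuples G m" for x gs
    using \<gamma>(2) that by (simp add: t_def)
  have "cochain_diff \<M> G (Suc m) u1 u2 = coboundary_map \<M> G \<sigma> m t"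
  proof
    fix gs
    show "cochain_diff \<M> G (Suc m) u1 u2 gs = coboundary_map \<M> G \<sigma> m t gs"
    proof (cases "gs \<in> tuples G (Suc m)")
      case gs: True
      have "u1 gs \<ominus>\<^bsub>\<M>\<^esub> u2 gs = coboundary_map \<M> G \<sigma> m t gs"
      proof (rule multiplier_atoms_ext[OF M.minus_closed[OF uc[OF gs]] coboundary_map_closed[OF t gs]])
        fix x assume x: "x \<in> atoms"
        have xf: "x \<otimes>\<^bsub>B\<^esub> f x gs \<in> carrier B" if "x \<in> atoms" "gs \<in> tuples G m" for x gs
          by (rule B.mult_closed[OF atom_closed[OF that(1)] f[OF that]])
        \<comment> \<open>The extra factor x is harmless on the other side: a component of a
          multiplier at x already lies in the ideal of x, because x is idempotent.\<close>
        have xi: "x \<otimes>\<^bsub>B\<^esub> fst \<gamma> x = fst \<gamma> x" if "\<gamma> \<in> carrier \<M>" for \<gamma>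
          using multiplierD(3)[OF that atom_closed[OF x] atom_closed[OF x]] atom_idem[OF x] by simp
        have "fst (coboundary_map \<M> G \<sigma> m t gs) x
            = IC.indexed_coboundary m (\<lambda>x gs. x \<otimes>\<^bsub>B\<^esub> f x gs) x gs"
          unfolding fst_coboundary_map[OF t x gs] by (rule IC.indexed_coboundary_cong[OF ft xf x gs])
        also have "\<dots> = x \<otimes>\<^bsub>B\<^esub> (c1 x gs \<ominus>\<^bsub>B\<^esub> c2 x gs)"
          using mult_indexed_coboundary[where c = f, OF f x gs] df[OF x gs] by simp
        also have "\<dots> = c1 x gs \<ominus>\<^bsub>B\<^esub> c2 x gs"
          unfolding B.mult_minus_r[OF atom_closed[OF x] c[OF x gs]]
          using xi[OF uc(1)[OF gs]] xi[OF uc(2)[OF gs]] by (simp add: c1_def c2_def)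
        also have "\<dots> = fst (u1 gs \<ominus>\<^bsub>\<M>\<^esub> u2 gs) x"
          unfolding B.fst_multiplier_minus[OF atom_closed[OF x] uc[OF gs]] c1_def c2_def ..
        finally show "fst (u1 gs \<ominus>\<^bsub>\<M>\<^esub> u2 gs) x = fst (coboundary_map \<M> G \<sigma> m t gs) x" ..
      qed
      then show ?thesis using gs by (simp add: cochain_diff_def)
    qed (simp add: cochain_diff_def coboundary_map_def)
  qed
  then show ?thesis using t by (auto simp: cohomologous_def coboundaries_def)
qed

text \<open>The zero cochain is a primitive of the difference. This reduces the claim about two
  globalizations of one cocycle to the case of cohomologous cocycles.\<close>

lemma par_cohomologous_refl:
  assumes w: "w \<in> par_cocycles A G \<alpha> e (Suc m)"
  shows "par_cohomologous A G \<alpha> e (Suc m) w w"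
proof -
  let ?z = "\<lambda>gs\<in>tuples G m. \<zero>\<^bsub>A\<^esub>"
  have z: "?z \<in> par_cochains A G e m"
    using tuple_idem_closed A.mult_zero_r unfolding par_cochains_def
    by (auto intro!: image_eqI[of _ _ "\<zero>\<^bsub>A\<^esub>"])
  have "cochain_diff A G (Suc m) w w = par_coboundary_map A G \<alpha> e m ?z"
  proof
    fix gs
    show "cochain_diff A G (Suc m) w w gs = par_coboundary_map A G \<alpha> e m ?z gs"
    proof (cases "gs \<in> tuples G (Suc m)")
      case gs: True
      have l: "cochain_diff A G (Suc m) w w gs = \<zero>\<^bsub>A\<^esub>"
        using gs par_cochain_closed[of w "Suc m" gs] w
        by (simp add: cochain_diff_def par_cocycles_def a_minus_def A.M.r_neg)
      note h = hd_tuples[OF gs]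
      have ih: "inv\<^bsub>G\<^esub> hd gs \<in> carrier G" using h by simp
      have g: "mult_list G (take i gs) \<in> carrier G" for i
        by (rule G.mult_list_closed) (use gs in \<open>auto simp: tuples_def dest: in_set_takeD\<close>)
      have full: "mult_list G gs \<in> carrier G"
        by (rule G.mult_list_closed) (use gs in \<open>auto simp: tuples_def\<close>)
      have "\<zero>\<^bsub>A\<^esub> \<in> D (inv\<^bsub>G\<^esub> hd gs)"
        using D_eq[OF ih] A.mult_zero_r[OF e_closed[OF ih]] by (metis A.M.zero_closed imageI)
      \<comment> \<open>The value of \<open>\<alpha>\<close> at zero is read off in B, where it
        becomes the value of \<open>\<beta>\<close> at zero, and brought back by injectivity of
        \<open>\<phi>\<close>.\<close>
      then have "\<phi> (\<alpha> (hd gs) \<zero>\<^bsub>A\<^esub>) = \<zero>\<^bsub>B\<^esub>" "\<alpha> (hd gs) \<zero>\<^bsub>A\<^esub> \<in> carrier A"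
        using phi_alpha[OF h] beta_zero[OF h] phi_zero alpha_closed[OF h] by auto
      then have a: "\<alpha> (hd gs) \<zero>\<^bsub>A\<^esub> = \<zero>\<^bsub>A\<^esub>" using phi_eq_zero by simp
      have s: "alt_sign A i \<zero>\<^bsub>A\<^esub> = \<zero>\<^bsub>A\<^esub>" for i by (simp add: alt_sign_def)
      have "(\<Oplus>\<^bsub>A\<^esub>i\<in>{1..m}. alt_sign A i (e (mult_list G (take i gs)) \<otimes>\<^bsub>A\<^esub> ?z (merge G i gs)))
          = (\<Oplus>\<^bsub>A\<^esub>i\<in>{1..m}. \<zero>\<^bsub>A\<^esub>)"
        using G.merge_tuples[OF gs]
        by (intro A.M.finsum_cong') (auto simp: A.mult_zero_r e_closed g s)
      then show ?thesis
        unfolding l using gs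
        by (simp add: par_coboundary_map_def tl_tuples[OF gs] butlast_tuples[OF gs]
            A.mult_zero_r e_closed ih full a s)
    qed (simp add: cochain_diff_def par_coboundary_map_def)
  qed
  then show ?thesis using z by (auto simp: par_cohomologous_def par_coboundaries_def)
qed

end

theorem theorem3p22:
  fixes K :: "('k, 'p) ring_scheme" and A :: "('k, 'a, 'q) module_scheme"
    and G :: "('g, 'r) monoid_scheme" and D :: "'g \<Rightarrow> 'a set"
    and \<alpha> :: "'g \<Rightarrow> 'a \<Rightarrow> 'a" and e :: "'g \<Rightarrow> 'a"
    and \<Lambda> :: "'l set" and S :: "'l \<Rightarrow> ('c, 't) ring_scheme"
    and B :: "('k, 'b, 's) module_scheme" and \<beta> :: "'g \<Rightarrow> 'b \<Rightarrow> 'b" and \<phi> :: "'a \<Rightarrow> 'b"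
    and n :: nat and w1 w2 :: "'g list \<Rightarrow> 'a"
    and u1 u2 :: "'g list \<Rightarrow> ('b \<Rightarrow> 'b) \<times> ('b \<Rightarrow> 'b)"
  assumes "unital_partial_action K A G D \<alpha> e"
    and "\<And>l. l \<in> \<Lambda> \<Longrightarrow> indecomposable_ring (S l)"
    and "A \<simeq> product_ring \<Lambda> S"
    and "n > 0"
    and "w1 \<in> par_cocycles A G \<alpha> e n" and "w2 \<in> par_cocycles A G \<alpha> e n"
    and "enveloping_action K A G D \<alpha> B \<beta> \<phi>"
    and "globalization K A G e B \<beta> \<phi> n w1 u1" and "globalization K A G e B \<beta> \<phi> n w2 u2"
  shows "(par_cohomologous A G \<alpha> e n w1 w2 \<longrightarrow>
            cohomologous (multiplier_algebra K B) G (multiplier_action B \<beta>) n u1 u2) \<and>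
         (\<forall>w \<in> par_cocycles A G \<alpha> e n. \<forall>u u'.
            globalization K A G e B \<beta> \<phi> n w u \<and> globalization K A G e B \<beta> \<phi> n w u' \<longrightarrow>
            cohomologous (multiplier_algebra K B) G (multiplier_action B \<beta>) n u u')"
proof -
  obtain m where n: "n = Suc m" using assms(4) gr0_implies_Suc by blast
  interpret U: unital_partial_action K A G D \<alpha> e by (rule assms(1))
  interpret enveloping K A G D \<alpha> e B \<beta> \<phi>
    by unfold_locales
      (rule assms(7), rule product_primitive_separate[OF U.A.ring_A assms(2,3)], assumption+,
       rule product_primitive_glue[OF U.A.ring_A assms(2,3)], assumption+)
  have main: "cohomologous (multiplier_algebra K B) G (multiplier_action B \<beta>) n u u'"
    if coh: "par_cohomologous A G \<alpha> e n w w'"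
      and w: "w \<in> par_cocycles A G \<alpha> e n" "w' \<in> par_cocycles A G \<alpha> e n"
      and u: "globalization K A G e B \<beta> \<phi> n w u" "globalization K A G e B \<beta> \<phi> n w' u'" for w w' u u'
  proof -
    obtain v where v: "v \<in> par_cochains A G e m"
      "cochain_diff A G (Suc m) w w' = par_coboundary_map A G \<alpha> e m v"
      using coh by (auto simp: n par_cohomologous_def par_coboundaries_def)
    have "w gs \<ominus>\<^bsub>A\<^esub> w' gs = par_coboundary_map A G \<alpha> e m v gs" if "gs \<in> tuples G (Suc m)" for gs
      using fun_cong[OF v(2), of gs] that by (simp add: cochain_diff_def)
    then show ?thesis using cohomologous_globalizations[OF v(1)] w u by (simp add: n)
  qed
  show ?thesis
  proof (intro conjI impI ballI allI)
    assume "par_cohomologous A G \<alpha> e n w1 w2"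
    then show "cohomologous (multiplier_algebra K B) G (multiplier_action B \<beta>) n u1 u2"
      by (rule main[OF _ assms(5,6,8,9)])
  next
    fix w u u' assume w: "w \<in> par_cocycles A G \<alpha> e n"
      and u: "globalization K A G e B \<beta> \<phi> n w u \<and> globalization K A G e B \<beta> \<phi> n w u'"
    then show "cohomologous (multiplier_algebra K B) G (multiplier_action B \<beta>) n u u'"
      using main[OF _ w w] par_cohomologous_refl[of w m] by (simp add: n)
  qed
qed

end
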